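(* Given $(\ell,u_0)\in Y'\times H$ and $\delta\in\Delta$, let $(\lambda^\delta,u^\delta)\in Y^\delta\times X^\delta$ be the solution of the saddle-point system, $\lambda_\delta:=A_s^{-1}(\ell-Bu^\delta)\in Y$, and $u:=B_e^{-1}(\ell,u_0)$. Assume that for some $\varrho\ge0$, $$\|\lambda_\delta-\lambda^\delta\|_Y\le\varrho\,\sqrt{\|\lambda^\delta\|_Y^2+\Big(1+\tfrac{1}{(\varrho+\frac12)^2}\Big)\|u_0-\gamma_0u^\delta\|_H^2}\,.$$ Then, with $\eta(\delta)^2:=\|\lambda^\delta\|_Y^2+\|u_0-\gamma_0u^\delta\|_H^2$, $$\tfrac{1}{c(\alpha)}\,\eta(\delta)^2\le\|u-u^\delta\|_X^2\le c(\alpha)\Big(1+\varrho^2\big(1+\tfrac{1}{(\varrho+\frac12)^2}\big)\Big)\eta(\delta)^2 .$$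
   Context: All spaces are real. Let $V\hookrightarrow H\simeq H'\hookrightarrow V'$ be a Gelfand triple of Hilbert spaces, $\mathrm{T}>0$, $\Xi:=(0,\mathrm{T})$. Let $A(t)\in\mathcal L(V,V')$ be bounded uniformly in a.e. $t\in\Xi$ and uniformly coercive: $(A(t)v)(v)\ge c\|v\|_V^2$ for all $v\in V$ and a.e. $t\in\Xi$, with $c>0$ independent of $t$ and $v$. Set $Y:=L_2(\Xi;V)$, $X:=Y\cap H^1(\Xi;V')$, and define $A\in\mathcal L(Y,Y')$, $\mathrm{d}_t\in\mathcal L(X,Y')$ by $(Aw)(v):=\int_\Xi (A(t)w(t))(v(t))\,dt$, $(\mathrm{d}_tw)(v):=\int_\Xi (\tfrac{dw}{dt}(t))(v(t))\,dt$. For $t\in\overline\Xi$, $\gamma_t\in\mathcal L(X,H)$ is the trace $w\mapsto w(t)$ (recall $X\hookrightarrow C(\overline\Xi;H)$). Set $B:=\mathrm{d}_t+A$ and $B_e:=(B,\gamma_0)\colon X\to Y'\times H$, which is boundedly invertible. Set $A_s:=\frac12(A+A')$, $A_a:=\frac12(A-A')$ (with $A'\colon Y\to Y'$ the adjoint). Norms: $\|v\|_Y:=\sqrt{(A_sv)(v)}$, $\|\cdot\|_{Y'}$ the corresponding dual norm, $\|w\|_X:=\sqrt{\|w\|_Y^2+\|\mathrm{d}_tw\|_{Y'}^2+\|\gamma_{\mathrm T}w\|_H^2}$. Set $\alpha:=\|A_a\|_{\mathcal L(Y,Y')}$ and $c(\alpha):=1+\frac{\alpha}{2}\big(\alpha+\sqrt{\alpha^2+4}\big)$.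 $(X^\delta)_{\delta\in\Delta}$, $(Y^\delta)_{\delta\in\Delta}$ are families of closed non-trivial subspaces of $X$ and $Y$. The index set $\Delta$ contains $\infty$, with $X^\infty=X$, $Y^\infty=Y$; for $\delta\ne\infty$ the spaces are finite-dimensional. It is always assumed that $X^\delta\subset Y^\delta$ for all $\delta\in\Delta$. For $g\in Y'$ put $\|g\|_{(Y^\delta)'}:=\sup_{0\ne v\in Y^\delta}g(v)/\|v\|_Y$. The saddle-point system, which is uniquely solvable, is: find $(\lambda^\delta,u^\delta)\in Y^\delta\times X^\delta$ with $(A_s\lambda^\delta)(v)+(Bu^\delta)(v)=\ell(v)$ for all $v\in Y^\delta$, and $(Bw)(\lambda^\delta)+\langle u_0-\gamma_0u^\delta,\gamma_0w\rangle_H=0$ for all $w\in X^\delta$. Equivalently $u^\delta=\operatorname{argmin}_{w\in X^\delta}\|\ell-Bw\|_{(Y^\delta)'}^2+\|u_0-\gamma_0w\|_H^2$, with $\lambda^\delta\in Y^\delta$ the Riesz lift of $\ell-Bu^\delta$ in $Y^\delta$. *)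

theory Defs
  imports "HOL-Analysis.Analysis"
begin

text \<open>
  Elements of the Bochner spaces are represented by functions on the reals, of which only the
  values on \<open>(0,T)\<close> matter, and only up to null sets.  Accordingly the norms below are seminorms
  on functions, and ``\<open>\<noteq> 0\<close>'' is read as ``not almost everywhere \<open>0\<close>''.
  Functionals on \<open>Y\<close>, and operators from \<open>Y\<close> or \<open>X\<close> to \<open>Y'\<close>, are HOL functions on such
  representatives; only their values on representatives in \<open>Y\<close> matter.
\<close>

subsection \<open>Gelfand triples and Bochner spaces\<close>

definition gelfand_embedding ::
    "('v::{real_inner,complete_space} \<Rightarrow>\<^sub>L 'h::{real_inner,complete_space}) \<Rightarrow> bool" where
  "gelfand_embedding \<iota> \<longleftrightarrow> inj (blinfun_apply \<iota>) \<and> closure (range (blinfun_apply \<iota>)) = UNIV"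

text \<open>The embedding of \<open>H \<simeq> H'\<close> into \<open>V'\<close> sends \<open>h\<close> to the functional \<open>v \<mapsto> \<langle>h, \<iota> v\<rangle>\<close>.\<close>

definition H_to_dual ::
    "('v::{real_inner,complete_space} \<Rightarrow>\<^sub>L 'h::{real_inner,complete_space}) \<Rightarrow> 'h \<Rightarrow> ('v \<Rightarrow>\<^sub>L real)" where
  "H_to_dual \<iota> h = blinfun_inner_right h o\<^sub>L \<iota>"

abbreviation Xi :: "real \<Rightarrow> real measure" where
  "Xi T \<equiv> lebesgue_on {0<..<T}"

text \<open>
  Strong (Bochner) measurability.  The Hilbert spaces are not assumed separable, so this is not
  the same as Borel measurability.
\<close>

definition strongly_measurable :: "'a measure \<Rightarrow> ('a \<Rightarrow> 'b::topological_space) \<Rightarrow> bool" where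
  "strongly_measurable M f \<longleftrightarrow>
     (\<exists>s. (\<forall>i. simple_function M (s i)) \<and> (AE x in M. (\<lambda>i. s i x) \<longlonglongrightarrow> f x))"

definition L2 :: "real \<Rightarrow> (real \<Rightarrow> 'b::real_normed_vector) set" where
  "L2 T = {f. strongly_measurable (Xi T) f \<and> integrable (Xi T) (\<lambda>t. (norm (f t))\<^sup>2)}"

definition norm_L2 :: "real \<Rightarrow> (real \<Rightarrow> 'b::real_normed_vector) \<Rightarrow> real" where
  "norm_L2 T f = sqrt (LINT t|Xi T. (norm (f t))\<^sup>2)"

text \<open>Smooth functions with compact support in \<open>(0,T)\<close>.\<close>

definition test_function :: "real \<Rightarrow> (real \<Rightarrow> real) \<Rightarrow> bool" where
  "test_function T \<phi> \<longleftrightarrow>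
     (\<forall>n t. (deriv ^^ n) \<phi> field_differentiable at t) \<and>
     (\<exists>a b. 0 < a \<and> b < T \<and> (\<forall>t. t \<notin> {a..b} \<longrightarrow> \<phi> t = 0))"

text \<open>
  \<open>g\<close> is the weak derivative of \<open>f\<close>, that is \<open>\<integral> \<phi>' f = - \<integral> \<phi> g\<close> for all test functions \<open>\<phi>\<close>.
  For \<open>f\<close>, \<open>g\<close> in \<open>L2 T\<close> these are integrals of Bochner integrable \<open>V'\<close>-valued functions, and the
  equation in \<open>V'\<close> is written out by applying both sides to an arbitrary \<open>v\<close>.
\<close>

definition weak_derivative ::
    "real \<Rightarrow> (real \<Rightarrow> ('v::real_normed_vector \<Rightarrow>\<^sub>L real)) \<Rightarrow> (real \<Rightarrow> ('v \<Rightarrow>\<^sub>L real)) \<Rightarrow> bool" where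
  "weak_derivative T f g \<longleftrightarrow>
     (\<forall>\<phi>. test_function T \<phi> \<longrightarrow>
        (\<forall>v. (LINT t|Xi T. deriv \<phi> t * f t v) = - (LINT t|Xi T. \<phi> t * g t v)))"

definition H1_dual :: "real \<Rightarrow> (real \<Rightarrow> ('v::real_normed_vector \<Rightarrow>\<^sub>L real)) set" where
  "H1_dual T = {f \<in> L2 T. \<exists>g \<in> L2 T. weak_derivative T f g}"

definition Y_space :: "real \<Rightarrow> (real \<Rightarrow> 'v::{real_inner,complete_space}) set" where
  "Y_space T = L2 T"

definition X_space ::
    "real \<Rightarrow> ('v::{real_inner,complete_space} \<Rightarrow>\<^sub>L 'h::{real_inner,complete_space}) \<Rightarrow> (real \<Rightarrow> 'v) set" where
  "X_space T \<iota> = {w \<in> Y_space T. (\<lambda>t. H_to_dual \<iota> (\<iota> (w t))) \<in> H1_dual T}"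

text \<open>The weak derivative is determined up to a null set, so the choice made here is immaterial.\<close>

definition time_derivative ::
    "real \<Rightarrow> ('v::{real_inner,complete_space} \<Rightarrow>\<^sub>L 'h::{real_inner,complete_space}) \<Rightarrow>
     (real \<Rightarrow> 'v) \<Rightarrow> real \<Rightarrow> ('v \<Rightarrow>\<^sub>L real)" where
  "time_derivative T \<iota> w =
     (SOME g. g \<in> L2 T \<and> weak_derivative T (\<lambda>t. H_to_dual \<iota> (\<iota> (w t))) g)"

text \<open>
  By the embedding of \<open>X\<close> into \<open>C([0,T];H)\<close>, every element of \<open>X\<close> has a continuous representative,
  unique on \<open>[0,T]\<close>; the trace at \<open>t\<close> is its value at \<open>t\<close>.
\<close>

definition continuous_representative ::
    "real \<Rightarrow> ('v::{real_inner,complete_space} \<Rightarrow>\<^sub>L 'h::{real_inner,complete_space}) \<Rightarrow>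
     (real \<Rightarrow> 'v) \<Rightarrow> real \<Rightarrow> 'h" where
  "continuous_representative T \<iota> w =
     (SOME f. continuous_on {0..T} f \<and> (AE t in Xi T. f t = \<iota> (w t)))"

definition trace_at ::
    "real \<Rightarrow> ('v::{real_inner,complete_space} \<Rightarrow>\<^sub>L 'h::{real_inner,complete_space}) \<Rightarrow>
     real \<Rightarrow> (real \<Rightarrow> 'v) \<Rightarrow> 'h" where
  "trace_at T \<iota> t w = continuous_representative T \<iota> w t"

subsection \<open>The parabolic operator\<close>

text \<open>
  The first clause is the measurability that makes \<open>\<integral> (A(t) w(t))(v(t)) dt\<close> meaningful.
\<close>

definition admissible_operator ::
    "real \<Rightarrow> (real \<Rightarrow> ('v::{real_inner,complete_space} \<Rightarrow>\<^sub>L 'v \<Rightarrow>\<^sub>L real)) \<Rightarrow> bool" where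
  "admissible_operator T A \<longleftrightarrow>
     (\<forall>w v. (\<lambda>t. A t w v) \<in> borel_measurable (Xi T)) \<and>
     (\<exists>C. AE t in Xi T. norm (A t) \<le> C) \<and>
     (\<exists>c>0. AE t in Xi T. \<forall>v. A t v v \<ge> c * (norm v)\<^sup>2)"

definition op_A ::
    "real \<Rightarrow> (real \<Rightarrow> ('v::{real_inner,complete_space} \<Rightarrow>\<^sub>L 'v \<Rightarrow>\<^sub>L real)) \<Rightarrow>
     (real \<Rightarrow> 'v) \<Rightarrow> (real \<Rightarrow> 'v) \<Rightarrow> real" where
  "op_A T A w v = (LINT t|Xi T. A t (w t) (v t))"

text \<open>The adjoint of \<open>F : Y \<rightarrow> Y'\<close>, under the identification of \<open>Y''\<close> with \<open>Y\<close>.\<close>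

definition adjoint_op :: "('y \<Rightarrow> 'y \<Rightarrow> real) \<Rightarrow> 'y \<Rightarrow> 'y \<Rightarrow> real" where
  "adjoint_op F w v = F v w"

definition op_As ::
    "real \<Rightarrow> (real \<Rightarrow> ('v::{real_inner,complete_space} \<Rightarrow>\<^sub>L 'v \<Rightarrow>\<^sub>L real)) \<Rightarrow>
     (real \<Rightarrow> 'v) \<Rightarrow> (real \<Rightarrow> 'v) \<Rightarrow> real" where
  "op_As T A w v = (op_A T A w v + adjoint_op (op_A T A) w v) / 2"

definition op_Aa ::
    "real \<Rightarrow> (real \<Rightarrow> ('v::{real_inner,complete_space} \<Rightarrow>\<^sub>L 'v \<Rightarrow>\<^sub>L real)) \<Rightarrow>
     (real \<Rightarrow> 'v) \<Rightarrow> (real \<Rightarrow> 'v) \<Rightarrow> real" where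
  "op_Aa T A w v = (op_A T A w v - adjoint_op (op_A T A) w v) / 2"

definition op_dt ::
    "real \<Rightarrow> ('v::{real_inner,complete_space} \<Rightarrow>\<^sub>L 'h::{real_inner,complete_space}) \<Rightarrow>
     (real \<Rightarrow> 'v) \<Rightarrow> (real \<Rightarrow> 'v) \<Rightarrow> real" where
  "op_dt T \<iota> w v = (LINT t|Xi T. time_derivative T \<iota> w t (v t))"

definition op_B ::
    "real \<Rightarrow> ('v::{real_inner,complete_space} \<Rightarrow>\<^sub>L 'h::{real_inner,complete_space}) \<Rightarrow>
     (real \<Rightarrow> ('v \<Rightarrow>\<^sub>L 'v \<Rightarrow>\<^sub>L real)) \<Rightarrow> (real \<Rightarrow> 'v) \<Rightarrow> (real \<Rightarrow> 'v) \<Rightarrow> real" where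
  "op_B T \<iota> A w v = op_dt T \<iota> w v + op_A T A w v"

definition Y_dual :: "real \<Rightarrow> ((real \<Rightarrow> 'v::{real_inner,complete_space}) \<Rightarrow> real) set" where
  "Y_dual T = {l.
     (\<forall>u\<in>Y_space T. \<forall>v\<in>Y_space T. l (\<lambda>t. u t + v t) = l u + l v) \<and>
     (\<forall>a. \<forall>v\<in>Y_space T. l (\<lambda>t. a *\<^sub>R v t) = a * l v) \<and>
     (\<exists>C. \<forall>v\<in>Y_space T. \<bar>l v\<bar> \<le> C * norm_L2 T v)}"

subsection \<open>Norms\<close>

definition norm_Y ::
    "real \<Rightarrow> (real \<Rightarrow> ('v::{real_inner,complete_space} \<Rightarrow>\<^sub>L 'v \<Rightarrow>\<^sub>L real)) \<Rightarrow> (real \<Rightarrow> 'v) \<Rightarrow> real" where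
  "norm_Y T A v = sqrt (op_As T A v v)"

definition norm_Y_dual ::
    "real \<Rightarrow> (real \<Rightarrow> ('v::{real_inner,complete_space} \<Rightarrow>\<^sub>L 'v \<Rightarrow>\<^sub>L real)) \<Rightarrow>
     ((real \<Rightarrow> 'v) \<Rightarrow> real) \<Rightarrow> real" where
  "norm_Y_dual T A g = (SUP v \<in> {v \<in> Y_space T. norm_Y T A v \<noteq> 0}. g v / norm_Y T A v)"

definition norm_X ::
    "real \<Rightarrow> ('v::{real_inner,complete_space} \<Rightarrow>\<^sub>L 'h::{real_inner,complete_space}) \<Rightarrow>
     (real \<Rightarrow> ('v \<Rightarrow>\<^sub>L 'v \<Rightarrow>\<^sub>L real)) \<Rightarrow> (real \<Rightarrow> 'v) \<Rightarrow> real" where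
  "norm_X T \<iota> A w =
     sqrt ((norm_Y T A w)\<^sup>2 + (norm_Y_dual T A (op_dt T \<iota> w))\<^sup>2 + (norm (trace_at T \<iota> T w))\<^sup>2)"

definition alpha ::
    "real \<Rightarrow> (real \<Rightarrow> ('v::{real_inner,complete_space} \<Rightarrow>\<^sub>L 'v \<Rightarrow>\<^sub>L real)) \<Rightarrow> real" where
  "alpha T A =
     (SUP w \<in> {w \<in> Y_space T. norm_Y T A w \<noteq> 0}. norm_Y_dual T A (op_Aa T A w) / norm_Y T A w)"

definition c_const :: "real \<Rightarrow> real" where
  "c_const a = 1 + a / 2 * (a + sqrt (a\<^sup>2 + 4))"

subsection \<open>Trial and test spaces\<close>

text \<open>
  \<open>S\<close> is a closed subspace of \<open>E\<close> with respect to the seminorm \<open>N\<close>.  Since \<open>N\<close> vanishes on null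
  functions, such an \<open>S\<close> contains every function in \<open>E\<close> that agrees a.e. with one of its elements.
\<close>

definition closed_subspace ::
    "((real \<Rightarrow> 'v::real_vector) \<Rightarrow> real) \<Rightarrow> (real \<Rightarrow> 'v) set \<Rightarrow> (real \<Rightarrow> 'v) set \<Rightarrow> bool" where
  "closed_subspace N E S \<longleftrightarrow>
     S \<subseteq> E \<and>
     (\<lambda>t. 0) \<in> S \<and>
     (\<forall>u\<in>S. \<forall>v\<in>S. (\<lambda>t. u t + v t) \<in> S) \<and>
     (\<forall>a. \<forall>u\<in>S. (\<lambda>t. a *\<^sub>R u t) \<in> S) \<and>
     (\<forall>f. \<forall>u\<in>E. (\<forall>n. f n \<in> S) \<and> (\<lambda>n::nat. N (\<lambda>t. f n t - u t)) \<longlonglongrightarrow> 0 \<longrightarrow> u \<in> S)"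

definition nontrivial :: "real \<Rightarrow> (real \<Rightarrow> 'v::real_vector) set \<Rightarrow> bool" where
  "nontrivial T S \<longleftrightarrow> (\<exists>u\<in>S. \<not> (AE t in Xi T. u t = 0))"

definition finite_dimensional :: "real \<Rightarrow> (real \<Rightarrow> 'v::real_vector) set \<Rightarrow> bool" where
  "finite_dimensional T S \<longleftrightarrow>
     (\<exists>F\<subseteq>S. finite F \<and> (\<forall>u\<in>S. \<exists>c. AE t in Xi T. u t = (\<Sum>f\<in>F. c f *\<^sub>R f t)))"

definition saddle_point_solution ::
    "real \<Rightarrow> ('v::{real_inner,complete_space} \<Rightarrow>\<^sub>L 'h::{real_inner,complete_space}) \<Rightarrow>
     (real \<Rightarrow> ('v \<Rightarrow>\<^sub>L 'v \<Rightarrow>\<^sub>L real)) \<Rightarrow> (real \<Rightarrow> 'v) set \<Rightarrow> (real \<Rightarrow> 'v) set \<Rightarrow>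
     ((real \<Rightarrow> 'v) \<Rightarrow> real) \<Rightarrow> 'h \<Rightarrow> (real \<Rightarrow> 'v) \<Rightarrow> (real \<Rightarrow> 'v) \<Rightarrow> bool" where
  "saddle_point_solution T \<iota> A Xs Ys l u0 lam u \<longleftrightarrow>
     lam \<in> Ys \<and> u \<in> Xs \<and>
     (\<forall>v\<in>Ys. op_As T A lam v + op_B T \<iota> A u v = l v) \<and>
     (\<forall>w\<in>Xs. op_B T \<iota> A w lam + (u0 - trace_at T \<iota> 0 u) \<bullet> trace_at T \<iota> 0 w = 0)"

definition eta ::
    "real \<Rightarrow> ('v::{real_inner,complete_space} \<Rightarrow>\<^sub>L 'h::{real_inner,complete_space}) \<Rightarrow>
     (real \<Rightarrow> ('v \<Rightarrow>\<^sub>L 'v \<Rightarrow>\<^sub>L real)) \<Rightarrow> 'h \<Rightarrow> (real \<Rightarrow> 'v) \<Rightarrow> (real \<Rightarrow> 'v) \<Rightarrow> real" where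
  "eta T \<iota> A u0 lam u = sqrt ((norm_Y T A lam)\<^sup>2 + (norm (u0 - trace_at T \<iota> 0 u))\<^sup>2)"

end

theory Submission
  imports Defs
begin

text \<open>
  Put \<open>e = u - u\<^sup>\<delta>\<close>.  On \<open>Y\<close> one has \<open>A\<^sub>s \<lambda>\<^sub>\<delta> = B e = (d\<^sub>t + A\<^sub>a) e + A\<^sub>s e\<close>.  Expanding the square of
  the dual norm and using \<open>(A\<^sub>a e)(e) = 0\<close> and \<open>2 (d\<^sub>t e)(e) = \<parallel>\<gamma>\<^sub>T e\<parallel>\<^sup>2 - \<parallel>\<gamma>\<^sub>0 e\<parallel>\<^sup>2\<close> gives
  \<open>\<parallel>\<lambda>\<^sub>\<delta>\<parallel>\<^sup>2 + \<parallel>\<gamma>\<^sub>0 e\<parallel>\<^sup>2 = \<parallel>(d\<^sub>t + A\<^sub>a) e\<parallel>\<^sup>2 + \<parallel>e\<parallel>\<^sup>2 + \<parallel>\<gamma>\<^sub>T e\<parallel>\<^sup>2\<close>, and the right-hand side differs from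
  \<open>\<parallel>e\<parallel>\<^sub>X\<^sup>2\<close> at most by the factor \<open>c(\<alpha>)\<close>, since \<open>\<parallel>A\<^sub>a e\<parallel> \<le> \<alpha> \<parallel>e\<parallel>\<close>.  Moreover \<open>\<lambda>\<^sup>\<delta>\<close> is the orthogonal
  projection of \<open>\<lambda>\<^sub>\<delta>\<close> onto \<open>Y\<^sup>\<delta>\<close>, so that \<open>\<parallel>\<lambda>\<^sub>\<delta>\<parallel>\<^sup>2 = \<parallel>\<lambda>\<^sup>\<delta>\<parallel>\<^sup>2 + \<parallel>\<lambda>\<^sub>\<delta> - \<lambda>\<^sup>\<delta>\<parallel>\<^sup>2\<close>.

  The analytic core is the embedding of \<open>X\<close> into \<open>C([0,T];H)\<close> with its energy identity.  For almost all
  \<open>s < t\<close> the increment of \<open>\<parallel>w\<parallel>\<^sub>H\<^sup>2\<close> is \<open>\<integral> w'(r)(w(s) + w(t)) dr\<close> over \<open>(s,t)\<close>; summing over fine partitions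
  whose nodes are chosen such that the step functions with values \<open>w(t\<^sub>i)\<close> approximate \<open>w\<close> in
  \<open>L\<^sub>2(V)\<close> yields \<open>2 \<integral> w'(r)(w(r)) dr\<close>.
\<close>

subsection \<open>Test functions\<close>

text \<open>The obstacle is that the derivative of \<open>w\<close> lies only in \<open>V'\<close>,
  so increments of \<open>w\<close> are known only after pairing with fixed test vectors. Each such
  pairing is a scalar function with a scalar weak derivative; the du Bois-Reymond lemma makes it an
  indefinite integral, and no vector-valued integration is used. The test functions required are
  built from exp(-1/x).

  Traces and time derivatives are choices of representatives, so even their compatibility with
  differences rests on uniqueness arguments.

  The constant c(alpha) is the square of the spectral norm of the matrix with rows (1, alpha) and
  (0, 1), that is, the best constant in (p + alpha n)^2 + n^2 <= c (p^2 + n^2). Passing from d_t to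
  d_t + A_a and passing back are both controlled by such a shear, which is why one constant serves
  in both directions.

  The lower estimate drops the squared distance between the two versions of lambda from the
  Pythagorean identity; the upper estimate bounds it by the assumption on rho.\<close>

definition flat_exp :: "real poly \<Rightarrow> real \<Rightarrow> real" where
  "flat_exp p x = (if x > 0 then poly p (1 / x) * exp (- (1 / x)) else 0)"

lemma poly_times_exp_minus_tendsto_0: "((\<lambda>y::real. poly p y * exp (- y)) \<longlongrightarrow> 0) at_top"
proof -
  have "((\<lambda>y::real. \<Sum>i\<le>degree p. coeff p i * (y ^ i / exp y)) \<longlongrightarrow> (\<Sum>i\<le>degree p. coeff p i * 0)) at_top"
    by (intro tendsto_sum tendsto_mult tendsto_const tendsto_power_div_exp_0)
  moreover have "(\<lambda>y::real. \<Sum>i\<le>degree p. coeff p i * (y ^ i / exp y)) = (\<lambda>y. poly p y * exp (- y))"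
    by (simp add: poly_altdef exp_minus sum_distrib_right divide_inverse mult.assoc fun_eq_iff)
  ultimately show ?thesis by simp
qed

text \<open>With y = 1/x one has d/dx = -y^2 d/dy, and this sends p(y) exp(-y) to y^2 (p - p')(y)
  exp(-y). The polynomial parameter thus closes the family under differentiation; the two
  \<open>pCons 0\<close> are the factor y^2.\<close>

lemma flat_exp_has_derivative:
  "(flat_exp p has_real_derivative flat_exp (pCons 0 (pCons 0 (p - pderiv p))) x) (at x)"
proof -
  consider "x > 0" | "x < 0" | "x = 0" by linarith
  then show ?thesis
  proof cases
    case 1
    have "((\<lambda>x. poly p (1 / x) * exp (- (1 / x))) has_real_derivative
        flat_exp (pCons 0 (pCons 0 (p - pderiv p))) x) (at x)"
    proof -
      have inv: "((\<lambda>x. 1 / x) has_real_derivative - (1 / x) * (1 / x)) (at x)"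
        using 1 by (auto intro!: derivative_eq_intros)
      have "((\<lambda>x. poly p (1 / x) * exp (- (1 / x))) has_real_derivative
          (poly (pderiv p) (1 / x) * (- (1 / x) * (1 / x))) * exp (- (1 / x)) +
          (exp (- (1 / x)) * - (- (1 / x) * (1 / x))) * poly p (1 / x)) (at x)"
        by (intro DERIV_mult DERIV_chain2[OF poly_DERIV inv] DERIV_chain2[OF DERIV_exp] DERIV_minus inv)
      moreover have "(poly (pderiv p) y * (- y * y)) * E + (E * - (- y * y)) * poly p y =
          poly (pCons 0 (pCons 0 (p - pderiv p))) y * E" for y E :: real
        by (simp add: algebra_simps)
      ultimately show ?thesis using 1 by (simp only: flat_exp_def if_True)
    qed
    then show ?thesis
      by (rule has_field_derivative_transform_within_open[where S="{0<..}"])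
         (use 1 in \<open>auto simp: flat_exp_def\<close>)
  next
    case 2
    have "((\<lambda>x. 0) has_real_derivative flat_exp (pCons 0 (pCons 0 (p - pderiv p))) x) (at x)"
      using 2 by (simp add: flat_exp_def)
    then show ?thesis
      by (rule has_field_derivative_transform_within_open[where S="{..<0}"])
         (use 2 in \<open>auto simp: flat_exp_def\<close>)
  next
    case 3
    \<comment> \<open>The difference quotient at 0 from the right is y p(y) exp(-y) with y = 1/h;
      the extra \<open>pCons 0\<close> is this factor y.\<close>
    have "((\<lambda>h. poly (pCons 0 p) (inverse h) * exp (- inverse h)) \<longlongrightarrow> 0) (at_right 0)"
      by (rule filterlim_compose[OF poly_times_exp_minus_tendsto_0 filterlim_inverse_at_top_right])
    then have R: "((\<lambda>h. flat_exp p h / h) \<longlongrightarrow> 0) (at_right 0)"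
    proof (rule Lim_transform_eventually)
      have "poly (pCons 0 p) (inverse h) * exp (- inverse h) = flat_exp p h / h" if "h > 0" for h
        using that by (simp add: flat_exp_def divide_inverse)
      then show "\<forall>\<^sub>F h in at_right 0. poly (pCons 0 p) (inverse h) * exp (- inverse h) = flat_exp p h / h"
        by (rule eventually_mono[OF eventually_at_right_less])
    qed
    have L: "((\<lambda>h. flat_exp p h / h) \<longlongrightarrow> 0) (at_left 0)"
    proof (rule Lim_transform_eventually[OF tendsto_const])
      show "\<forall>\<^sub>F h in at_left 0. 0 = flat_exp p h / h"
        by (simp add: eventually_at_filter flat_exp_def)
    qed
    from L R have "((\<lambda>h. flat_exp p h / h) \<longlongrightarrow> 0) (at 0)"
      by (simp add: filterlim_split_at)
    then show ?thesis using 3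
      by (simp add: DERIV_def flat_exp_def)
  qed
qed

text \<open>Smoothness is obtained without computing higher derivatives: the set contains the needed
  bumps and is closed under \<open>deriv\<close>.\<close>

inductive_set smooth_algebra :: "(real \<Rightarrow> real) set" where
  const: "(\<lambda>x. c) \<in> smooth_algebra"
| flat: "(\<lambda>x. flat_exp p (a * x + b)) \<in> smooth_algebra"
| add: "f \<in> smooth_algebra \<Longrightarrow> g \<in> smooth_algebra \<Longrightarrow> (\<lambda>x. f x + g x) \<in> smooth_algebra"
| mult: "f \<in> smooth_algebra \<Longrightarrow> g \<in> smooth_algebra \<Longrightarrow> (\<lambda>x. f x * g x) \<in> smooth_algebra"

lemma smooth_algebra_derivative:
  assumes "f \<in> smooth_algebra"
  shows "\<exists>f'\<in>smooth_algebra. \<forall>x. (f has_real_derivative f' x) (at x)"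
  using assms
proof induction
  case (const c)
  show ?case by (rule bexI[OF _ smooth_algebra.const[of 0]]) auto
next
  case (flat p a b)
  show ?case
    by (rule bexI[OF _ smooth_algebra.mult[OF smooth_algebra.flat[of "pCons 0 (pCons 0 (p - pderiv p))" a b]
          smooth_algebra.const[of a]]])
       (intro allI DERIV_chain2[OF flat_exp_has_derivative], auto intro!: derivative_eq_intros)
next
  case (add f g)
  then obtain f' g' where "f' \<in> smooth_algebra" "g' \<in> smooth_algebra"
    "\<And>x. (f has_real_derivative f' x) (at x)" "\<And>x. (g has_real_derivative g' x) (at x)" by blast
  then show ?case
    by (intro bexI[OF _ smooth_algebra.add[of f' g']]) (auto intro!: derivative_eq_intros)
next
  case (mult f g)
  then obtain f' g' where "f' \<in> smooth_algebra" "g' \<in> smooth_algebra"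
    "\<And>x. (f has_real_derivative f' x) (at x)" "\<And>x. (g has_real_derivative g' x) (at x)" by blast
  with mult show ?case
    by (intro bexI[OF _ smooth_algebra.add[OF smooth_algebra.mult[of f' g] smooth_algebra.mult[of f g']]])
       (auto intro!: derivative_eq_intros)
qed

lemma smooth_algebra_deriv:
  assumes "f \<in> smooth_algebra"
  shows "deriv f \<in> smooth_algebra" "(f has_real_derivative deriv f x) (at x)"
proof -
  obtain f' where f': "f' \<in> smooth_algebra" "\<And>x. (f has_real_derivative f' x) (at x)"
    using smooth_algebra_derivative[OF assms] by blast
  then have "deriv f = f'" by (auto intro!: DERIV_imp_deriv)
  with f' show "deriv f \<in> smooth_algebra" "(f has_real_derivative deriv f x) (at x)" by auto
qed

lemma smooth_algebra_field_differentiable: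
  assumes "f \<in> smooth_algebra"
  shows "(deriv ^^ n) f field_differentiable at x"
proof -
  have "(deriv ^^ n) f \<in> smooth_algebra"
    using assms by (induction n) (auto intro: smooth_algebra_deriv)
  then show ?thesis
    using smooth_algebra_derivative field_differentiable_def by blast
qed

lemma smooth_algebra_continuous_on: "f \<in> smooth_algebra \<Longrightarrow> continuous_on S f"
  by (intro continuous_at_imp_continuous_on ballI DERIV_isCont[OF smooth_algebra_deriv(2)])

text \<open>An antiderivative need not lie in \<open>smooth_algebra\<close>, but all its derivatives
  of positive order do, and order zero is covered by differentiability itself.\<close>

lemma test_function_antiderivative:
  assumes \<psi>: "\<psi> \<in> smooth_algebra" and \<Phi>: "\<And>x. (\<Phi> has_real_derivative \<psi> x) (at x)"
    and "0 < a" "b < T" and "\<And>x. x \<notin> {a..b} \<Longrightarrow> \<Phi> x = 0"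
  shows "test_function T \<Phi>" and "deriv \<Phi> = \<psi>"
proof -
  show D: "deriv \<Phi> = \<psi>" using \<Phi> by (auto intro!: DERIV_imp_deriv)
  have "(deriv ^^ n) \<Phi> field_differentiable at t" for n t
  proof (cases n)
    case 0
    then show ?thesis using \<Phi> by (auto simp: field_differentiable_def)
  next
    case (Suc m)
    have "(deriv ^^ n) \<Phi> = (deriv ^^ m) \<psi>" unfolding Suc funpow_Suc_right by (simp add: D)
    then show ?thesis using smooth_algebra_field_differentiable[OF \<psi>] by simp
  qed
  then show "test_function T \<Phi>" using assms unfolding test_function_def by blast
qed

text \<open>As \<open>n \<rightarrow> \<infinity>\<close> these bumps increase to the indicator function of \<open>(a,b)\<close>, because
  \<open>exp (-1/(n x))\<close> tends to \<open>1\<close> for every \<open>x > 0\<close>.\<close>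

definition bump :: "nat \<Rightarrow> real \<Rightarrow> real \<Rightarrow> real \<Rightarrow> real" where
  "bump n a b x = flat_exp 1 (real (Suc n) * (x - a)) * flat_exp 1 (real (Suc n) * (b - x))"

lemma bump_smooth: "bump n a b \<in> smooth_algebra"
proof -
  have "bump n a b = (\<lambda>x. flat_exp 1 (real (Suc n) * x + (- real (Suc n) * a)) *
      flat_exp 1 ((- real (Suc n)) * x + real (Suc n) * b))"
    by (simp only: bump_def fun_eq_iff) (simp add: algebra_simps)
  then show ?thesis by (simp only: smooth_algebra.intros)
qed

lemma bump_eq_0: "x \<notin> {a<..<b} \<Longrightarrow> bump n a b x = 0"
  by (auto simp: bump_def flat_exp_def zero_less_mult_iff)

lemma bump_pos: "x \<in> {a<..<b} \<Longrightarrow> bump n a b x > 0"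
  by (auto simp: bump_def flat_exp_def zero_less_mult_iff)

lemma bump_nonneg: "bump n a b x \<ge> 0"
  by (auto simp: bump_def flat_exp_def)

lemma bump_le_1: "bump n a b x \<le> 1"
proof -
  have "flat_exp 1 x \<le> 1" for x by (auto simp: flat_exp_def)
  moreover have "flat_exp 1 x \<ge> 0" for x by (auto simp: flat_exp_def)
  ultimately show ?thesis unfolding bump_def by (simp add: mult_le_one)
qed

lemma bump_tendsto: "(\<lambda>n. bump n a b x) \<longlonglongrightarrow> indicator {a<..<b} x"
proof (cases "x \<in> {a<..<b}")
  case True
  have *: "(\<lambda>n. flat_exp 1 (real (Suc n) * y)) \<longlonglongrightarrow> 1" if "y > 0" for y
  proof -
    have "(\<lambda>n. exp (- (inverse (real (Suc n)) * inverse y))) \<longlonglongrightarrow> exp (- (0 * inverse y))"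
      by (intro tendsto_intros LIMSEQ_inverse_real_of_nat)
    moreover have "flat_exp 1 (real (Suc n) * y) = exp (- (inverse (real (Suc n)) * inverse y))" for n
      using that by (simp add: flat_exp_def inverse_eq_divide mult_pos_pos del: of_nat_Suc)
    ultimately show ?thesis by simp
  qed
  show ?thesis
    using tendsto_mult[OF *[of "x - a"] *[of "b - x"]] True by (simp add: bump_def[abs_def])
qed (simp add: bump_eq_0)

subsection \<open>Weak derivatives of real functions\<close>

text \<open>The end points are null, so Lebesgue integrals over the open interval can be handled by
  the calculus of gauge integrals on closed intervals.\<close>

lemma integrable_Xi_iff:
  fixes f :: "real \<Rightarrow> real"
  shows "integrable (Xi T) f \<longleftrightarrow> f absolutely_integrable_on {0..T}"
proof -
  have "integrable (Xi T) f \<longleftrightarrow> f absolutely_integrable_on {0<..<T}"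
    by (simp add: integrable_restrict_space set_integrable_def)
  then show ?thesis by (simp add: absolutely_integrable_on_Icc_iff_Ioo)
qed

lemma integral_Xi:
  fixes f :: "real \<Rightarrow> real"
  assumes "integrable (Xi T) f"
  shows "(LINT t|Xi T. f t) = integral {0..T} f"
  using lebesgue_integral_eq_integral[OF assms] by (simp add: integral_open_interval_real)

lemma integrable_Xi_subinterval:
  fixes f :: "real \<Rightarrow> real"
  assumes "integrable (Xi T) f" "0 \<le> a" "b \<le> T"
  shows "f integrable_on {a..b}"
proof -
  have "f absolutely_integrable_on {a..b}"
    using absolutely_integrable_on_subinterval[where f=f and S="{0..T}" and a=a and b=b] assms by (auto simp: integrable_Xi_iff)
  then show ?thesis by (simp add: absolutely_integrable_on_def)
qed

lemma integral_interval_diff: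
  fixes f :: "real \<Rightarrow> real"
  assumes "integrable (Xi T) f" "0 \<le> a" "a \<le> b" "b \<le> T"
  shows "integral {a..b} f = integral {0..b} f - integral {0..a} f"
  using Henstock_Kurzweil_Integration.integral_combine[of 0 a b f] integrable_Xi_subinterval[OF assms(1), of 0 b] assms by simp

lemma continuous_on_indefinite_integral_Xi:
  fixes f :: "real \<Rightarrow> real"
  assumes "integrable (Xi T) f"
  shows "continuous_on {0..T} (\<lambda>t. integral {0..t} f)"
  using assms by (intro indefinite_integral_continuous_1 integrable_Xi_subinterval[of T]) auto

text \<open>Henstock's lemma shows that the Riemann sums of \<open>\<bar>g\<bar>\<close> tend to \<open>0\<close>.\<close>

lemma AE_eq_0_if_interval_integrals_eq_0:
  fixes g :: "real \<Rightarrow> real"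
  assumes g: "integrable (Xi T) g"
    and z: "\<And>a b. 0 \<le> a \<Longrightarrow> a \<le> b \<Longrightarrow> b \<le> T \<Longrightarrow> integral {a..b} g = 0"
  shows "AE t in Xi T. g t = 0"
proof -
  have gi: "g integrable_on cbox 0 T"
    using integrable_Xi_subinterval[OF g, of 0 T] by simp
  have "((\<lambda>x. \<bar>g x\<bar>) has_integral 0) (cbox 0 T)"
    unfolding has_integral
  proof (intro allI impI)
    fix e :: real assume "e > 0"
    obtain \<gamma> where "gauge \<gamma>" and \<gamma>: "\<And>p. \<lbrakk>p tagged_partial_division_of (cbox 0 T); \<gamma> fine p\<rbrakk> \<Longrightarrow>
             sum (\<lambda>(x,k). norm (measure lborel k *\<^sub>R g x - integral k g)) p < e"
      by (rule Henstock_lemma[OF gi \<open>e > 0\<close>]) (rule that)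
    show "\<exists>\<gamma>. gauge \<gamma> \<and> (\<forall>\<D>. \<D> tagged_division_of cbox 0 T \<and> \<gamma> fine \<D> \<longrightarrow>
             norm ((\<Sum>(x, k)\<in>\<D>. measure lborel k *\<^sub>R \<bar>g x\<bar>) - 0) < e)"
    proof (intro exI conjI allI impI)
      fix p assume p: "p tagged_division_of cbox 0 T \<and> \<gamma> fine p"
      have "(\<Sum>(x, k)\<in>p. measure lborel k *\<^sub>R \<bar>g x\<bar>) = (\<Sum>(x,k)\<in>p. norm (measure lborel k *\<^sub>R g x - integral k g))"
      proof (rule sum.cong)
        fix y assume y: "y \<in> p"
        obtain x k where xk: "y = (x,k)" by fastforce
        then obtain a b where k: "k = cbox a b" and sub: "k \<subseteq> cbox 0 T" and "k \<noteq> {}"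
          using y p tagged_division_ofD by (metis empty_iff)
        then have "integral k g = 0" using z[of a b] by auto
        then show "(case y of (x, k) \<Rightarrow> measure lborel k *\<^sub>R \<bar>g x\<bar>) =
            (case y of (x,k) \<Rightarrow> norm (measure lborel k *\<^sub>R g x - integral k g))"
          by (simp add: xk abs_mult)
      qed simp
      also have "\<dots> < e"
        using \<gamma> p by (simp add: tagged_division_of_def)
      finally have "(\<Sum>(x, k)\<in>p. measure lborel k *\<^sub>R \<bar>g x\<bar>) < e" .
      moreover have "(\<Sum>(x, k)\<in>p. measure lborel k *\<^sub>R \<bar>g x\<bar>) \<ge> 0"
        by (rule sum_nonneg) auto
      ultimately show "norm ((\<Sum>(x, k)\<in>p. measure lborel k *\<^sub>R \<bar>g x\<bar>) - 0) < e" by simp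
    qed fact
  qed
  then have "(LINT t|Xi T. \<bar>g t\<bar>) = 0"
    using integral_Xi[of T "\<lambda>t. \<bar>g t\<bar>"] g by (simp add: integral_unique)
  then show ?thesis
    using integral_nonneg_eq_0_iff_AE[of "Xi T" "\<lambda>t. \<bar>g t\<bar>"] g by simp
qed

text \<open>Over a uniform partition of mesh below \<open>d\<close> the bounds telescope to
  \<open>e * (\<mu> b - \<mu> a)\<close>, and \<open>e\<close> is arbitrary. This proves constancy
  of functions that are not differentiable everywhere.\<close>

lemma eq_of_small_increments:
  fixes H \<mu> :: "real \<Rightarrow> real"
  assumes small: "\<And>e. e > 0 \<Longrightarrow> \<exists>d>0. \<forall>s t. a \<le> s \<longrightarrow> s \<le> t \<longrightarrow> t \<le> b \<longrightarrow> t - s < d \<longrightarrow>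
                    \<bar>H t - H s\<bar> \<le> e * (\<mu> t - \<mu> s)"
    and "a \<le> b"
  shows "H b = H a"
proof -
  have "\<bar>H b - H a\<bar> \<le> e * (\<mu> b - \<mu> a)" if "e > 0" for e
  proof -
    obtain d where "d > 0" and d: "\<forall>s t. a \<le> s \<longrightarrow> s \<le> t \<longrightarrow> t \<le> b \<longrightarrow> t - s < d \<longrightarrow>
                    \<bar>H t - H s\<bar> \<le> e * (\<mu> t - \<mu> s)"
      using small[OF \<open>e > 0\<close>] by blast
    obtain n :: nat where n: "real n > (b - a) / d" using reals_Archimedean2[of "(b - a) / d"] by auto
    then have "n > 0" using \<open>d > 0\<close> \<open>a \<le> b\<close> by (cases n) (auto simp: not_less divide_less_0_iff)
    define x where "x i = a + (b - a) * (real i / real n)" for i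
    have x0: "x 0 = a" and xn: "x n = b" using \<open>n > 0\<close> by (auto simp: x_def)
    have step: "\<bar>H (x (Suc i)) - H (x i)\<bar> \<le> e * (\<mu> (x (Suc i)) - \<mu> (x i))" if "i < n" for i
    proof (rule d[rule_format])
      show "a \<le> x i" using \<open>a \<le> b\<close> by (simp add: x_def)
      show "x i \<le> x (Suc i)" unfolding x_def using \<open>a \<le> b\<close>
        by (intro add_left_mono mult_left_mono divide_right_mono) auto
      have "(b - a) * (real (Suc i) / real n) \<le> (b - a) * 1"
        by (rule mult_left_mono) (use that \<open>a \<le> b\<close> in auto)
      then show "x (Suc i) \<le> b" by (simp add: x_def)
      have "x (Suc i) - x i = (b - a) / n" by (simp add: x_def field_simps add_divide_distrib)
      also have "\<dots> < d" using n \<open>n > 0\<close> \<open>d > 0\<close> by (simp add: field_simps)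
      finally show "x (Suc i) - x i < d" .
    qed
    have "\<bar>H b - H a\<bar> = \<bar>\<Sum>i<n. H (x (Suc i)) - H (x i)\<bar>"
      by (simp add: sum_lessThan_telescope[of "\<lambda>i. H (x i)"] x0 xn)
    also have "\<dots> \<le> (\<Sum>i<n. e * (\<mu> (x (Suc i)) - \<mu> (x i)))"
      by (rule order_trans[OF sum_abs sum_mono]) (use step in auto)
    also have "\<dots> = e * (\<mu> b - \<mu> a)"
      by (simp add: sum_distrib_left[symmetric] sum_lessThan_telescope[of "\<lambda>i. \<mu> (x i)"] x0 xn)
    finally show ?thesis .
  qed
  note * = this
  have "\<bar>H b - H a\<bar> \<le> 0 + e" if "e > 0" for e
  proof -
    \<comment> \<open>The added 1 keeps the denominator positive when
      \<open>\<mu> b = \<mu> a\<close>.\<close>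
    have "\<bar>H b - H a\<bar> \<le> (e / (\<bar>\<mu> b - \<mu> a\<bar> + 1)) * (\<mu> b - \<mu> a)"
      by (rule *) (use that in \<open>simp add: add_nonneg_pos\<close>)
    also have "\<dots> \<le> (e / (\<bar>\<mu> b - \<mu> a\<bar> + 1)) * (\<bar>\<mu> b - \<mu> a\<bar> + 1)"
      by (rule mult_left_mono) (use that in auto)
    also have "\<dots> = e" by (simp add: add_nonneg_pos less_imp_neq[symmetric])
    finally show ?thesis by simp
  qed
  then have "\<bar>H b - H a\<bar> \<le> 0" by (rule field_le_epsilon)
  then show ?thesis by simp
qed

lemma integrable_Xi_continuous:
  fixes f :: "real \<Rightarrow> real"
  shows "continuous_on {0..T} f \<Longrightarrow> integrable (Xi T) f"
  unfolding integrable_Xi_iff by (rule absolutely_integrable_continuous_real)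

lemma integrable_Xi_continuous_mult:
  fixes \<phi> g :: "real \<Rightarrow> real"
  assumes c: "continuous_on {0..T} \<phi>" and g: "integrable (Xi T) g"
  shows "integrable (Xi T) (\<lambda>r. \<phi> r * g r)"
proof -
  obtain C where C: "\<forall>t\<in>{0..T}. \<bar>\<phi> t\<bar> \<le> C"
    using compact_imp_bounded[OF compact_continuous_image[OF c compact_Icc]] unfolding bounded_real by auto
  show ?thesis
  proof (rule Bochner_Integration.integrable_bound)
    show "integrable (Xi T) (\<lambda>r. C * g r)" using g by simp
    have "\<phi> \<in> borel_measurable (Xi T)"
      using integrable_Xi_continuous[OF c] by (rule borel_measurable_integrable)
    then show "(\<lambda>r. \<phi> r * g r) \<in> borel_measurable (Xi T)" using g by measurable
    show "AE r in Xi T. norm (\<phi> r * g r) \<le> norm (C * g r)"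
    proof (rule AE_I2)
      fix r assume "r \<in> space (Xi T)"
      then have "\<bar>\<phi> r\<bar> \<le> \<bar>C\<bar>" using C[rule_format, of r] by auto
      then show "norm (\<phi> r * g r) \<le> norm (C * g r)" by (simp add: abs_mult mult_right_mono)
    qed
  qed
qed

text \<open>The product rule fails for the indefinite integral \<open>F\<close>, which is
  differentiable only almost everywhere. Instead, the increment of \<open>H\<close> over
  \<open>{s..t}\<close> is the integral of
  \<open>(\<Phi> t - \<Phi> r) * g r + (F s - F r) * \<phi> r\<close>; uniform continuity of
  \<open>\<Phi>\<close> and \<open>F\<close> makes it small relative to the integral of
  \<open>\<bar>g\<bar> + \<bar>\<phi>\<bar>\<close>, so \<open>H\<close> is constant.\<close>

lemma integral_by_parts_absolutely_integrable:
  fixes \<Phi> \<phi> g :: "real \<Rightarrow> real"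
  assumes "0 \<le> T" and g: "integrable (Xi T) g"
    and D: "\<And>x. (\<Phi> has_real_derivative \<phi> x) (at x)" and c: "continuous_on {0..T} \<phi>"
    and "\<Phi> T = 0"
  shows "integral {0..T} (\<lambda>t. \<phi> t * integral {0..t} g) = - integral {0..T} (\<lambda>t. \<Phi> t * g t)"
proof -
  define F where "F t = integral {0..t} g" for t
  define K where "K r = \<phi> r * F r + \<Phi> r * g r" for r
  define H where "H t = \<Phi> t * F t - integral {0..t} K" for t
  have cF: "continuous_on {0..T} F"
    unfolding F_def by (rule continuous_on_indefinite_integral_Xi[OF g])
  have c\<Phi>: "continuous_on {0..T} \<Phi>" by (intro continuous_at_imp_continuous_on ballI DERIV_isCont[OF D])
  have iK1: "integrable (Xi T) (\<lambda>r. \<phi> r * F r)"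
    by (intro integrable_Xi_continuous continuous_intros c cF)
  have iK2: "integrable (Xi T) (\<lambda>r. \<Phi> r * g r)"
    by (rule integrable_Xi_continuous_mult[OF c\<Phi> g])
  have iK: "integrable (Xi T) K" unfolding K_def using iK1 iK2 by simp
  have "H T = H 0"
  proof (rule eq_of_small_increments[where H = H and a = 0 and b = T and \<mu> = "\<lambda>t. integral {0..t} (\<lambda>r. \<bar>g r\<bar> + \<bar>\<phi> r\<bar>)"])
    fix e :: real assume "e > 0"
    obtain d1 where "d1 > 0" and d1: "\<And>s t. s \<in> {0..T} \<Longrightarrow> t \<in> {0..T} \<Longrightarrow> dist t s < d1 \<Longrightarrow> dist (F t) (F s) < e"
      using compact_uniformly_continuous[OF cF] \<open>e > 0\<close> unfolding uniformly_continuous_on_def by fastforce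
    obtain d2 where "d2 > 0" and d2: "\<And>s t. s \<in> {0..T} \<Longrightarrow> t \<in> {0..T} \<Longrightarrow> dist t s < d2 \<Longrightarrow> dist (\<Phi> t) (\<Phi> s) < e"
      using compact_uniformly_continuous[OF c\<Phi>] \<open>e > 0\<close> unfolding uniformly_continuous_on_def by fastforce
    show "\<exists>d>0. \<forall>s t. 0 \<le> s \<longrightarrow> s \<le> t \<longrightarrow> t \<le> T \<longrightarrow> t - s < d \<longrightarrow>
                \<bar>H t - H s\<bar> \<le> e * (integral {0..t} (\<lambda>r. \<bar>g r\<bar> + \<bar>\<phi> r\<bar>) - integral {0..s} (\<lambda>r. \<bar>g r\<bar> + \<bar>\<phi> r\<bar>))"
    proof (intro exI conjI allI impI)
      show "min d1 d2 > 0" using \<open>d1 > 0\<close> \<open>d2 > 0\<close> by simp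
      fix s t assume st: "0 \<le> s" "s \<le> t" "t \<le> T" "t - s < min d1 d2"
      have i\<phi>: "integrable (Xi T) \<phi>"
        by (rule integrable_Xi_continuous[OF c])
      have im: "integrable (Xi T) (\<lambda>r. \<bar>g r\<bar> + \<bar>\<phi> r\<bar>)"
        using g i\<phi> by simp
      have iA: "(\<lambda>r. (\<Phi> t - \<Phi> r) * g r + (F s - F r) * \<phi> r) integrable_on {s..t}"
      proof (rule integrable_Xi_subinterval[of T])
        have "integrable (Xi T) (\<lambda>r. \<Phi> t * g r + F s * \<phi> r - K r)" using g i\<phi> iK by simp
        then show "integrable (Xi T) (\<lambda>r. (\<Phi> t - \<Phi> r) * g r + (F s - F r) * \<phi> r)"
          by (simp add: K_def algebra_simps)
      qed (use st in auto)
      have \<Phi>d: "(\<phi> has_integral (\<Phi> t - \<Phi> s)) {s..t}"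
        by (rule fundamental_theorem_of_calculus)
           (use st D in \<open>auto simp: has_real_derivative_iff_has_vector_derivative[symmetric] intro: has_field_derivative_at_within\<close>)
      have Fd: "(g has_integral (F t - F s)) {s..t}"
        using integral_interval_diff[OF g, of s t] integrable_Xi_subinterval[OF g, of s t] st
        by (simp add: F_def has_integral_iff)
      have Kd: "(K has_integral (integral {0..t} K - integral {0..s} K)) {s..t}"
        using integral_interval_diff[OF iK, of s t] integrable_Xi_subinterval[OF iK, of s t] st
        by (simp add: has_integral_iff)
      have "((\<lambda>r. \<Phi> t * g r + F s * \<phi> r - K r) has_integral
          (\<Phi> t * (F t - F s) + F s * (\<Phi> t - \<Phi> s) - (integral {0..t} K - integral {0..s} K))) {s..t}"
        by (intro has_integral_diff has_integral_add has_integral_mult_right \<Phi>d Fd Kd)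
      moreover have "(\<lambda>r. \<Phi> t * g r + F s * \<phi> r - K r) = (\<lambda>r. (\<Phi> t - \<Phi> r) * g r + (F s - F r) * \<phi> r)"
        by (simp add: K_def algebra_simps fun_eq_iff)
      moreover have "\<Phi> t * (F t - F s) + F s * (\<Phi> t - \<Phi> s) - (integral {0..t} K - integral {0..s} K) = H t - H s"
        by (simp add: H_def algebra_simps)
      ultimately have "H t - H s = integral {s..t} (\<lambda>r. (\<Phi> t - \<Phi> r) * g r + (F s - F r) * \<phi> r)"
        by (simp add: has_integral_iff)
      then have "\<bar>H t - H s\<bar> = norm (integral {s..t} (\<lambda>r. (\<Phi> t - \<Phi> r) * g r + (F s - F r) * \<phi> r))"
        by simp
      also have "\<dots> \<le> integral {s..t} (\<lambda>r. e * (\<bar>g r\<bar> + \<bar>\<phi> r\<bar>))"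
      proof (rule integral_norm_bound_integral[OF iA])
        show "(\<lambda>r. e * (\<bar>g r\<bar> + \<bar>\<phi> r\<bar>)) integrable_on {s..t}"
          by (rule integrable_Xi_subinterval[of T]) (use im st in auto)
        fix r assume r: "r \<in> {s..t}"
        have "\<bar>\<Phi> t - \<Phi> r\<bar> \<le> e" using d2[of r t] r st by (auto simp: dist_real_def)
        moreover have "\<bar>F s - F r\<bar> \<le> e" using d1[of r s] r st by (auto simp: dist_real_def)
        ultimately have "\<bar>(\<Phi> t - \<Phi> r) * g r\<bar> + \<bar>(F s - F r) * \<phi> r\<bar> \<le> e * \<bar>g r\<bar> + e * \<bar>\<phi> r\<bar>"
          by (simp add: abs_mult add_mono mult_right_mono)
        then show "norm ((\<Phi> t - \<Phi> r) * g r + (F s - F r) * \<phi> r) \<le> e * (\<bar>g r\<bar> + \<bar>\<phi> r\<bar>)"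
          unfolding real_norm_def distrib_left using abs_triangle_ineq order_trans by blast
      qed
      also have "\<dots> = e * (integral {0..t} (\<lambda>r. \<bar>g r\<bar> + \<bar>\<phi> r\<bar>) - integral {0..s} (\<lambda>r. \<bar>g r\<bar> + \<bar>\<phi> r\<bar>))"
        using integral_interval_diff[OF im, of s t] st by simp
      finally show "\<bar>H t - H s\<bar> \<le> e * (integral {0..t} (\<lambda>r. \<bar>g r\<bar> + \<bar>\<phi> r\<bar>) - integral {0..s} (\<lambda>r. \<bar>g r\<bar> + \<bar>\<phi> r\<bar>))" .
    qed
  qed fact
  then have "integral {0..T} K = 0" using \<open>\<Phi> T = 0\<close> by (simp add: H_def F_def)
  moreover have "integral {0..T} K = integral {0..T} (\<lambda>t. \<phi> t * F t) + integral {0..T} (\<lambda>t. \<Phi> t * g t)"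
    unfolding K_def
    by (rule Henstock_Kurzweil_Integration.integral_add; rule integrable_Xi_subinterval[of T]) (use iK1 iK2 in auto)
  ultimately show ?thesis by (simp add: F_def)
qed

lemma integral_Xi_indicator:
  fixes f :: "real \<Rightarrow> real"
  assumes f: "integrable (Xi T) f" and ab: "0 \<le> a" "b \<le> T"
  shows "integrable (Xi T) (\<lambda>t. indicat_real {a<..<b} t * f t)"
    and "(LINT t|Xi T. indicat_real {a<..<b} t * f t) = integral {a..b} f"
proof -
  have mi: "indicat_real {a<..<b} \<in> borel_measurable (Xi T)"
    by (intro measurable_restrict_space1 borel_measurable_indicator) auto
  show i: "integrable (Xi T) (\<lambda>t. indicat_real {a<..<b} t * f t)"
  proof (rule Bochner_Integration.integrable_bound[OF f])
    show "(\<lambda>t. indicat_real {a<..<b} t * f t) \<in> borel_measurable (Xi T)"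
      using mi borel_measurable_integrable[OF f] by measurable
  qed (auto simp: indicator_def)
  have "(LINT t|Xi T. indicat_real {a<..<b} t * f t) = integral {0..T} (\<lambda>t. indicat_real {a<..<b} t * f t)"
    by (rule integral_Xi[OF i])
  also have "\<dots> = integral {0..T} (\<lambda>t. if t \<in> {a<..<b} then f t else 0)"
    by (rule Henstock_Kurzweil_Integration.integral_cong) (auto simp: indicator_def)
  also have "\<dots> = integral {a<..<b} f"
    using ab by (simp only: Henstock_Kurzweil_Integration.integral_restrict_Int) (simp add: Int_absorb2 subset_iff)
  finally show "(LINT t|Xi T. indicat_real {a<..<b} t * f t) = integral {a..b} f"
    by (simp add: integral_open_interval_real)
qed

text \<open>Dominated convergence replaces the bumps by indicators of intervals with
  \<open>0 < a\<close> and \<open>b < T\<close>; continuity of the indefinite integral then reaches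
  the end points 0 and \<open>T\<close>.\<close>

lemma AE_eq_0_if_bump_integrals_eq_0:
  fixes f :: "real \<Rightarrow> real"
  assumes "T > 0" and f: "integrable (Xi T) f"
    and z: "\<And>n a b. 0 < a \<Longrightarrow> a < b \<Longrightarrow> b < T \<Longrightarrow> (LINT t|Xi T. bump n a b t * f t) = 0"
  shows "AE t in Xi T. f t = 0"
proof -
  define F where "F t = integral {0..t} f" for t
  have cF: "continuous_on {0..T} F"
    unfolding F_def by (rule continuous_on_indefinite_integral_Xi[OF f])
  have mf: "f \<in> borel_measurable (Xi T)" using f by simp
  have mb: "bump n a b \<in> borel_measurable (Xi T)" for n a b
    by (intro borel_measurable_integrable integrable_Xi_continuous smooth_algebra_continuous_on bump_smooth)
  have "integral {a..b} f = 0" if ab: "0 < a" "a < b" "b < T" for a b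
  proof -
    have "(\<lambda>n. LINT t|Xi T. bump n a b t * f t) \<longlonglongrightarrow> (LINT t|Xi T. indicat_real {a<..<b} t * f t)"
    proof (rule integral_dominated_convergence)
      show "(\<lambda>t. indicat_real {a<..<b} t * f t) \<in> borel_measurable (Xi T)"
        using ab by (intro borel_measurable_integrable integral_Xi_indicator(1)[OF f]) auto
      show "(\<lambda>t. bump n a b t * f t) \<in> borel_measurable (Xi T)" for n using mb mf by measurable
      show "integrable (Xi T) (\<lambda>t. \<bar>f t\<bar>)" using f by simp
      show "AE t in Xi T. (\<lambda>n. bump n a b t * f t) \<longlonglongrightarrow> indicat_real {a<..<b} t * f t"
        by (intro AE_I2 tendsto_intros bump_tendsto)
      show "AE t in Xi T. norm (bump n a b t * f t) \<le> \<bar>f t\<bar>" for n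
        using bump_nonneg[of n a b] bump_le_1[of n a b] by (intro AE_I2) (simp add: abs_mult mult_left_le_one_le)
    qed
    then have "(LINT t|Xi T. indicat_real {a<..<b} t * f t) = 0"
      using z[OF ab] by (simp add: LIMSEQ_const_iff)
    then show ?thesis using integral_Xi_indicator(2)[OF f, of a b] ab by simp
  qed
  then have *: "F a = F b" if "0 < a" "a < b" "b < T" for a b
    using integral_interval_diff[OF f, of a b] that by (simp add: F_def)
  have cl: "F x = F (T/2)" if "x \<in> closure {0<..<T}" for x
  proof (rule continuous_constant_on_closure[OF _ _ that])
    show "continuous_on (closure {0<..<T}) F" using cF \<open>T > 0\<close> by simp
    show "F y = F (T/2)" if "y \<in> {0<..<T}" for y
      using *[of y "T/2"] *[of "T/2" y] that \<open>T > 0\<close> by (cases "T/2" y rule: linorder_cases) auto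
  qed
  have half: "F x = F (T/2)" if "x \<in> {0..T}" for x
    by (rule cl) (use that \<open>T > 0\<close> in simp)
  have "F 0 = 0" by (simp add: F_def)
  then have F0: "F x = 0" if "x \<in> {0..T}" for x
    using half[of x] half[of 0] that \<open>T > 0\<close> by simp
  show ?thesis
  proof (rule AE_eq_0_if_interval_integrals_eq_0[OF f])
    fix a b :: real assume "0 \<le> a" "a \<le> b" "b \<le> T"
    then show "integral {a..b} f = 0"
      using integral_interval_diff[OF f, of a b] F0[of a] F0[of b] by (simp add: F_def)
  qed
qed

text \<open>Zero mean is what brings the antiderivative that vanishes at \<open>a\<close> back to 0
  at \<open>b\<close>, and so makes its support compact.\<close>

lemma test_function_with_derivative:
  assumes "0 < a" "a < b" "b < T" and \<psi>: "\<psi> \<in> smooth_algebra"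
    and supp: "\<And>x. x \<notin> {a<..<b} \<Longrightarrow> \<psi> x = 0" and "integral {0..T} \<psi> = 0"
  obtains \<Phi> where "test_function T \<Phi>" "deriv \<Phi> = \<psi>" "\<And>x. (\<Phi> has_real_derivative \<psi> x) (at x)" "\<Phi> T = 0"
proof -
  have cont: "isCont \<psi> x" for x using DERIV_isCont[OF smooth_algebra_deriv(2)[OF \<psi>]] .
  have "\<exists>F. \<forall>x. -\<infinity> < ereal x \<longrightarrow> ereal x < \<infinity> \<longrightarrow> (F has_vector_derivative \<psi> x) (at x)"
    by (rule einterval_antiderivative) (use cont in auto)
  then obtain F where F: "\<And>x. (F has_real_derivative \<psi> x) (at x)"
    unfolding has_real_derivative_iff_has_vector_derivative by fastforce
  define \<Phi> where "\<Phi> x = F x - F a" for x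
  have D: "(\<Phi> has_real_derivative \<psi> x) (at x)" for x
    unfolding \<Phi>_def using F[of x] by (auto intro!: derivative_eq_intros)
  have FTC: "(\<psi> has_integral (\<Phi> y - \<Phi> x)) {x..y}" if "x \<le> y" for x y
    by (rule fundamental_theorem_of_calculus)
       (use that D in \<open>auto simp: has_real_derivative_iff_has_vector_derivative[symmetric] intro: has_field_derivative_at_within\<close>)
  have zero: "\<Phi> y = \<Phi> x" if "x \<le> y" "y \<le> a \<or> b \<le> x" for x y
  proof -
    have "(\<psi> has_integral 0) {x..y}"
      by (rule has_integral_is_0) (use that supp in auto)
    from has_integral_unique[OF FTC[OF \<open>x \<le> y\<close>] this] show ?thesis by simp
  qed
  have "\<Phi> a = 0" by (simp add: \<Phi>_def)
  have "\<Phi> 0 = 0" using zero[of 0 a] \<open>0 < a\<close> \<open>\<Phi> a = 0\<close> by simp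
  moreover have "integral {0..T} \<psi> = \<Phi> T - \<Phi> 0" using FTC[of 0 T] assms by (simp add: integral_unique)
  ultimately have "\<Phi> T = 0" using assms by simp
  then have "\<Phi> b = 0" using zero[of b T] assms by simp
  have "\<Phi> x = 0" if "x \<notin> {a..b}" for x
    using that zero[of x a] zero[of b x] \<open>\<Phi> a = 0\<close> \<open>\<Phi> b = 0\<close> by (cases "x < a") auto
  then have "test_function T \<Phi>" "deriv \<Phi> = \<psi>"
    using test_function_antiderivative[OF \<psi> D \<open>0 < a\<close> \<open>b < T\<close>] by auto
  then show thesis using D \<open>\<Phi> T = 0\<close> by (rule that)
qed

text \<open>By parts, \<open>k = f - F\<close> is orthogonal to every smooth compactly supported
  function of mean zero. An arbitrary bump becomes one after subtracting a multiple of the fixed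
  bump \<open>\<beta>\<close>, so \<open>k\<close> minus its \<open>\<beta>\<close>-weighted mean
  \<open>c\<close> is orthogonal to all bumps.\<close>

lemma du_Bois_Reymond:
  fixes f g :: "real \<Rightarrow> real"
  assumes "T > 0" and f: "integrable (Xi T) f" and g: "integrable (Xi T) g"
    and weak: "\<And>\<phi>. test_function T \<phi> \<Longrightarrow> (LINT t|Xi T. deriv \<phi> t * f t) = - (LINT t|Xi T. \<phi> t * g t)"
  obtains c where "AE t in Xi T. f t = c + integral {0..t} g"
proof -
  define F where "F t = integral {0..t} g" for t
  have iF: "integrable (Xi T) F"
    unfolding F_def by (rule integrable_Xi_continuous[OF continuous_on_indefinite_integral_Xi[OF g]])
  define k where "k t = f t - F t" for t
  have ik: "integrable (Xi T) k" unfolding k_def using f iF by simp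
  have orth: "(LINT t|Xi T. \<psi> t * k t) = 0"
    if ab: "0 < a" "a < b" "b < T" and \<psi>: "\<psi> \<in> smooth_algebra"
      and supp: "\<And>x. x \<notin> {a<..<b} \<Longrightarrow> \<psi> x = 0" and mean: "integral {0..T} \<psi> = 0" for a b \<psi>
  proof -
    obtain \<Phi> where \<Phi>: "test_function T \<Phi>" "deriv \<Phi> = \<psi>" "\<And>x. (\<Phi> has_real_derivative \<psi> x) (at x)" "\<Phi> T = 0"
      using test_function_with_derivative[OF ab \<psi> supp mean] by blast
    have c: "continuous_on {0..T} \<psi>" by (rule smooth_algebra_continuous_on[OF \<psi>])
    have c\<Phi>: "continuous_on {0..T} \<Phi>" by (intro continuous_at_imp_continuous_on ballI DERIV_isCont[OF \<Phi>(3)])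
    have "(LINT t|Xi T. \<psi> t * F t) = integral {0..T} (\<lambda>t. \<psi> t * F t)"
      by (rule integral_Xi[OF integrable_Xi_continuous_mult[OF c iF]])
    also have "\<dots> = - integral {0..T} (\<lambda>t. \<Phi> t * g t)"
      unfolding F_def by (rule integral_by_parts_absolutely_integrable[OF _ g \<Phi>(3) c \<Phi>(4)]) (use \<open>T > 0\<close> in simp)
    also have "\<dots> = - (LINT t|Xi T. \<Phi> t * g t)"
      by (simp add: integral_Xi[OF integrable_Xi_continuous_mult[OF c\<Phi> g]])
    also have "\<dots> = (LINT t|Xi T. \<psi> t * f t)" using weak[OF \<Phi>(1)] \<Phi>(2) by simp
    finally have "(LINT t|Xi T. \<psi> t * f t) - (LINT t|Xi T. \<psi> t * F t) = 0" by simp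
    then show ?thesis
      using integrable_Xi_continuous_mult[OF c f] integrable_Xi_continuous_mult[OF c iF]
      by (simp add: k_def right_diff_distrib)
  qed
  define \<beta> where "\<beta> = bump 0 (T/3) (2*T/3)"
  have cb: "continuous_on {0..T} (bump n a b)" for n a b
    by (intro smooth_algebra_continuous_on bump_smooth)
  have ib: "bump n a b integrable_on {0..T}" for n a b
    using cb by (rule integrable_continuous_real)
  define m where "m = integral {0..T} \<beta>"
  have "m \<noteq> 0"
  proof
    assume "m = 0"
    then have "\<forall>t\<in>{0..T}. \<beta> t = 0"
      using integral_eq_0_iff[of 0 T \<beta>] cb bump_nonneg \<open>T > 0\<close> by (auto simp: m_def \<beta>_def)
    then show False using bump_pos[of "T/2" "T/3" "2*T/3" 0] \<open>T > 0\<close> by (auto simp: \<beta>_def)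
  qed
  define c where "c = (LINT t|Xi T. \<beta> t * k t) / m"
  have ic: "integrable (Xi T) (\<lambda>t. k t - c)"
    using ik integrable_Xi_continuous[of T "\<lambda>t. c"] by simp
  have "AE t in Xi T. k t - c = 0"
  proof (rule AE_eq_0_if_bump_integrals_eq_0[OF \<open>T > 0\<close> ic])
    fix n a b assume ab: "0 < a" "a < b" "b < T"
    define q where "q = integral {0..T} (bump n a b) / m"
    define \<psi> where "\<psi> t = bump n a b t + (- q) * \<beta> t" for t
    have "(LINT t|Xi T. \<psi> t * k t) = 0"
    proof (rule orth)
      show "\<psi> \<in> smooth_algebra"
        unfolding \<psi>_def \<beta>_def by (intro smooth_algebra.intros bump_smooth)
      show "0 < min a (T/3)" "min a (T/3) < max b (2*T/3)" "max b (2*T/3) < T"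
        using ab \<open>T > 0\<close> by auto
      show "\<psi> x = 0" if "x \<notin> {min a (T/3)<..<max b (2*T/3)}" for x
              proof -
        have "x \<notin> {a<..<b}" "x \<notin> {T/3<..<2*T/3}" using that by auto
        then have "bump n a b x = 0" and "\<beta> x = 0" unfolding \<beta>_def by (blast intro: bump_eq_0)+
        then show ?thesis by (simp add: \<psi>_def)
      qed
      have "(\<psi> has_integral (integral {0..T} (bump n a b) + (- q) * m)) {0..T}"
        unfolding \<psi>_def m_def \<beta>_def
        by (intro has_integral_add has_integral_mult_right integrable_integral ib)
      then have "integral {0..T} \<psi> = integral {0..T} (bump n a b) + (- q) * m" by (rule integral_unique)
      then show "integral {0..T} \<psi> = 0" using \<open>m \<noteq> 0\<close> by (simp add: q_def)
    qed
    moreover have "(LINT t|Xi T. \<psi> t * k t) = (LINT t|Xi T. bump n a b t * k t + (- q) * (\<beta> t * k t))"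
      by (simp add: \<psi>_def algebra_simps)
    ultimately have "(LINT t|Xi T. bump n a b t * k t) = q * (LINT t|Xi T. \<beta> t * k t)"
      using integrable_Xi_continuous_mult[OF cb ik] by (simp add: \<beta>_def)
    also have "\<dots> = integral {0..T} (bump n a b) * c"
      using \<open>m \<noteq> 0\<close> by (simp add: q_def c_def)
    also have "\<dots> = (LINT t|Xi T. bump n a b t * c)"
      using integral_Xi[OF integrable_Xi_continuous[OF cb]] by simp
    finally show "(LINT t|Xi T. bump n a b t * (k t - c)) = 0"
      using integrable_Xi_continuous_mult[OF cb ik] integrable_Xi_continuous[OF cb[of n a b]]
      by (simp add: right_diff_distrib)
  qed
  then show thesis by (intro that[of c]) (auto simp: k_def F_def elim!: eventually_mono)
qed

subsection \<open>Strongly measurable and square-integrable functions\<close>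

text \<open>The limit exists only almost everywhere. \<open>lim\<close> is measurable, and
  completeness of Lebesgue measure carries this over to \<open>f\<close> after both functions are
  extended by 0 to the whole line.\<close>

lemma borel_measurable_Xi_AE_limit:
  fixes f :: "real \<Rightarrow> real"
  assumes h: "\<And>i. h i \<in> borel_measurable (Xi T)" and lim: "AE t in Xi T. (\<lambda>i::nat. h i t) \<longlonglongrightarrow> f t"
  shows "f \<in> borel_measurable (Xi T)"
proof -
  define g where "g t = lim (\<lambda>i. h i t)" for t
  have g: "g \<in> borel_measurable (Xi T)" unfolding g_def using h by (rule borel_measurable_lim_metric)
  have "AE t in Xi T. g t = f t" using lim by eventually_elim (auto simp: g_def limI)
  then have "AE t in lebesgue. t \<in> {0<..<T} \<longrightarrow> g t = f t"
    by (subst (asm) AE_restrict_space_iff) auto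
  then have "AE t in lebesgue. (if t \<in> {0<..<T} then g t else 0) = (if t \<in> {0<..<T} then f t else 0)"
    by eventually_elim auto
  moreover have "(\<lambda>t. if t \<in> {0<..<T} then g t else 0) \<in> borel_measurable lebesgue"
    by (subst borel_measurable_if) (use g in simp_all)
  ultimately have "(\<lambda>t. if t \<in> {0<..<T} then f t else 0) \<in> borel_measurable lebesgue"
    by (rule borel_measurable_AE[rotated])
  then show ?thesis by (subst (asm) borel_measurable_if) simp_all
qed

lemma strongly_measurableE:
  assumes "strongly_measurable M f"
  obtains s where "\<And>i. simple_function M (s i)" "AE x in M. (\<lambda>i. s i x) \<longlonglongrightarrow> f x"
  using assms unfolding strongly_measurable_def by blast

lemma strongly_measurable_simple: "simple_function M f \<Longrightarrow> strongly_measurable M f"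
  unfolding strongly_measurable_def by (intro exI[of _ "\<lambda>i. f"]) simp

lemma strongly_measurable_compose2:
  assumes "strongly_measurable M f" "strongly_measurable M g"
    and cont: "\<And>a b x y. a \<longlonglongrightarrow> x \<Longrightarrow> b \<longlonglongrightarrow> y \<Longrightarrow> (\<lambda>i::nat. h (a i) (b i)) \<longlonglongrightarrow> h x y"
  shows "strongly_measurable M (\<lambda>t. h (f t) (g t))"
proof -
  obtain s where s: "\<And>i. simple_function M (s i)" "AE x in M. (\<lambda>i. s i x) \<longlonglongrightarrow> f x"
    by (rule strongly_measurableE[OF assms(1)]) (rule that)
  obtain r where r: "\<And>i. simple_function M (r i)" "AE x in M. (\<lambda>i. r i x) \<longlonglongrightarrow> g x"
    by (rule strongly_measurableE[OF assms(2)]) (rule that)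
  show ?thesis unfolding strongly_measurable_def
  proof (intro exI conjI allI)
    show "simple_function M (\<lambda>t. h (s i t) (r i t))" for i
      using s(1) r(1) by (rule simple_function_compose2)
    show "AE x in M. (\<lambda>i. h (s i x) (r i x)) \<longlonglongrightarrow> h (f x) (g x)"
      using s(2) r(2) by eventually_elim (rule cont)
  qed
qed

lemma strongly_measurable_compose:
  assumes "strongly_measurable M f"
    and cont: "\<And>a x. a \<longlonglongrightarrow> x \<Longrightarrow> (\<lambda>i::nat. h (a i)) \<longlonglongrightarrow> h x"
  shows "strongly_measurable M (\<lambda>t. h (f t))"
  using strongly_measurable_compose2[OF assms(1) assms(1), of "\<lambda>x y. h x"] cont by blast

lemma strongly_measurable_add:
  fixes f g :: "_ \<Rightarrow> 'b::real_normed_vector"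
  shows "strongly_measurable M f \<Longrightarrow> strongly_measurable M g \<Longrightarrow> strongly_measurable M (\<lambda>t. f t + g t)"
  by (erule (1) strongly_measurable_compose2) (rule tendsto_add)

lemma strongly_measurable_scaleR:
  fixes f :: "_ \<Rightarrow> 'b::real_normed_vector"
  shows "strongly_measurable M f \<Longrightarrow> strongly_measurable M (\<lambda>t. a *\<^sub>R f t)"
  by (erule strongly_measurable_compose) (rule tendsto_scaleR[OF tendsto_const])

lemma borel_measurable_strongly:
  fixes f :: "real \<Rightarrow> real"
  assumes "strongly_measurable (Xi T) f"
  shows "f \<in> borel_measurable (Xi T)"
  using assms by (elim strongly_measurableE) (rule borel_measurable_Xi_AE_limit, auto intro: borel_measurable_simple_function)

lemma borel_measurable_norm_strongly:
  fixes f :: "real \<Rightarrow> 'b::real_normed_vector"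
  assumes "strongly_measurable (Xi T) f"
  shows "(\<lambda>t. norm (f t)) \<in> borel_measurable (Xi T)"
  by (rule borel_measurable_strongly, rule strongly_measurable_compose[OF assms]) (rule tendsto_norm)

lemma borel_measurable_pairing:
  fixes g :: "real \<Rightarrow> 'v::real_normed_vector \<Rightarrow>\<^sub>L real"
  assumes "strongly_measurable (Xi T) g" "strongly_measurable (Xi T) v"
  shows "(\<lambda>t. g t (v t)) \<in> borel_measurable (Xi T)"
  by (rule borel_measurable_strongly, rule strongly_measurable_compose2[OF assms])
     (rule bounded_bilinear.tendsto[OF bounded_bilinear_blinfun_apply])

text \<open>Measurability of \<open>A\<close> is given only entry by entry. For simple arguments
  only finitely many entries occur; the general case follows from continuity of \<open>A t\<close>
  at each fixed \<open>t\<close>.\<close>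

lemma borel_measurable_bilinear_form:
  fixes A :: "real \<Rightarrow> 'v::real_normed_vector \<Rightarrow>\<^sub>L 'v \<Rightarrow>\<^sub>L real"
  assumes A: "\<And>x y. (\<lambda>t. A t x y) \<in> borel_measurable (Xi T)"
    and "strongly_measurable (Xi T) w" "strongly_measurable (Xi T) v"
  shows "(\<lambda>t. A t (w t) (v t)) \<in> borel_measurable (Xi T)"
proof -
  obtain s where s: "\<And>i. simple_function (Xi T) (s i)" "AE x in Xi T. (\<lambda>i. s i x) \<longlonglongrightarrow> w x"
    by (rule strongly_measurableE[OF assms(2)]) (rule that)
  obtain r where r: "\<And>i. simple_function (Xi T) (r i)" "AE x in Xi T. (\<lambda>i. r i x) \<longlonglongrightarrow> v x"
    by (rule strongly_measurableE[OF assms(3)]) (rule that)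
  show ?thesis
  proof (rule borel_measurable_Xi_AE_limit)
    fix i
    define p where "p t = (s i t, r i t)" for t
    have p: "simple_function (Xi T) p" unfolding p_def using s(1) r(1) by (rule simple_function_Pair)
    have "(\<lambda>t. A t (fst (p t)) (snd (p t))) \<in> borel_measurable (Xi T)"
    proof (rule measurable_compose_countable'[where g = p and I = "p ` space (Xi T)" and f = "\<lambda>q t. A t (fst q) (snd q)"])
      show "p \<in> Xi T \<rightarrow>\<^sub>M count_space (p ` space (Xi T))"
        using simple_functionD(2)[OF p] by (intro measurableI) auto
      show "countable (p ` space (Xi T))" using simple_functionD(1)[OF p] by (rule countable_finite)
    qed (rule A)
    then show "(\<lambda>t. A t (s i t) (r i t)) \<in> borel_measurable (Xi T)" by (simp add: p_def)
  next
    show "AE t in Xi T. (\<lambda>i. A t (s i t) (r i t)) \<longlonglongrightarrow> A t (w t) (v t)"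
      using s(2) r(2) by eventually_elim (intro tendsto_intros)
  qed
qed

lemma norm_add_power2_le: "(norm (x + y))\<^sup>2 \<le> 2 * (norm (x::'b::real_normed_vector))\<^sup>2 + 2 * (norm y)\<^sup>2"
proof -
  have "(norm (x + y))\<^sup>2 \<le> (norm x + norm y)\<^sup>2" by (intro power_mono norm_triangle_ineq) simp
  also have "\<dots> \<le> 2 * (norm x)\<^sup>2 + 2 * (norm y)\<^sup>2"
    using sum_squares_bound[of "norm x" "norm y"] by (simp add: power2_sum)
  finally show ?thesis .
qed

lemma L2_D:
  assumes "f \<in> L2 T"
  shows "strongly_measurable (Xi T) f" "integrable (Xi T) (\<lambda>t. (norm (f t))\<^sup>2)"
  using assms by (auto simp: L2_def)

lemma L2_bound:
  assumes "strongly_measurable (Xi T) f" "integrable (Xi T) b" "AE t in Xi T. (norm (f t))\<^sup>2 \<le> b t"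
  shows "f \<in> L2 T"
  unfolding L2_def
proof (intro CollectI conjI Bochner_Integration.integrable_bound[OF assms(2)])
  show "(\<lambda>t. (norm (f t))\<^sup>2) \<in> borel_measurable (Xi T)"
    using borel_measurable_norm_strongly[OF assms(1)] by measurable
  show "AE t in Xi T. norm ((norm (f t))\<^sup>2) \<le> norm (b t)"
    using assms(3) by eventually_elim simp
qed fact

lemma L2_add:
  assumes "f \<in> L2 T" "g \<in> L2 T"
  shows "(\<lambda>t. f t + g t) \<in> L2 T"
proof (rule L2_bound)
  show "integrable (Xi T) (\<lambda>t. 2 * (norm (f t))\<^sup>2 + 2 * (norm (g t))\<^sup>2)"
    using assms[THEN L2_D(2)] by simp
qed (use assms in \<open>auto intro: strongly_measurable_add L2_D norm_add_power2_le\<close>)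

lemma L2_scaleR:
  assumes "f \<in> L2 T"
  shows "(\<lambda>t. a *\<^sub>R f t) \<in> L2 T"
proof (rule L2_bound)
  show "integrable (Xi T) (\<lambda>t. a\<^sup>2 * (norm (f t))\<^sup>2)"
    using assms[THEN L2_D(2)] by simp
qed (use assms in \<open>auto intro: strongly_measurable_scaleR L2_D simp: power_mult_distrib\<close>)

lemma L2_diff:
  assumes "f \<in> L2 T" "g \<in> L2 T"
  shows "(\<lambda>t. f t - g t) \<in> L2 T"
  using L2_add[OF assms(1) L2_scaleR[OF assms(2), of "-1"]] by simp

lemma L2_const: "(\<lambda>t. c) \<in> L2 T"
  by (rule L2_bound[where b = "\<lambda>t. (norm c)\<^sup>2"]) (auto intro: strongly_measurable_simple integrable_Xi_continuous)

lemma L2_norm_mult_integrable: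
  assumes f: "f \<in> L2 T" and g: "g \<in> L2 T"
  shows "integrable (Xi T) (\<lambda>t. norm (f t) * norm (g t))"
proof (rule Bochner_Integration.integrable_bound)
  show "integrable (Xi T) (\<lambda>t. (norm (f t))\<^sup>2 + (norm (g t))\<^sup>2)"
    using assms[THEN L2_D(2)] by simp
  show "(\<lambda>t. norm (f t) * norm (g t)) \<in> borel_measurable (Xi T)"
    using assms[THEN L2_D(1), THEN borel_measurable_norm_strongly] by measurable
  have "norm (f t) * norm (g t) \<le> (norm (f t))\<^sup>2 + (norm (g t))\<^sup>2" for t
    using sum_squares_bound[of "norm (f t)" "norm (g t)"] zero_le_power2[of "norm (f t)"]
      zero_le_power2[of "norm (g t)"] by linarith
  then show "AE t in Xi T. norm (norm (f t) * norm (g t)) \<le> norm ((norm (f t))\<^sup>2 + (norm (g t))\<^sup>2)"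
    by simp
qed

lemma L2_pairing_integrable:
  fixes g :: "real \<Rightarrow> 'v::real_normed_vector \<Rightarrow>\<^sub>L real"
  assumes g: "g \<in> L2 T" and v: "v \<in> L2 T"
  shows "integrable (Xi T) (\<lambda>t. g t (v t))"
proof (rule Bochner_Integration.integrable_bound[OF L2_norm_mult_integrable[OF assms]])
  show "(\<lambda>t. g t (v t)) \<in> borel_measurable (Xi T)"
    using assms[THEN L2_D(1)] by (rule borel_measurable_pairing)
  show "AE t in Xi T. norm (g t (v t)) \<le> norm (norm (g t) * norm (v t))"
    using norm_blinfun[of "g _" "v _"] by (intro AE_I2) simp
qed

text \<open>Young's inequality. The free weight lets later estimates choose which factor is made
  small.\<close>

lemma mult_le_weighted_squares:
  fixes x y k :: real
  assumes "k > 0"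
  shows "2 * (x * y) \<le> k * x\<^sup>2 + y\<^sup>2 / k"
proof -
  have "0 \<le> (k * x - y)\<^sup>2 / k" using assms by simp
  also have "\<dots> = k * x\<^sup>2 + y\<^sup>2 / k - 2 * (x * y)"
    using assms by (simp add: power2_eq_square field_simps)
  finally show ?thesis by simp
qed

lemma L2_norm_mult_le:
  assumes f: "f \<in> L2 T" and g: "g \<in> L2 T" and "k > 0"
  shows "2 * (LINT t|Xi T. norm (f t) * norm (g t)) \<le> k * (LINT t|Xi T. (norm (f t))\<^sup>2) + (LINT t|Xi T. (norm (g t))\<^sup>2) / k"
proof -
  have "(LINT t|Xi T. 2 * (norm (f t) * norm (g t))) \<le> (LINT t|Xi T. k * (norm (f t))\<^sup>2 + (norm (g t))\<^sup>2 / k)"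
    using L2_norm_mult_integrable[OF f g] f[THEN L2_D(2)] g[THEN L2_D(2)] mult_le_weighted_squares[OF \<open>k > 0\<close>]
    by (intro integral_mono) auto
  then show ?thesis using f[THEN L2_D(2)] g[THEN L2_D(2)] by simp
qed

subsection \<open>Density of continuous functions\<close>

text \<open>Continuity is asked for on the whole line, so that \<open>\<sigma>\<close> is uniformly
  continuous on the compact \<open>{0..T}\<close>.\<close>

definition continuously_approximable :: "real \<Rightarrow> (real \<Rightarrow> 'b::real_normed_vector) \<Rightarrow> bool" where
  "continuously_approximable T f \<longleftrightarrow>
     f \<in> L2 T \<and> (\<forall>e>0. \<exists>\<sigma>\<in>L2 T. continuous_on UNIV \<sigma> \<and> (LINT t|Xi T. (norm (f t - \<sigma> t))\<^sup>2) < e)"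

lemma L2_square_integral_add_le:
  assumes "f \<in> L2 T" "g \<in> L2 T"
  shows "(LINT t|Xi T. (norm (f t + g t))\<^sup>2) \<le> 2 * (LINT t|Xi T. (norm (f t))\<^sup>2) + 2 * (LINT t|Xi T. (norm (g t))\<^sup>2)"
proof -
  have "(LINT t|Xi T. (norm (f t + g t))\<^sup>2) \<le> (LINT t|Xi T. 2 * (norm (f t))\<^sup>2 + 2 * (norm (g t))\<^sup>2)"
    using L2_D(2)[OF L2_add[OF assms]] assms[THEN L2_D(2)] by (intro integral_mono norm_add_power2_le) auto
  then show ?thesis using assms[THEN L2_D(2)] by simp
qed

lemma continuously_approximable_add:
  assumes f: "continuously_approximable T f" and g: "continuously_approximable T g"
  shows "continuously_approximable T (\<lambda>t. f t + g t)"
  unfolding continuously_approximable_def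
proof (intro conjI allI impI)
  have fg: "f \<in> L2 T" "g \<in> L2 T" using f g by (auto simp: continuously_approximable_def)
  then show "(\<lambda>t. f t + g t) \<in> L2 T" by (rule L2_add)
  fix e :: real assume "e > 0"
  then have e: "e / 4 > 0" by simp
  obtain \<sigma> where \<sigma>: "\<sigma> \<in> L2 T" "continuous_on UNIV \<sigma>" "(LINT t|Xi T. (norm (f t - \<sigma> t))\<^sup>2) < e / 4"
    using f e unfolding continuously_approximable_def by meson
  obtain \<tau> where \<tau>: "\<tau> \<in> L2 T" "continuous_on UNIV \<tau>" "(LINT t|Xi T. (norm (g t - \<tau> t))\<^sup>2) < e / 4"
    using g e unfolding continuously_approximable_def by meson
  have "(LINT t|Xi T. (norm ((f t - \<sigma> t) + (g t - \<tau> t)))\<^sup>2) < e"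
    using L2_square_integral_add_le[OF L2_diff[OF fg(1) \<sigma>(1)] L2_diff[OF fg(2) \<tau>(1)]] \<sigma>(3) \<tau>(3) by linarith
  moreover have "(f t - \<sigma> t) + (g t - \<tau> t) = f t + g t - (\<sigma> t + \<tau> t)" for t by simp
  ultimately have "(LINT t|Xi T. (norm (f t + g t - (\<sigma> t + \<tau> t)))\<^sup>2) < e" by simp
  then show "\<exists>\<sigma>\<in>L2 T. continuous_on UNIV \<sigma> \<and> (LINT t|Xi T. (norm (f t + g t - \<sigma> t))\<^sup>2) < e"
    using L2_add[OF \<sigma>(1) \<tau>(1)] continuous_on_add[OF \<sigma>(2) \<tau>(2)] by (intro bexI[of _ "\<lambda>t. \<sigma> t + \<tau> t"]) auto
qed

text \<open>Regularity gives a closed \<open>K\<close> inside and an open \<open>U\<close> outside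
  \<open>S\<close>, and Urysohn's function interpolates between them. It differs from the indicator
  only on \<open>D\<close>, which has measure below \<open>2 * d\<close>.\<close>

lemma continuously_approximable_indicator:
  assumes S: "S \<in> sets (Xi T)"
  shows "continuously_approximable T (\<lambda>t. indicat_real S t *\<^sub>R c)"
  unfolding continuously_approximable_def
proof (intro conjI allI impI)
  have Sl: "S \<in> sets lebesgue" using S by (auto simp: sets_restrict_space)
  have "simple_function (Xi T) (\<lambda>t. indicat_real S t *\<^sub>R c)"
    using S by (intro simple_function_compose1[where g = "\<lambda>x. x *\<^sub>R c"] simple_function_indicator)
  then show L: "(\<lambda>t. indicat_real S t *\<^sub>R c) \<in> L2 T"
    by (intro L2_bound[where b = "\<lambda>t. (norm c)\<^sup>2"] strongly_measurable_simple integrable_Xi_continuous)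
       (auto simp: indicator_def)
  fix e :: real assume "e > 0"
  \<comment> \<open>Chosen so that \<open>((norm c)\<^sup>2 + 1) * (2 * d) = e\<close>; the added 1
    covers \<open>c = 0\<close>.\<close>
  define d where "d = e / (2 * ((norm c)\<^sup>2 + 1))"
  have "d > 0" using \<open>e > 0\<close> by (simp add: d_def add_nonneg_pos)
  obtain K where K: "closed K" "K \<subseteq> S" "S - K \<in> lmeasurable" "emeasure lebesgue (S - K) < ennreal d"
    using sets_lebesgue_inner_closed[OF Sl \<open>d > 0\<close>] .
  obtain U where U: "open U" "S \<subseteq> U" "U - S \<in> lmeasurable" "emeasure lebesgue (U - S) < ennreal d"
    using sets_lebesgue_outer_open[OF Sl \<open>d > 0\<close>] .
  obtain \<phi> :: "real \<Rightarrow> real" where \<phi>: "continuous_on UNIV \<phi>" "\<And>x. \<phi> x \<in> closed_segment 1 0"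
      "\<And>x. x \<in> K \<Longrightarrow> \<phi> x = 1" "\<And>x. x \<in> - U \<Longrightarrow> \<phi> x = 0"
    by (rule Urysohn[of K "- U" 1 "0::real"]) (use K U in auto)
  have \<phi>01: "0 \<le> \<phi> x" "\<phi> x \<le> 1" for x using \<phi>(2)[of x] by (auto simp: closed_segment_eq_real_ivl)
  define D where "D = (U - S) \<union> (S - K)"
  have D: "D \<in> lmeasurable" unfolding D_def using K U by auto
  have mD: "measure lebesgue D < 2 * d"
  proof -
    have "measure lebesgue D \<le> measure lebesgue (U - S) + measure lebesgue (S - K)"
      unfolding D_def using K U by (intro measure_Un_le) (auto intro: fmeasurableD)
    moreover have "measure lebesgue (U - S) < d" "measure lebesgue (S - K) < d"
      using K U \<open>d > 0\<close> by (auto simp: emeasure_eq_measure2 ennreal_less_iff)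
    ultimately show ?thesis by simp
  qed
  have c\<phi>: "continuous_on UNIV (\<lambda>t. \<phi> t *\<^sub>R c)" using \<phi>(1) by (intro continuous_intros)
  have "continuous_on {0..T} \<phi>" using \<phi>(1) continuous_on_subset by blast
  then have m\<phi>: "\<phi> \<in> borel_measurable (Xi T)"
    by (intro borel_measurable_integrable integrable_Xi_continuous)
  obtain s where s: "\<And>i. simple_function (Xi T) (s i)" "\<And>x. x \<in> space (Xi T) \<Longrightarrow> (\<lambda>i. s i x) \<longlonglongrightarrow> \<phi> x"
    using borel_measurable_implies_sequence_metric[OF m\<phi>, of 0] by metis
  have "strongly_measurable (Xi T) \<phi>"
    unfolding strongly_measurable_def using s by (intro exI[of _ s]) auto
  then have "strongly_measurable (Xi T) (\<lambda>t. \<phi> t *\<^sub>R c)"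
    by (rule strongly_measurable_compose) (intro tendsto_intros)
  moreover have "(norm (\<phi> t *\<^sub>R c))\<^sup>2 \<le> (norm c)\<^sup>2" for t
    using \<phi>01[of t] by (intro power_mono) (auto simp: mult_left_le_one_le)
  ultimately have L\<phi>: "(\<lambda>t. \<phi> t *\<^sub>R c) \<in> L2 T"
    by (intro L2_bound[where b = "\<lambda>t. (norm c)\<^sup>2"] integrable_Xi_continuous) auto
  have bound: "(norm (indicat_real S t *\<^sub>R c - \<phi> t *\<^sub>R c))\<^sup>2 \<le> (norm c)\<^sup>2 * indicat_real D t" for t
  proof (cases "t \<in> D")
    case True
    have "(norm (indicat_real S t *\<^sub>R c - \<phi> t *\<^sub>R c))\<^sup>2 = \<bar>indicat_real S t - \<phi> t\<bar>\<^sup>2 * (norm c)\<^sup>2"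
      unfolding scaleR_diff_left[symmetric] norm_scaleR power_mult_distrib ..
    also have "\<dots> \<le> 1\<^sup>2 * (norm c)\<^sup>2"
      using \<phi>01[of t] by (intro mult_right_mono power_mono) (auto simp: indicator_def)
    finally show ?thesis using True by simp
  next
    case False
    then have "t \<in> K \<or> t \<notin> U" by (auto simp: D_def)
    then have "indicat_real S t = \<phi> t" using K U \<phi>(3,4) by (auto simp: indicator_def)
    then show ?thesis using False by simp
  qed
  have iD: "integrable (Xi T) (indicat_real D)"
  proof -
    have "D \<inter> {0<..<T} \<in> sets (Xi T)" using D by (auto simp: sets_restrict_space)
    moreover have "emeasure (Xi T) (D \<inter> {0<..<T}) < \<infinity>"
    proof -
      have "emeasure (Xi T) (D \<inter> {0<..<T}) \<le> emeasure lebesgue {0<..<T}"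
        by (subst emeasure_restrict_space) (auto simp del: emeasure_lborel_box_eq emeasure_lborel_Ioo emeasure_completion intro: emeasure_mono)
      also have "\<dots> < \<infinity>" by (cases "0 \<le> T") auto
      finally show ?thesis .
    qed
    ultimately have "integrable (Xi T) (indicat_real (D \<inter> {0<..<T}))"
      by (intro integrable_real_indicator)
    then show ?thesis
      by (rule Bochner_Integration.integrable_cong[THEN iffD1, rotated 2]) (auto simp: indicator_def)
  qed
  have mDD: "(LINT t|Xi T. indicat_real D t) \<le> measure lebesgue D"
  proof -
    have "(LINT t|Xi T. indicat_real D t) = (LINT t|lebesgue. indicat_real {0<..<T} t *\<^sub>R indicat_real D t)"
      by (rule integral_restrict_space) simp
    also have "\<dots> = (LINT t|lebesgue. indicat_real (D \<inter> {0<..<T}) t)"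
      by (intro Bochner_Integration.integral_cong) (auto simp: indicator_def)
    also have "\<dots> = measure lebesgue (D \<inter> {0<..<T})" by simp
    also have "\<dots> \<le> measure lebesgue D" using D by (intro measure_mono_fmeasurable) auto
    finally show ?thesis .
  qed
  have "(LINT t|Xi T. (norm (indicat_real S t *\<^sub>R c - \<phi> t *\<^sub>R c))\<^sup>2) \<le> (LINT t|Xi T. (norm c)\<^sup>2 * indicat_real D t)"
    using L2_D(2)[OF L2_diff[OF L L\<phi>]] iD bound by (intro integral_mono) auto
  also have "\<dots> = (norm c)\<^sup>2 * (LINT t|Xi T. indicat_real D t)" by simp
  also have "\<dots> \<le> ((norm c)\<^sup>2 + 1) * measure lebesgue D"
    using mDD by (intro mult_mono) auto
  also have "\<dots> < ((norm c)\<^sup>2 + 1) * (2 * d)"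
    using mD by (intro mult_strict_left_mono) (auto simp: add_nonneg_pos)
  also have "\<dots> = e"
  proof -
    have "(norm c)\<^sup>2 + 1 \<noteq> 0" using zero_le_power2[of "norm c"] by linarith
    then show ?thesis by (simp add: d_def field_simps)
  qed
  finally show "\<exists>\<sigma>\<in>L2 T. continuous_on UNIV \<sigma> \<and> (LINT t|Xi T. (norm (indicat_real S t *\<^sub>R c - \<sigma> t))\<^sup>2) < e"
    using L\<phi> c\<phi> by (intro bexI[of _ "\<lambda>t. \<phi> t *\<^sub>R c"]) auto
qed

lemma continuously_approximable_sum:
  assumes "finite I" "\<And>i. i \<in> I \<Longrightarrow> continuously_approximable T (f i)"
  shows "continuously_approximable T (\<lambda>t. \<Sum>i\<in>I. f i t)"
  using assms
proof (induction I rule: finite_induct)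
  case empty
  show ?case using continuously_approximable_indicator[of "{}" T 0] by simp
next
  case (insert i I)
  then show ?case by (simp add: continuously_approximable_add)
qed

text \<open>A simple function agrees with its sum of indicators only on \<open>(0, T)\<close>; this
  absorbs the values elsewhere.\<close>

lemma continuously_approximable_cong:
  assumes "\<And>t. t \<in> space (Xi T) \<Longrightarrow> f t = g t" and f: "continuously_approximable T f"
  shows "continuously_approximable T g"
proof -
  have "(AE t in Xi T. (\<lambda>i::nat. s i t) \<longlonglongrightarrow> f t) \<longleftrightarrow> (AE t in Xi T. (\<lambda>i. s i t) \<longlonglongrightarrow> g t)" for s
    by (rule AE_cong) (simp add: assms(1))
  then have "strongly_measurable (Xi T) f = strongly_measurable (Xi T) g"
    unfolding strongly_measurable_def by simp
  moreover have "integrable (Xi T) (\<lambda>t. (norm (f t))\<^sup>2) = integrable (Xi T) (\<lambda>t. (norm (g t))\<^sup>2)"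
    by (rule Bochner_Integration.integrable_cong) (use assms(1) in auto)
  moreover have "(LINT t|Xi T. (norm (f t - \<sigma> t))\<^sup>2) = (LINT t|Xi T. (norm (g t - \<sigma> t))\<^sup>2)" for \<sigma>
    by (rule Bochner_Integration.integral_cong) (use assms(1) in auto)
  ultimately show ?thesis using f by (simp add: continuously_approximable_def L2_def)
qed

lemma continuously_approximable_simple:
  assumes s: "simple_function (Xi T) s"
  shows "continuously_approximable T s"
proof (rule continuously_approximable_cong)
  let ?f = "\<lambda>t. \<Sum>c\<in>s ` space (Xi T). indicat_real (s -` {c} \<inter> space (Xi T)) t *\<^sub>R c"
  show "continuously_approximable T ?f"
    using simple_functionD[OF s] by (intro continuously_approximable_sum continuously_approximable_indicator) auto
  show "?f t = s t" if "t \<in> space (Xi T)" for t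
  proof -
    have "?f t = (\<Sum>c\<in>s ` space (Xi T). if c = s t then c else 0)"
      by (rule sum.cong) (use that in \<open>auto simp: indicator_def\<close>)
    also have "\<dots> = s t" using simple_functionD(1)[OF s] that by (simp add: sum.delta)
    finally show ?thesis .
  qed
qed

lemma L2_continuously_approximable:
  assumes f: "f \<in> L2 T"
  shows "continuously_approximable T f"
  unfolding continuously_approximable_def
proof (intro conjI allI impI)
  fix e :: real assume "e > 0"
  obtain s where s: "\<And>i. simple_function (Xi T) (s i)" "AE x in Xi T. (\<lambda>i. s i x) \<longlonglongrightarrow> f x"
    by (rule strongly_measurableE[OF L2_D(1)[OF f]]) (rule that)
  \<comment> \<open>The truncation supplies the integrable dominating function
    \<open>(3 * norm (f t))\<^sup>2\<close> and keeps the limit: it is eventually inactive where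
    \<open>f t\<close> is nonzero, and it forces the value 0 where \<open>f t = 0\<close>.\<close>
  define r where "r i t = (if norm (s i t) \<le> 2 * norm (f t) then s i t else 0)" for i t
  have mf: "(\<lambda>t. norm (f t)) \<in> borel_measurable (Xi T)"
    by (rule borel_measurable_norm_strongly[OF L2_D(1)[OF f]])
  have ms: "(\<lambda>t. norm (s i t)) \<in> borel_measurable (Xi T)" for i
    by (rule borel_measurable_norm_strongly[OF strongly_measurable_simple[OF s(1)]])
  have r: "simple_function (Xi T) (r i)" for i
  proof -
    note [measurable] = mf ms[of i]
    have "{t \<in> space (Xi T). norm (s i t) \<le> 2 * norm (f t)} \<in> sets (Xi T)" by measurable
    then show ?thesis unfolding r_def by (intro simple_function_If s(1)) auto
  qed
  have rlim: "AE t in Xi T. (\<lambda>i. r i t) \<longlonglongrightarrow> f t"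
    using s(2)
  proof eventually_elim
    fix t assume lim: "(\<lambda>i. s i t) \<longlonglongrightarrow> f t"
    show "(\<lambda>i. r i t) \<longlonglongrightarrow> f t"
    proof (cases "f t = 0")
      case True
      then have "r i t = 0" for i by (simp add: r_def)
      then show ?thesis using True by simp
    next
      case False
      then have "\<forall>\<^sub>F i in sequentially. norm (s i t) < 2 * norm (f t)"
        using tendsto_norm[OF lim] by (intro order_tendstoD) auto
      then have "\<forall>\<^sub>F i in sequentially. s i t = r i t"
        by eventually_elim (simp add: r_def)
      with lim show ?thesis by (rule Lim_transform_eventually)
    qed
  qed
  have rb: "(norm (f t - r i t))\<^sup>2 \<le> (3 * norm (f t))\<^sup>2" for i t
  proof (rule power_mono)
    show "norm (f t - r i t) \<le> 3 * norm (f t)"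
      using norm_triangle_ineq4[of "f t" "r i t"] by (auto simp: r_def split: if_splits)
  qed simp
  have r2: "r i \<in> L2 T" for i
    by (rule L2_bound[where b = "\<lambda>t. 4 * (norm (f t))\<^sup>2"])
       (use r L2_D(2)[OF f] in \<open>auto intro: strongly_measurable_simple simp: r_def power2_eq_square intro!: mult_mono[of _ "2 * norm (f _)" _ "2 * norm (f _)", simplified]\<close>)
  have "(\<lambda>i. LINT t|Xi T. (norm (f t - r i t))\<^sup>2) \<longlonglongrightarrow> (LINT t|Xi T. 0)"
  proof (rule integral_dominated_convergence)
    show "integrable (Xi T) (\<lambda>t. (3 * norm (f t))\<^sup>2)"
      using L2_D(2)[OF f] by (simp add: power_mult_distrib)
    show "(\<lambda>t. (norm (f t - r i t))\<^sup>2) \<in> borel_measurable (Xi T)" for i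
      using L2_D(2)[OF L2_diff[OF f r2]] by (rule borel_measurable_integrable)
    show "AE t in Xi T. (\<lambda>i. (norm (f t - r i t))\<^sup>2) \<longlonglongrightarrow> 0"
      using rlim
    proof eventually_elim
      fix t assume "(\<lambda>i. r i t) \<longlonglongrightarrow> f t"
      then have "(\<lambda>i. (norm (f t - r i t))\<^sup>2) \<longlonglongrightarrow> (norm (f t - f t))\<^sup>2" by (intro tendsto_intros)
      then show "(\<lambda>i. (norm (f t - r i t))\<^sup>2) \<longlonglongrightarrow> 0" by simp
    qed
    show "AE t in Xi T. norm ((norm (f t - r i t))\<^sup>2) \<le> (3 * norm (f t))\<^sup>2" for i
      using rb by simp
  qed simp
  then have "\<forall>\<^sub>F i in sequentially. (LINT t|Xi T. (norm (f t - r i t))\<^sup>2) < e / 4"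
    using \<open>e > 0\<close> by (intro order_tendstoD) auto
  then obtain i where i: "(LINT t|Xi T. (norm (f t - r i t))\<^sup>2) < e / 4"
    by (auto simp: eventually_sequentially)
  have "e / 4 > 0" using \<open>e > 0\<close> by simp
  then obtain \<sigma> where \<sigma>: "\<sigma> \<in> L2 T" "continuous_on UNIV \<sigma>" "(LINT t|Xi T. (norm (r i t - \<sigma> t))\<^sup>2) < e / 4"
    using continuously_approximable_simple[OF r] unfolding continuously_approximable_def by meson
  have "(LINT t|Xi T. (norm ((f t - r i t) + (r i t - \<sigma> t)))\<^sup>2) < e"
    using L2_square_integral_add_le[OF L2_diff[OF f r2[of i]] L2_diff[OF r2[of i] \<sigma>(1)]] i \<sigma>(3)
    by linarith
  then show "\<exists>\<sigma>\<in>L2 T. continuous_on UNIV \<sigma> \<and> (LINT t|Xi T. (norm (f t - \<sigma> t))\<^sup>2) < e"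
    using \<sigma> by (intro bexI[of _ \<sigma>]) auto
qed (rule f)

subsection \<open>The energy identity\<close>

text \<open>Otherwise \<open>\<phi>\<close> would exceed its mean almost everywhere on
  \<open>(x, y)\<close>, while the difference integrates to 0. The set \<open>E\<close> lets the
  point avoid a prescribed null set.\<close>

lemma exists_point_le_average:
  fixes \<phi> :: "real \<Rightarrow> real"
  assumes \<phi>: "integrable (Xi T) \<phi>" and E: "AE t in Xi T. t \<in> E" and xy: "0 \<le> x" "x < y" "y \<le> T"
  obtains p where "p \<in> E" "x < p" "p < y" "(y - x) * \<phi> p \<le> integral {x..y} \<phi>"
proof (rule ccontr)
  assume "\<not> thesis"
  then have less: "integral {x..y} \<phi> < (y - x) * \<phi> p" if "p \<in> E" "x < p" "p < y" for p
    using that \<open>\<And>p. p \<in> E \<Longrightarrow> x < p \<Longrightarrow> p < y \<Longrightarrow> (y - x) * \<phi> p \<le> integral {x..y} \<phi> \<Longrightarrow> thesis\<close> not_less by blast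
  define f where "f t = (y - x) * \<phi> t - integral {x..y} \<phi>" for t
  have f: "integrable (Xi T) f"
    unfolding f_def using \<phi> integrable_Xi_continuous[of T "\<lambda>t. integral {x..y} \<phi>"] by simp
  have "integral {x..y} f = (y - x) * integral {x..y} \<phi> - integral {x..y} (\<lambda>t. integral {x..y} \<phi>)"
    unfolding f_def using integrable_Xi_subinterval[OF \<phi>, of x y] xy
    by (subst Henstock_Kurzweil_Integration.integral_diff) (auto intro!: integrable_on_cmult_left)
  then have "integral {x..y} f = 0" using xy by simp
  then have 0: "(LINT t|Xi T. indicat_real {x<..<y} t * f t) = 0"
    using integral_Xi_indicator(2)[OF f, of x y] xy by simp
  have pos: "f t > 0" if "t \<in> E" "t \<in> {x<..<y}" for t using less that by (auto simp: f_def)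
  have "AE t in Xi T. 0 \<le> indicat_real {x<..<y} t * f t"
    using E by eventually_elim (use pos in \<open>auto simp: indicator_def less_imp_le\<close>)
  then have "AE t in Xi T. indicat_real {x<..<y} t * f t = 0"
    using integral_nonneg_eq_0_iff_AE[OF integral_Xi_indicator(1)[OF f, of x y]] xy 0 by simp
  with E have "AE t in Xi T. indicat_real {x<..<y} t * 1 = 0"
  proof eventually_elim
    fix t assume "t \<in> E" "indicat_real {x<..<y} t * f t = 0"
    then show "indicat_real {x<..<y} t * 1 = 0" using pos[of t] by (auto simp: indicator_def split: if_splits)
  qed
  then have "(LINT t|Xi T. indicat_real {x<..<y} t * 1) = (LINT t|Xi T. 0)"
    by (rule integral_cong_AE[rotated 2])
       (use xy integral_Xi_indicator(1)[of T "\<lambda>t. 1" x y] integrable_Xi_continuous[of T "\<lambda>t. 1"] in \<open>auto dest: borel_measurable_integrable\<close>)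
  moreover have "(LINT t|Xi T. indicat_real {x<..<y} t * 1) = integral {x..y} (\<lambda>t. 1::real)"
    using xy by (intro integral_Xi_indicator(2) integrable_Xi_continuous) auto
  ultimately show False using xy by simp
qed

text \<open>For the zero function, \<open>exists_point_le_average\<close> says that \<open>E\<close>
  meets every interval, hence is dense.\<close>

lemma closure_of_full_measure:
  assumes E: "AE t in Xi T. t \<in> E" "E \<subseteq> {0..T}" and "T > 0"
  shows "closure E = {0..T}"
proof
  show "closure E \<subseteq> {0..T}" using E(2) by (simp add: closure_minimal)
  have "t \<in> closure E" if t: "t \<in> {0<..<T}" for t
    unfolding closure_approachable
  proof (intro allI impI)
    fix e :: real assume "e > 0"
    have "integrable (Xi T) (\<lambda>t. 0::real)" by simp
    then obtain p where "p \<in> E" "t < p" "p < min (t + e) T"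
      using exists_point_le_average[OF _ E(1), of "\<lambda>t. 0" t "min (t + e) T"] t \<open>e > 0\<close> by auto
    then show "\<exists>y\<in>E. dist y t < e" by (intro bexI[of _ p]) (auto simp: dist_real_def)
  qed
  then have "{0<..<T} \<subseteq> closure E" by blast
  then have "closure {0<..<T} \<subseteq> closure E" by (simp add: closure_minimal)
  then show "{0..T} \<subseteq> closure E" using \<open>T > 0\<close> by simp
qed

lemma norm_add3_power2_le: "(norm (x + y + z))\<^sup>2 \<le> 3 * (norm (x::'b::real_normed_vector))\<^sup>2 + 3 * (norm y)\<^sup>2 + 3 * (norm z)\<^sup>2"
proof -
  have "(norm (x + y + z))\<^sup>2 \<le> (norm x + norm y + norm z)\<^sup>2"
    using norm_triangle_ineq[of "x + y" z] norm_triangle_ineq[of x y] by (intro power_mono) auto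
  also have "\<dots> \<le> 3 * (norm x)\<^sup>2 + 3 * (norm y)\<^sup>2 + 3 * (norm z)\<^sup>2"
    using sum_squares_bound[of "norm x" "norm y"] sum_squares_bound[of "norm x" "norm z"]
      sum_squares_bound[of "norm y" "norm z"]
    by (simp add: power2_eq_square algebra_simps)
  finally show ?thesis .
qed

text \<open>The set \<open>E\<close> gathers the good times. The integrated form of the derivative
  is demanded only for test vectors \<open>w r\<close> with \<open>r\<close> in \<open>E\<close>,
  which is what the energy argument evaluates.\<close>

locale weakly_differentiable_path =
  fixes T :: real and \<iota> :: "'v::{real_inner,complete_space} \<Rightarrow>\<^sub>L 'h::{real_inner,complete_space}"
    and w :: "real \<Rightarrow> 'v" and g :: "real \<Rightarrow> 'v \<Rightarrow>\<^sub>L real" and E :: "real set"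
  assumes T_pos: "T > 0" and w: "w \<in> L2 T" and g: "g \<in> L2 T"
    and E_sub: "E \<subseteq> {0<..<T}" and E_AE: "AE t in Xi T. t \<in> E"
    and increment: "\<And>s t r. s \<in> E \<Longrightarrow> t \<in> E \<Longrightarrow> r \<in> E \<Longrightarrow>
      (\<iota> (w t) - \<iota> (w s)) \<bullet> \<iota> (w r) = integral {0..t} (\<lambda>q. g q (w r)) - integral {0..s} (\<lambda>q. g q (w r))"
begin

text \<open>The energy defect; its constancy on \<open>E\<close> is the energy identity between
  times in \<open>E\<close>.\<close>

definition M :: "real \<Rightarrow> real" where
  "M t = (norm (\<iota> (w t)))\<^sup>2 - 2 * integral {0..t} (\<lambda>r. g r (w r))"

lemma integrable_g_const: "integrable (Xi T) (\<lambda>r. g r v)"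
  by (rule L2_pairing_integrable[OF g L2_const])

lemma integrable_g_w: "integrable (Xi T) (\<lambda>r. g r (w r))"
  by (rule L2_pairing_integrable[OF g w])

lemma increment_integral:
  assumes "s \<in> E" "t \<in> E" "r \<in> E" "s < t"
  shows "(\<iota> (w t) - \<iota> (w s)) \<bullet> \<iota> (w r) = integral {s..t} (\<lambda>q. g q (w r))"
proof -
  have "s \<in> {0<..<T}" "t \<in> {0<..<T}" using assms E_sub by auto
  then show ?thesis
    using increment[OF assms(1-3)] integral_interval_diff[OF integrable_g_const, of s t "w r"] assms(4) by simp
qed

text \<open>Since |x|^2 - |y|^2 = (x - y, x) + (x - y, y), pairing the increment with both end
  values leaves no quadratic remainder in \<open>H\<close>; only deviations of \<open>w\<close> from
  its end values, measured in \<open>V\<close>, appear.\<close>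

lemma M_increment:
  assumes st: "s \<in> E" "t \<in> E" "s < t"
  shows "M t - M s = integral {s..t} (\<lambda>r. g r (w t - w r) + g r (w s - w r))"
proof -
  have b: "0 \<le> s" "t \<le> T" using st E_sub by auto
  note i = integrable_Xi_subinterval[OF integrable_g_const b] integrable_Xi_subinterval[OF integrable_g_w b]
  have "(norm (\<iota> (w t)))\<^sup>2 - (norm (\<iota> (w s)))\<^sup>2 = (\<iota> (w t) - \<iota> (w s)) \<bullet> \<iota> (w t) + (\<iota> (w t) - \<iota> (w s)) \<bullet> \<iota> (w s)"
    by (simp add: power2_norm_eq_inner inner_diff_left inner_diff_right inner_commute)
  also have "\<dots> = integral {s..t} (\<lambda>q. g q (w t)) + integral {s..t} (\<lambda>q. g q (w s))"
    using increment_integral[OF st(1,2,2,3)] increment_integral[OF st(1,2,1,3)] by simp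
  finally have "M t - M s = integral {s..t} (\<lambda>q. g q (w t)) + integral {s..t} (\<lambda>q. g q (w s)) - 2 * integral {s..t} (\<lambda>r. g r (w r))"
    using integral_interval_diff[OF integrable_g_w, of s t] b st by (simp add: M_def)
  also have "\<dots> = integral {s..t} (\<lambda>r. g r (w t) + g r (w s) - 2 * g r (w r))"
    by (rule integral_unique[symmetric], intro has_integral_diff has_integral_add has_integral_mult_right integrable_integral i)
  also have "(\<lambda>r. g r (w t) + g r (w s) - 2 * g r (w r)) = (\<lambda>r. g r (w t - w r) + g r (w s - w r))"
    by (simp add: blinfun.diff_right)
  finally show ?thesis .
qed

lemma L2_const_diff: "(\<lambda>r. v - w r) \<in> L2 T"
  by (rule L2_diff[OF L2_const w])

lemma M_increment_le:
  assumes st: "s \<in> E" "t \<in> E" "s < t" and "k > 0"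
  shows "\<bar>M t - M s\<bar> \<le> integral {s..t} (\<lambda>r. k * (norm (g r))\<^sup>2 + ((norm (w t - w r))\<^sup>2 + (norm (w s - w r))\<^sup>2) / k)"
proof -
  have b: "0 \<le> s" "t \<le> T" using st E_sub by auto
  have i1: "integrable (Xi T) (\<lambda>r. g r (w t - w r) + g r (w s - w r))"
    using L2_pairing_integrable[OF g L2_const_diff] by simp
  have i2: "integrable (Xi T) (\<lambda>r. k * (norm (g r))\<^sup>2 + ((norm (w t - w r))\<^sup>2 + (norm (w s - w r))\<^sup>2) / k)"
    using L2_D(2)[OF g] L2_D(2)[OF L2_const_diff] by simp
  have "norm (integral {s..t} (\<lambda>r. g r (w t - w r) + g r (w s - w r))) \<le>
      integral {s..t} (\<lambda>r. k * (norm (g r))\<^sup>2 + ((norm (w t - w r))\<^sup>2 + (norm (w s - w r))\<^sup>2) / k)"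
  proof (rule integral_norm_bound_integral)
    fix r
    have *: "2 * \<bar>g r v\<bar> \<le> k * (norm (g r))\<^sup>2 + (norm v)\<^sup>2 / k" for v
      using norm_blinfun[of "g r" v] mult_le_weighted_squares[OF \<open>k > 0\<close>, of "norm (g r)" "norm v"] by simp
    have "(norm v)\<^sup>2 / k \<ge> 0" for v :: 'v using \<open>k > 0\<close> by simp
    note ** = this[of "w t - w r"] this[of "w s - w r"]
    show "norm (g r (w t - w r) + g r (w s - w r)) \<le> k * (norm (g r))\<^sup>2 + ((norm (w t - w r))\<^sup>2 + (norm (w s - w r))\<^sup>2) / k"
      using *[of "w t - w r"] *[of "w s - w r"] ** unfolding add_divide_distrib by simp
  qed (use integrable_Xi_subinterval[OF i1 b] integrable_Xi_subinterval[OF i2 b] in auto)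
  then show ?thesis using M_increment[OF st] by simp
qed

text \<open>The nodes \<open>t\<^sub>i\<close> are chosen in the cells of a uniform partition such that the squared distance of
  \<open>w(t\<^sub>i)\<close> from a continuous approximation \<open>\<sigma>\<close> of \<open>w\<close> is at most its mean value over the cell.\<close>

lemma M_increment_le_approximation:
  assumes ab: "a \<in> E" "b \<in> E" "a < b" and "k > 0" "d > 0"
  shows "\<bar>M b - M a\<bar> \<le> k * (LINT r|Xi T. (norm (g r))\<^sup>2) + d * (24 + 6 * T) / k"
proof -
  have b: "0 \<le> a" "b \<le> T" using ab E_sub by auto
  obtain \<sigma> where \<sigma>: "\<sigma> \<in> L2 T" "continuous_on UNIV \<sigma>" "(LINT t|Xi T. (norm (w t - \<sigma> t))\<^sup>2) < d"
    using L2_continuously_approximable[OF w] \<open>d > 0\<close> unfolding continuously_approximable_def by blast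
  define c where "c t = (norm (w t - \<sigma> t))\<^sup>2" for t
  have c: "integrable (Xi T) c" unfolding c_def by (rule L2_D(2)[OF L2_diff[OF w \<sigma>(1)]])
  have c0: "c t \<ge> 0" for t by (simp add: c_def)
  have "uniformly_continuous_on {0..T} \<sigma>"
    using \<sigma>(2) by (intro compact_uniformly_continuous) (auto intro: continuous_on_subset)
  moreover have "sqrt d > 0" using \<open>d > 0\<close> by simp
  ultimately obtain \<epsilon> where "\<epsilon> > 0" and \<epsilon>: "\<forall>x\<in>{0..T}. \<forall>x'\<in>{0..T}. dist x' x < \<epsilon> \<longrightarrow> dist (\<sigma> x') (\<sigma> x) < sqrt d"
    unfolding uniformly_continuous_on_def by meson
  have osc: "(norm (\<sigma> x - \<sigma> y))\<^sup>2 \<le> d" if "x \<in> {0..T}" "y \<in> {0..T}" "\<bar>x - y\<bar> < \<epsilon>" for x y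
  proof -
    have "norm (\<sigma> x - \<sigma> y) \<le> sqrt d" using \<epsilon>[rule_format, of y x] that by (auto simp: dist_norm)
    then show ?thesis using \<open>d > 0\<close> by (metis norm_ge_zero power_mono real_sqrt_pow2 less_imp_le)
  qed
  \<comment> \<open>The first bound keeps neighbouring nodes within the oscillation radius of
    \<open>\<sigma>\<close>. The second is for the end nodes \<open>a\<close> and \<open>b\<close>:
    they are prescribed, so \<open>c a\<close> and \<open>c b\<close> obey no mean value bound, but
    a short step makes their contribution at most \<open>d\<close>.\<close>
  define \<theta> where "\<theta> = min (\<epsilon> / 2) (d / (c a + c b + 1))"
  have "\<theta> > 0" using \<open>\<epsilon> > 0\<close> \<open>d > 0\<close> c0[of a] c0[of b] by (simp add: \<theta>_def)
  obtain n :: nat where n: "(b - a) / \<theta> < real n" using reals_Archimedean2[of "(b - a) / \<theta>"] by auto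
  moreover have "(b - a) / \<theta> > 0" using ab \<open>\<theta> > 0\<close> by simp
  ultimately have "n > 0" by (cases n) auto
  define h where "h = (b - a) / n"
  have "h > 0" using ab \<open>n > 0\<close> by (simp add: h_def)
  have "h < \<theta>" using n \<open>n > 0\<close> \<open>\<theta> > 0\<close> by (simp add: h_def field_simps)
  then have h1: "2 * h < \<epsilon>" and h2: "h < d / (c a + c b + 1)" by (auto simp: \<theta>_def)
  have "h * (c a + c b) \<le> h * (c a + c b + 1)" using \<open>h > 0\<close> by simp
  also have "\<dots> < d" using h2 c0[of a] c0[of b] by (simp add: pos_less_divide_eq)
  finally have hc: "h * (c a + c b) \<le> d" by simp
  define x where "x i = a + real i * h" for i :: nat
  have xS: "x (Suc i) = x i + h" for i by (simp add: x_def algebra_simps)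
  have xn: "x n = b" using \<open>n > 0\<close> by (simp add: x_def h_def)
  have xmono: "x i \<le> x j" if "i \<le> j" for i j using that \<open>h > 0\<close> by (simp add: x_def)
  have xab: "a \<le> x i" "i \<le> n \<Longrightarrow> x i \<le> b" for i
    using \<open>h > 0\<close> xmono[of i n] xn by (auto simp: x_def)
  have "\<exists>p. p \<in> E \<and> x i < p \<and> p < x (Suc i) \<and> h * c p \<le> integral {x i..x (Suc i)} c" if "i < n" for i
  proof -
    have "0 \<le> x i" "x i < x (Suc i)" "x (Suc i) \<le> T"
      using xab(1)[of i] xab(2)[of "Suc i"] that b \<open>h > 0\<close> xS[of i] by auto
    then obtain p where "p \<in> E" "x i < p" "p < x (Suc i)" "(x (Suc i) - x i) * c p \<le> integral {x i..x (Suc i)} c"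
      using exists_point_le_average[OF c E_AE] by metis
    then show ?thesis using xS[of i] by auto
  qed
  then obtain p where p: "\<And>i. i < n \<Longrightarrow> p i \<in> E \<and> x i < p i \<and> p i < x (Suc i) \<and> h * c (p i) \<le> integral {x i..x (Suc i)} c"
    by metis
  \<comment> \<open>The nodes are \<open>a\<close>, then one point per cell, then \<open>b\<close>:
    n + 2 nodes and n + 1 increments. Consecutive nodes lie in the same or adjacent cells, hence at
    distance below \<open>2 * h\<close>.\<close>
  define t where "t i = (if i = 0 then a else if i \<le> n then p (i - 1) else b)" for i
  have t0: "t 0 = a" and tn: "t (Suc n) = b" and tp: "i < n \<Longrightarrow> t (Suc i) = p i" for i
    by (auto simp: t_def)
  have tE: "t i \<in> E" for i using p ab \<open>n > 0\<close> by (auto simp: t_def)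
  have tT: "t i \<in> {0..T}" for i using tE[of i] E_sub by auto
  have step: "t i < t (Suc i) \<and> t (Suc i) - t i < 2 * h" if "i \<le> n" for i
  proof -
    have lo: "t i = a \<and> i = 0 \<or> x (i - 1) < t i \<and> t i < x i \<and> i > 0"
      using that p[of "i - 1"] by (auto simp: t_def)
    have hi: "t (Suc i) = b \<and> i = n \<or> x i < t (Suc i) \<and> t (Suc i) < x (Suc i) \<and> i < n"
      using that p[of i] by (auto simp: t_def)
    have x0: "x 0 = a" by (simp add: x_def)
    have xm: "x i = x (i - 1) + h" if "i > 0" using xS[of "i - 1"] that by simp
    show ?thesis using lo hi xm xS[of i] x0 xn ab \<open>h > 0\<close> \<open>n > 0\<close> by auto
  qed
  \<comment> \<open>Splitting \<open>w y - w r\<close> through \<open>\<sigma> y\<close> and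
    \<open>\<sigma> r\<close> costs \<open>3 * c y + 3 * d + 3 * c r\<close> for each of the two end
    nodes \<open>y\<close>. The parts free of \<open>c y\<close> are collected in \<open>f\<close>;
    the nodal parts are summed separately.\<close>
  define f where "f r = k * (norm (g r))\<^sup>2 + 6 * c r / k + 6 * d / k" for r
  have f: "integrable (Xi T) f"
    unfolding f_def using L2_D(2)[OF g] c integrable_Xi_continuous[of T "\<lambda>t. 6 * d / k"] by simp
  have f0: "f r \<ge> 0" for r using \<open>k > 0\<close> \<open>d > 0\<close> c0[of r] by (simp add: f_def)
  define P where "P t = integral {0..t} f" for t
  have bound: "\<bar>M (t (Suc i)) - M (t i)\<bar> \<le> P (t (Suc i)) - P (t i) + (6 * h / k) * (c (t i) + c (t (Suc i)))" if "i \<le> n" for i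
  proof -
    let ?s = "t i" and ?t = "t (Suc i)"
    have st: "?s < ?t" "?t - ?s < 2 * h" using step[OF that] by auto
    have bb: "0 \<le> ?s" "?t \<le> T" using tT[of i] tT[of "Suc i"] by auto
    have i2: "integrable (Xi T) (\<lambda>r. k * (norm (g r))\<^sup>2 + ((norm (w ?t - w r))\<^sup>2 + (norm (w ?s - w r))\<^sup>2) / k)"
      using L2_D(2)[OF g] L2_D(2)[OF L2_const_diff] by simp
    have i3: "integrable (Xi T) (\<lambda>r. f r + (3 * c ?s + 3 * c ?t) / k)"
      using f integrable_Xi_continuous[of T "\<lambda>t. (3 * c ?s + 3 * c ?t) / k"] by simp
    have "\<bar>M ?t - M ?s\<bar> \<le> integral {?s..?t} (\<lambda>r. k * (norm (g r))\<^sup>2 + ((norm (w ?t - w r))\<^sup>2 + (norm (w ?s - w r))\<^sup>2) / k)"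
      by (rule M_increment_le[OF tE tE st(1) \<open>k > 0\<close>])
    also have "\<dots> \<le> integral {?s..?t} (\<lambda>r. f r + (3 * c ?s + 3 * c ?t) / k)"
    proof (rule integral_le)
      fix r assume r: "r \<in> {?s..?t}"
      have rT: "r \<in> {0..T}" using r bb by auto
      have *: "(norm (w y - w r))\<^sup>2 \<le> 3 * c y + 3 * d + 3 * c r" if "y \<in> {0..T}" "\<bar>y - r\<bar> < \<epsilon>" for y
      proof -
        have "w y - w r = (w y - \<sigma> y) + (\<sigma> y - \<sigma> r) + (\<sigma> r - w r)" by simp
        then have "(norm (w y - w r))\<^sup>2 \<le> 3 * c y + 3 * (norm (\<sigma> y - \<sigma> r))\<^sup>2 + 3 * c r"
          using norm_add3_power2_le[of "w y - \<sigma> y" "\<sigma> y - \<sigma> r" "\<sigma> r - w r"]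
          by (simp add: c_def norm_minus_commute)
        also have "\<dots> \<le> 3 * c y + 3 * d + 3 * c r" using osc[OF that(1) rT that(2)] by simp
        finally show ?thesis .
      qed
      have "(norm (w ?t - w r))\<^sup>2 + (norm (w ?s - w r))\<^sup>2 \<le> 6 * c r + 6 * d + (3 * c ?s + 3 * c ?t)"
        using *[OF tT[of i]] *[OF tT[of "Suc i"]] r st h1 by auto
      then have "((norm (w ?t - w r))\<^sup>2 + (norm (w ?s - w r))\<^sup>2) / k \<le> (6 * c r + 6 * d + (3 * c ?s + 3 * c ?t)) / k"
        using \<open>k > 0\<close> by (intro divide_right_mono) auto
      then show "k * (norm (g r))\<^sup>2 + ((norm (w ?t - w r))\<^sup>2 + (norm (w ?s - w r))\<^sup>2) / k \<le> f r + (3 * c ?s + 3 * c ?t) / k"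
        by (simp add: f_def add_divide_distrib)
    qed (use integrable_Xi_subinterval[OF i2 bb] integrable_Xi_subinterval[OF i3 bb] in auto)
    also have "\<dots> = integral {?s..?t} f + integral {?s..?t} (\<lambda>r. (3 * c ?s + 3 * c ?t) / k)"
      by (rule Henstock_Kurzweil_Integration.integral_add) (use integrable_Xi_subinterval[OF f bb] in auto)
    also have "\<dots> = P ?t - P ?s + (?t - ?s) * ((3 * c ?s + 3 * c ?t) / k)"
      using integral_interval_diff[OF f bb(1) less_imp_le[OF st(1)] bb(2)] st(1) by (simp add: P_def)
    also have "(?t - ?s) * ((3 * c ?s + 3 * c ?t) / k) \<le> (2 * h) * ((3 * c ?s + 3 * c ?t) / k)"
      using st c0[of ?s] c0[of ?t] \<open>k > 0\<close> by (intro mult_right_mono) auto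
    also have "(2 * h) * ((3 * c ?s + 3 * c ?t) / k) = (6 * h / k) * (c ?s + c ?t)"
      by (simp add: field_simps)
    finally show ?thesis by simp
  qed
  have "\<bar>M b - M a\<bar> = \<bar>\<Sum>i<Suc n. M (t (Suc i)) - M (t i)\<bar>"
    using sum_lessThan_telescope[of "\<lambda>i. M (t i)" "Suc n"] by (simp only: t0 tn)
  also have "\<dots> \<le> (\<Sum>i<Suc n. P (t (Suc i)) - P (t i) + (6 * h / k) * (c (t i) + c (t (Suc i))))"
    by (rule order_trans[OF sum_abs sum_mono]) (use bound in auto)
  also have "\<dots> = (P b - P a) + (6 / k) * (\<Sum>i<Suc n. h * (c (t i) + c (t (Suc i))))"
    using sum_lessThan_telescope[of "\<lambda>i. P (t i)" "Suc n"]
    by (simp only: sum.distrib t0 tn sum_distrib_left) (simp add: mult.assoc)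
  finally have tel: "\<bar>M b - M a\<bar> \<le> (P b - P a) + (6 / k) * (\<Sum>i<Suc n. h * (c (t i) + c (t (Suc i))))" .
  \<comment> \<open>Each interior node belongs to two increments, hence the factor 2.\<close>
  have sum_eq: "(\<Sum>i<Suc n. h * (c (t i) + c (t (Suc i)))) = h * (c a + c b) + 2 * (\<Sum>i<n. h * c (p i))"
  proof -
    have "(\<Sum>i<Suc n. h * c (t i)) = h * c a + (\<Sum>i<n. h * c (p i))"
      unfolding sum.lessThan_Suc_shift by (simp add: t0 tp)
    moreover have "(\<Sum>i<Suc n. h * c (t (Suc i))) = (\<Sum>i<n. h * c (p i)) + h * c b"
      by (simp add: tn tp)
    ultimately show ?thesis by (simp only: distrib_left sum.distrib)
  qed
  have sum_le: "(\<Sum>i<n. h * c (p i)) \<le> d"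
  proof -
    define Q where "Q t = integral {0..t} c" for t
    have "(\<Sum>i<n. h * c (p i)) \<le> (\<Sum>i<n. Q (x (Suc i)) - Q (x i))"
    proof (rule sum_mono)
      fix i assume "i \<in> {..<n}"
      then have i: "i < n" by simp
      have "integral {x i..x (Suc i)} c = Q (x (Suc i)) - Q (x i)"
        unfolding Q_def using xab(1)[of i] xab(2)[of "Suc i"] i b xmono[of i "Suc i"]
        by (intro integral_interval_diff[OF c]) auto
      then show "h * c (p i) \<le> Q (x (Suc i)) - Q (x i)" using p[OF i] by simp
    qed
    also have "\<dots> = Q b - Q a"
      using sum_lessThan_telescope[of "\<lambda>i. Q (x i)" n] xn by (simp add: x_def[of 0])
    also have "\<dots> = integral {a..b} c"
      unfolding Q_def using integral_interval_diff[OF c b(1) less_imp_le[OF ab(3)] b(2)] by simp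
    also have "\<dots> \<le> integral {0..T} c"
      by (rule integral_subset_le) (use b c0 integrable_Xi_subinterval[OF c] in auto)
    also have "\<dots> \<le> d" using \<sigma>(3) integral_Xi[OF c] by (simp add: c_def)
    finally show ?thesis .
  qed
  have "(6 / k) * (h * (c a + c b) + 2 * (\<Sum>i<n. h * c (p i))) \<le> (6 / k) * (3 * d)"
    using sum_le hc \<open>k > 0\<close> by (intro mult_left_mono) auto
  with tel have "\<bar>M b - M a\<bar> \<le> (P b - P a) + (6 / k) * (3 * d)"
    unfolding sum_eq by linarith
  moreover have "P b - P a \<le> k * (LINT r|Xi T. (norm (g r))\<^sup>2) + 6 * (LINT r|Xi T. c r) / k + T * (6 * d / k)"
  proof -
    have "P b - P a = integral {a..b} f"
      unfolding P_def using integral_interval_diff[OF f b(1) less_imp_le[OF ab(3)] b(2)] by simp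
    also have "\<dots> \<le> integral {0..T} f"
      by (rule integral_subset_le) (use b f0 integrable_Xi_subinterval[OF f] in auto)
    also have "\<dots> = (LINT r|Xi T. f r)" by (rule integral_Xi[OF f, symmetric])
    also have "\<dots> = k * (LINT r|Xi T. (norm (g r))\<^sup>2) + 6 * (LINT r|Xi T. c r) / k + (LINT r|Xi T. 6 * d / k)"
      unfolding f_def using L2_D(2)[OF g] c integrable_Xi_continuous[of T "\<lambda>t. 6 * d / k"] by simp
    also have "(LINT r|Xi T. 6 * d / k) = T * (6 * d / k)"
      using integral_Xi[OF integrable_Xi_continuous[of T "\<lambda>t. 6 * d / k"]] T_pos by simp
    finally show ?thesis .
  qed
  moreover have "6 * (LINT r|Xi T. c r) / k \<le> 6 * d / k"
    using \<sigma>(3) \<open>k > 0\<close> by (intro divide_right_mono) (auto simp: c_def)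
  \<comment> \<open>Of the 24, the integral of \<open>c\<close> contributes 6 and the nodal sum, at
    most \<open>3 * d\<close>, contributes 18; \<open>6 * T\<close> comes from the constant term of
    \<open>f\<close>.\<close>
  moreover have "6 * d / k + T * (6 * d / k) + (6 / k) * (3 * d) = d * (24 + 6 * T) / k"
    by (simp add: add_divide_distrib algebra_simps)
  ultimately show ?thesis by linarith
qed

text \<open>The order of choice matters: \<open>k\<close> first makes the term with \<open>g\<close>
  at most \<open>e / 2\<close>, then \<open>d\<close>, depending on \<open>k\<close>, does the same
  for the approximation error.\<close>

lemma M_const:
  assumes "a \<in> E" "b \<in> E"
  shows "M a = M b"
proof -
  have aux: "M b = M a" if ab: "a \<in> E" "b \<in> E" "a < b" for a b
  proof -
    define G where "G = (LINT r|Xi T. (norm (g r))\<^sup>2)"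
    have "G \<ge> 0" unfolding G_def by (rule Bochner_Integration.integral_nonneg) simp
    have "\<bar>M b - M a\<bar> \<le> 0 + e" if "e > 0" for e
    proof -
      define k where "k = e / (2 * (G + 1))"
      define Z where "Z = 24 + 6 * T"
      define d where "d = e * k / (2 * Z)"
      have "Z > 0" using T_pos by (simp add: Z_def)
      have "k > 0" using \<open>e > 0\<close> \<open>G \<ge> 0\<close> by (simp add: k_def)
      have "d > 0" using \<open>e > 0\<close> \<open>k > 0\<close> \<open>Z > 0\<close> by (simp add: d_def)
      have "k * G \<le> k * (G + 1)" using \<open>k > 0\<close> by simp
      also have "\<dots> = e / 2" using \<open>G \<ge> 0\<close> by (simp add: k_def field_simps)
      finally have "k * G \<le> e / 2" .
      moreover have "d * Z / k = e / 2"
        using \<open>k > 0\<close> \<open>Z > 0\<close> by (simp add: d_def)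
      ultimately have "k * G + d * Z / k \<le> e / 2 + e / 2" by (intro add_mono) auto
      then have "k * G + d * Z / k \<le> 0 + e" by simp
      with M_increment_le_approximation[OF ab \<open>k > 0\<close> \<open>d > 0\<close>, folded G_def Z_def] show ?thesis by (rule order_trans)
    qed
    then have "\<bar>M b - M a\<bar> \<le> 0" by (rule field_le_epsilon)
    then show ?thesis by simp
  qed
  show ?thesis using aux[of a b] aux[of b a] assms by (cases a b rule: linorder_cases) auto
qed

text \<open>A continuous control function: its increments bound squared distances of values of
  \<open>w\<close> in \<open>H\<close>, so its uniform continuity passes to
  \<open>w\<close>.\<close>

definition \<mu> :: "real \<Rightarrow> real" where
  "\<mu> t = integral {0..t} (\<lambda>r. (norm (g r))\<^sup>2 + (norm (w r))\<^sup>2)"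

text \<open>Since \<open>w - v\<close> has the same derivative as \<open>w\<close> for every constant \<open>v\<close>, the energy identity can be
  applied to \<open>w - w(s)\<close>, where \<open>s\<close> is chosen such that \<open>\<parallel>w(s)\<parallel>\<^sup>2\<close> does not exceed its mean value.\<close>

lemma distance_square_le:
  assumes st: "s \<in> E" "t \<in> E" and xy: "0 \<le> x" "x < y" "y \<le> T" "s \<in> {x..y}" "t \<in> {x..y}"
    and s: "(y - x) * (norm (w s))\<^sup>2 \<le> integral {x..y} (\<lambda>r. (norm (w r))\<^sup>2)"
  shows "(norm (\<iota> (w t) - \<iota> (w s)))\<^sup>2 \<le> 2 * (\<mu> y - \<mu> x)"
proof -
  define q where "q r = 2 * (norm (g r))\<^sup>2 + (norm (w r))\<^sup>2 + (norm (w s))\<^sup>2" for r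
  have ig: "integrable (Xi T) (\<lambda>r. (norm (g r))\<^sup>2)" and iw: "integrable (Xi T) (\<lambda>r. (norm (w r))\<^sup>2)"
    using L2_D(2) g w by auto
  have iq: "integrable (Xi T) q"
    unfolding q_def using ig iw integrable_Xi_continuous[of T "\<lambda>t. (norm (w s))\<^sup>2"] by simp
  have q0: "q r \<ge> 0" for r by (simp add: q_def)
  define f where "f r = 2 * g r (w r) - 2 * g r (w s)" for r
  have f: "integrable (Xi T) f" unfolding f_def using integrable_g_w integrable_g_const by simp
  have fq: "\<bar>f r\<bar> \<le> q r" for r
  proof -
    have "\<bar>2 * g r v\<bar> \<le> (norm (g r))\<^sup>2 + (norm v)\<^sup>2" for v
      using norm_blinfun[of "g r" v] sum_squares_bound[of "norm (g r)" "norm v"] by simp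
    from this[of "w r"] this[of "w s"] show ?thesis unfolding f_def q_def by linarith
  qed
  have fint: "\<bar>integral {u..v} f\<bar> \<le> integral {x..y} q" if "x \<le> u" "v \<le> y" for u v
  proof -
    have "norm (integral {u..v} f) \<le> integral {u..v} q"
      using integrable_Xi_subinterval[OF f, of u v] integrable_Xi_subinterval[OF iq, of u v] fq that xy
      by (intro integral_norm_bound_integral) auto
    also have "\<dots> \<le> integral {x..y} q"
      using integrable_Xi_subinterval[OF iq, of u v] integrable_Xi_subinterval[OF iq, of x y] q0 that xy
      by (intro integral_subset_le) auto
    finally show ?thesis by simp
  qed
  define F where "F t = integral {0..t} f" for t
  have sT: "s \<in> {0..T}" "t \<in> {0..T}" using xy by auto
  have F: "F r = 2 * integral {0..r} (\<lambda>r. g r (w r)) - 2 * integral {0..r} (\<lambda>q. g q (w s))" if "r \<in> {0..T}" for r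
    unfolding F_def f_def using that
    by (intro integral_unique has_integral_diff has_integral_mult_right integrable_integral
        integrable_Xi_subinterval[OF integrable_g_w] integrable_Xi_subinterval[OF integrable_g_const]) auto
  \<comment> \<open>This expansion extracts the energy identity for \<open>w - w s\<close> from
    \<open>M_const\<close> for \<open>w\<close> itself: the cross term is the increment tested with
    \<open>w s\<close>.\<close>
  have "(norm (\<iota> (w t) - \<iota> (w s)))\<^sup>2 = (norm (\<iota> (w t)))\<^sup>2 - (norm (\<iota> (w s)))\<^sup>2 - 2 * ((\<iota> (w t) - \<iota> (w s)) \<bullet> \<iota> (w s))"
    by (simp add: power2_norm_eq_inner inner_diff_left inner_diff_right inner_commute)
  also have "\<dots> = F t - F s"
    using M_const[OF st] increment[OF st(1,2,1)] F[OF sT(1)] F[OF sT(2)] by (simp add: M_def)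
  also have "\<dots> \<le> integral {x..y} q"
  proof (cases "s \<le> t")
    case True
    then have "F t - F s = integral {s..t} f"
      unfolding F_def using integral_interval_diff[OF f, of s t] sT by simp
    then show ?thesis using fint[of s t] xy by auto
  next
    case False
    then have "F t - F s = - integral {t..s} f"
      unfolding F_def using integral_interval_diff[OF f, of t s] sT by simp
    then show ?thesis using fint[of t s] xy by auto
  qed
  also have "\<dots> = 2 * integral {x..y} (\<lambda>r. (norm (g r))\<^sup>2) + integral {x..y} (\<lambda>r. (norm (w r))\<^sup>2) + (y - x) * (norm (w s))\<^sup>2"
  proof (rule integral_unique)
    have "((\<lambda>r. (norm (w s))\<^sup>2) has_integral (y - x) * (norm (w s))\<^sup>2) {x..y}"
      using has_integral_const_real[of "(norm (w s))\<^sup>2" x y] xy by simp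
    then show "(q has_integral 2 * integral {x..y} (\<lambda>r. (norm (g r))\<^sup>2) + integral {x..y} (\<lambda>r. (norm (w r))\<^sup>2) + (y - x) * (norm (w s))\<^sup>2) {x..y}"
      unfolding q_def using integrable_Xi_subinterval[OF ig] integrable_Xi_subinterval[OF iw] xy
      by (intro has_integral_add has_integral_mult_right integrable_integral) auto
  qed
  also have "\<dots> \<le> 2 * (integral {x..y} (\<lambda>r. (norm (g r))\<^sup>2) + integral {x..y} (\<lambda>r. (norm (w r))\<^sup>2))"
    using s by simp
  also have "integral {x..y} (\<lambda>r. (norm (g r))\<^sup>2) + integral {x..y} (\<lambda>r. (norm (w r))\<^sup>2) =
      integral {x..y} (\<lambda>r. (norm (g r))\<^sup>2 + (norm (w r))\<^sup>2)"
    by (rule Henstock_Kurzweil_Integration.integral_add[symmetric]; rule integrable_Xi_subinterval[of T]) (use ig iw xy in auto)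
  also have "\<dots> = \<mu> y - \<mu> x"
    unfolding \<mu>_def using xy ig iw by (intro integral_interval_diff[where T = T]) auto
  finally show ?thesis .
qed

text \<open>Neither \<open>s\<close> nor \<open>t\<close> need have a small norm in
  \<open>V\<close>. Both are compared with an intermediate \<open>p\<close> satisfying the mean
  value condition, hence the factor 2.\<close>

lemma distance_le:
  assumes "s \<in> E" "t \<in> E" "s < t"
  shows "norm (\<iota> (w t) - \<iota> (w s)) \<le> 2 * sqrt (2 * (\<mu> t - \<mu> s))"
proof -
  have b: "0 \<le> s" "t \<le> T" using assms E_sub by auto
  obtain p where p: "p \<in> E" "s < p" "p < t" "(t - s) * (norm (w p))\<^sup>2 \<le> integral {s..t} (\<lambda>r. (norm (w r))\<^sup>2)"
    using exists_point_le_average[OF L2_D(2)[OF w] E_AE b(1) assms(3) b(2)] by metis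
  have "norm (\<iota> (w r) - \<iota> (w p)) \<le> sqrt (2 * (\<mu> t - \<mu> s))" if "r \<in> {s, t}" for r
    using distance_square_le[OF p(1) _ b(1) assms(3) b(2) _ _ p(4), of r] p assms that by (intro real_le_rsqrt) auto
  from this[of s] this[of t] show ?thesis
    using norm_triangle_ineq4[of "\<iota> (w t) - \<iota> (w p)" "\<iota> (w s) - \<iota> (w p)"] by simp
qed

text \<open>Uniform continuity on the dense set \<open>E\<close> gives the extension
  \<open>f\<close>. The defect is constant on \<open>E\<close>, and continuity carries this to 0 and
  \<open>T\<close>, which lie outside \<open>E\<close>.\<close>

lemma continuous_representative_energy:
  obtains f where "continuous_on {0..T} f" "\<And>t. t \<in> E \<Longrightarrow> f t = \<iota> (w t)"
    "(norm (f T))\<^sup>2 - (norm (f 0))\<^sup>2 = 2 * (LINT t|Xi T. g t (w t))"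
proof -
  have cl: "closure E = {0..T}"
    using E_AE E_sub T_pos by (intro closure_of_full_measure) auto
  have i\<mu>: "integrable (Xi T) (\<lambda>r. (norm (g r))\<^sup>2 + (norm (w r))\<^sup>2)"
    using L2_D(2)[OF g] L2_D(2)[OF w] by simp
  have "continuous_on {0..T} \<mu>"
    unfolding \<mu>_def by (rule continuous_on_indefinite_integral_Xi[OF i\<mu>])
  then have u\<mu>: "uniformly_continuous_on {0..T} \<mu>" by (rule compact_uniformly_continuous) simp
  have "uniformly_continuous_on E (\<lambda>t. \<iota> (w t))"
    unfolding uniformly_continuous_on_def
  proof (intro allI impI)
    \<comment> \<open>The 8 matches \<open>distance_le\<close>:
      \<open>2 * sqrt (2 * (e\<^sup>2 / 8)) = e\<close>.\<close>
    fix e :: real assume "e > 0"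
    then have "e\<^sup>2 / 8 > 0" by simp
    then obtain d where "d > 0" and d: "\<forall>x\<in>{0..T}. \<forall>x'\<in>{0..T}. dist x' x < d \<longrightarrow> dist (\<mu> x') (\<mu> x) < e\<^sup>2 / 8"
      using u\<mu> unfolding uniformly_continuous_on_def by meson
    have *: "norm (\<iota> (w t) - \<iota> (w s)) < e" if "s \<in> E" "t \<in> E" "s < t" "t - s < d" for s t
    proof -
      have "s \<in> {0..T}" "t \<in> {0..T}" using that E_sub by auto
      then have "\<bar>\<mu> t - \<mu> s\<bar> < e\<^sup>2 / 8" using d[rule_format, of s t] that by (auto simp: dist_real_def)
      then have "\<mu> t - \<mu> s < e\<^sup>2 / 8" by (rule le_less_trans[OF abs_ge_self])
      then have "2 * (\<mu> t - \<mu> s) < 2 * (e\<^sup>2 / 8)" by (rule mult_strict_left_mono) simp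
      also have "\<dots> = (e / 2)\<^sup>2" by (simp add: power_divide)
      finally have "sqrt (2 * (\<mu> t - \<mu> s)) < sqrt ((e / 2)\<^sup>2)" by (rule real_sqrt_less_mono)
      then have "sqrt (2 * (\<mu> t - \<mu> s)) < e / 2" using \<open>e > 0\<close> by simp
      then show ?thesis using distance_le[OF that(1-3)] by simp
    qed
    show "\<exists>d>0. \<forall>x\<in>E. \<forall>x'\<in>E. dist x' x < d \<longrightarrow> dist (\<iota> (w x')) (\<iota> (w x)) < e"
    proof (intro exI conjI ballI impI)
      fix s t assume "s \<in> E" "t \<in> E" "dist t s < d"
      then show "dist (\<iota> (w t)) (\<iota> (w s)) < e"
        using *[of s t] *[of t s] \<open>e > 0\<close>
        by (cases s t rule: linorder_cases) (auto simp: dist_norm norm_minus_commute)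
    qed (rule \<open>d > 0\<close>)
  qed
  then obtain f where f: "uniformly_continuous_on (closure E) f" "\<And>t. t \<in> E \<Longrightarrow> \<iota> (w t) = f t"
    using uniformly_continuous_on_extension_on_closure by metis
  have cf: "continuous_on {0..T} f" using f(1) cl uniformly_continuous_imp_continuous by metis
  define F where "F t = (norm (f t))\<^sup>2 - 2 * integral {0..t} (\<lambda>r. g r (w r))" for t
  have cF: "continuous_on (closure E) F"
    unfolding F_def cl by (intro continuous_intros cf continuous_on_indefinite_integral_Xi integrable_g_w)
  obtain e0 where "e0 \<in> E" using cl T_pos by (cases "E = {}") auto
  have FE: "F t = F e0" if "t \<in> E" for t
    using M_const[OF that \<open>e0 \<in> E\<close>] f(2)[OF that] f(2)[OF \<open>e0 \<in> E\<close>] by (simp add: F_def M_def)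
  have "F t = F e0" if "t \<in> {0..T}" for t
    by (rule continuous_constant_on_closure[OF cF FE]) (use that cl in auto)
  from this[of 0] this[of T] have "F T = F 0" using T_pos by simp
  then have "(norm (f T))\<^sup>2 - (norm (f 0))\<^sup>2 = 2 * (LINT t|Xi T. g t (w t))"
    using integral_Xi[OF integrable_g_w] by (simp add: F_def)
  then show thesis using cf f(2) by (intro that) auto
qed

end

subsection \<open>Traces and time derivatives\<close>

lemma H_to_dual_apply: "H_to_dual \<iota> h v = h \<bullet> \<iota> v"
  by (simp add: H_to_dual_def)

text \<open>Continuity in \<open>v\<close> is what lets the increment identity pass from a set of
  test vectors to its closure.\<close>

lemma bounded_linear_integral_pairing:
  fixes g :: "real \<Rightarrow> 'v::real_normed_vector \<Rightarrow>\<^sub>L real"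
  assumes g: "g \<in> L2 T" and t: "t \<in> {0..T}"
  shows "bounded_linear (\<lambda>v. integral {0..t} (\<lambda>q. g q v))"
proof (rule bounded_linear_intro)
  have i: "(\<lambda>q. g q v) integrable_on {0..t}" for v
    using integrable_Xi_subinterval[OF L2_pairing_integrable[OF g L2_const]] t by auto
  show "integral {0..t} (\<lambda>q. g q (x + y)) = integral {0..t} (\<lambda>q. g q x) + integral {0..t} (\<lambda>q. g q y)" for x y
    using i by (simp add: blinfun.add_right Henstock_Kurzweil_Integration.integral_add)
  show "integral {0..t} (\<lambda>q. g q (r *\<^sub>R x)) = r *\<^sub>R integral {0..t} (\<lambda>q. g q x)" for r x
    by (simp add: blinfun.scaleR_right)
  show "norm (integral {0..t} (\<lambda>q. g q x)) \<le> norm x * integral {0..t} (\<lambda>q. norm (g q))" for x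
  proof -
    have "integrable (Xi T) (\<lambda>q. norm (g q))"
      using L2_norm_mult_integrable[OF g L2_const[of "1::real"]] by simp
    then have n: "(\<lambda>q. norm (g q)) integrable_on {0..t}"
      using integrable_Xi_subinterval t by auto
    have "norm (integral {0..t} (\<lambda>q. g q x)) \<le> integral {0..t} (\<lambda>q. norm x * norm (g q))"
      using norm_blinfun[of "g _" x]
      by (intro integral_norm_bound_integral i integrable_on_mult_right n) (auto simp: mult.commute)
    then show ?thesis by simp
  qed
qed

text \<open>As \<open>V\<close> need not be separable, the exceptional null sets are controlled by testing only with the
  countably many values of approximating simple functions; their closure contains almost every \<open>w(t)\<close>.\<close>

lemma weakly_differentiable_path_exists:
  assumes T: "T > 0" and w: "w \<in> L2 T" and g: "g \<in> L2 T"
    and weak: "weak_derivative T (\<lambda>t. H_to_dual \<iota> (\<iota> (w t))) g"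
  shows "\<exists>E. weakly_differentiable_path T \<iota> w g E"
proof -
  obtain s where s: "\<And>i. simple_function (Xi T) (s i)" "AE x in Xi T. (\<lambda>i. s i x) \<longlonglongrightarrow> w x"
    by (rule strongly_measurableE[OF L2_D(1)[OF w]]) (rule that)
  define D where "D = (\<Union>i. s i ` space (Xi T))"
  have "countable D" unfolding D_def by (intro countable_UN countableI_type countable_finite[OF simple_functionD(1)[OF s(1)]])
  have "\<exists>c. AE t in Xi T. \<iota> (w t) \<bullet> \<iota> v = c + integral {0..t} (\<lambda>q. g q v)" for v
  proof -
    have "integrable (Xi T) (\<lambda>t. H_to_dual \<iota> (\<iota> v) (w t))"
      by (rule L2_pairing_integrable[OF L2_const w])
    then have "integrable (Xi T) (\<lambda>t. \<iota> (w t) \<bullet> \<iota> v)" by (simp add: H_to_dual_apply inner_commute)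
    moreover have "integrable (Xi T) (\<lambda>q. g q v)" by (rule L2_pairing_integrable[OF g L2_const])
    ultimately obtain c where "AE t in Xi T. \<iota> (w t) \<bullet> \<iota> v = c + integral {0..t} (\<lambda>q. g q v)"
    proof (rule du_Bois_Reymond[OF T])
      fix \<phi> assume "test_function T \<phi>"
      then show "(LINT t|Xi T. deriv \<phi> t * (\<iota> (w t) \<bullet> \<iota> v)) = - (LINT t|Xi T. \<phi> t * g t v)"
        using weak by (simp add: weak_derivative_def H_to_dual_apply)
    qed
    then show ?thesis by blast
  qed
  then obtain c where c: "\<And>v. AE t in Xi T. \<iota> (w t) \<bullet> \<iota> v = c v + integral {0..t} (\<lambda>q. g q v)" by metis
  define E where "E = {t\<in>{0<..<T}. w t \<in> closure D \<and> (\<forall>v\<in>D. \<iota> (w t) \<bullet> \<iota> v = c v + integral {0..t} (\<lambda>q. g q v))}"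
  have "AE t in Xi T. \<forall>v\<in>D. \<iota> (w t) \<bullet> \<iota> v = c v + integral {0..t} (\<lambda>q. g q v)"
    using c by (subst AE_ball_countable[OF \<open>countable D\<close>]) blast
  moreover have "AE t in Xi T. w t \<in> closure D"
    using s(2) AE_space
  proof eventually_elim
    fix t assume "(\<lambda>i. s i t) \<longlonglongrightarrow> w t" "t \<in> space (Xi T)"
    moreover from this(2) have "s i t \<in> D" for i unfolding D_def by blast
    ultimately show "w t \<in> closure D" unfolding closure_sequential by (intro exI[of _ "\<lambda>i. s i t"]) auto
  qed
  ultimately have E_AE: "AE t in Xi T. t \<in> E"
    using AE_space by eventually_elim (simp add: E_def)
  \<comment> \<open>The integration constants \<open>c v\<close> cancel in differences of times,
    leaving two sides that are continuous in the test vector.\<close>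
  have inc: "(\<iota> (w t) - \<iota> (w s)) \<bullet> \<iota> (w r) = integral {0..t} (\<lambda>q. g q (w r)) - integral {0..s} (\<lambda>q. g q (w r))"
    if "s \<in> E" "t \<in> E" "r \<in> E" for s t r
  proof -
    let ?C = "{v. (\<iota> (w t) - \<iota> (w s)) \<bullet> \<iota> v = integral {0..t} (\<lambda>q. g q v) - integral {0..s} (\<lambda>q. g q v)}"
    have st: "s \<in> {0..T}" "t \<in> {0..T}" using that by (auto simp: E_def)
    have "closed ?C"
      using bounded_linear_integral_pairing[OF g st(1)] bounded_linear_integral_pairing[OF g st(2)]
      by (intro closed_Collect_eq continuous_intros linear_continuous_on) auto
    moreover have "D \<subseteq> ?C"
      using that by (auto simp: E_def inner_diff_left)
    ultimately have "closure D \<subseteq> ?C" by (rule closure_minimal[rotated])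
    then show ?thesis using that by (auto simp: E_def)
  qed
  show ?thesis
    by (rule exI[of _ E], unfold_locales) (use T w g E_AE inc in \<open>auto simp: E_def\<close>)
qed

lemma continuous_eq_if_AE_eq:
  fixes f h :: "real \<Rightarrow> 'b::real_normed_vector"
  assumes "T > 0" "continuous_on {0..T} f" "continuous_on {0..T} h" and eq: "AE t in Xi T. f t = h t"
    and t: "t \<in> {0..T}"
  shows "f t = h t"
proof -
  let ?E = "{t\<in>{0..T}. f t = h t}"
  have "AE t in Xi T. t \<in> ?E" using eq AE_space by eventually_elim auto
  then have cl: "closure ?E = {0..T}" by (rule closure_of_full_measure) (use \<open>T > 0\<close> in auto)
  have "f t - h t = 0"
    by (rule continuous_constant_on_closure[of ?E "\<lambda>t. f t - h t"])
       (use assms cl in \<open>auto intro!: continuous_intros\<close>)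
  then show ?thesis by simp
qed

lemma X_space_D:
  assumes "w \<in> X_space T \<iota>"
  shows "w \<in> L2 T" "time_derivative T \<iota> w \<in> L2 T"
    "weak_derivative T (\<lambda>t. H_to_dual \<iota> (\<iota> (w t))) (time_derivative T \<iota> w)"
proof -
  show "w \<in> L2 T" using assms by (simp add: X_space_def Y_space_def)
  have "\<exists>g. g \<in> L2 T \<and> weak_derivative T (\<lambda>t. H_to_dual \<iota> (\<iota> (w t))) g"
    using assms by (auto simp: X_space_def H1_dual_def)
  from someI_ex[OF this] show "time_derivative T \<iota> w \<in> L2 T"
    "weak_derivative T (\<lambda>t. H_to_dual \<iota> (\<iota> (w t))) (time_derivative T \<iota> w)"
    by (auto simp: time_derivative_def)
qed

text \<open>The chosen representative and the constructed one are continuous and agree almost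
  everywhere, hence agree at 0 and \<open>T\<close>, where the energy identity is evaluated.\<close>

lemma trace_at_continuous_energy:
  assumes T: "T > 0" and w: "w \<in> X_space T \<iota>"
  shows "continuous_on {0..T} (\<lambda>t. trace_at T \<iota> t w)" "AE t in Xi T. trace_at T \<iota> t w = \<iota> (w t)"
    and "(norm (trace_at T \<iota> T w))\<^sup>2 - (norm (trace_at T \<iota> 0 w))\<^sup>2 = 2 * op_dt T \<iota> w w"
proof -
  obtain E where "weakly_differentiable_path T \<iota> w (time_derivative T \<iota> w) E"
    using weakly_differentiable_path_exists[OF T X_space_D[OF w]] by blast
  then interpret weakly_differentiable_path T \<iota> w "time_derivative T \<iota> w" E .
  obtain f where f: "continuous_on {0..T} f" "\<And>t. t \<in> E \<Longrightarrow> f t = \<iota> (w t)"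
    "(norm (f T))\<^sup>2 - (norm (f 0))\<^sup>2 = 2 * (LINT t|Xi T. time_derivative T \<iota> w t (w t))"
    using continuous_representative_energy by blast
  have f_AE: "AE t in Xi T. f t = \<iota> (w t)" using E_AE by eventually_elim (rule f)
  with f have "\<exists>f. continuous_on {0..T} f \<and> (AE t in Xi T. f t = \<iota> (w t))" by blast
  from someI_ex[OF this] show c: "continuous_on {0..T} (\<lambda>t. trace_at T \<iota> t w)"
    and ae: "AE t in Xi T. trace_at T \<iota> t w = \<iota> (w t)"
    by (auto simp: trace_at_def continuous_representative_def)
  have "AE t in Xi T. trace_at T \<iota> t w = f t" using ae f_AE by eventually_elim simp
  then have "trace_at T \<iota> t w = f t" if "t \<in> {0..T}" for t
    using continuous_eq_if_AE_eq[OF T c f(1)] that by blast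
  from this[of 0] this[of T] f(3) T
  show "(norm (trace_at T \<iota> T w))\<^sup>2 - (norm (trace_at T \<iota> 0 w))\<^sup>2 = 2 * op_dt T \<iota> w w"
    by (simp add: op_dt_def)
qed

lemma test_function_continuous:
  assumes "test_function T \<phi>"
  shows "continuous_on S \<phi>" "continuous_on S (deriv \<phi>)"
proof -
  have "(deriv ^^ 0) \<phi> field_differentiable at t" "(deriv ^^ 1) \<phi> field_differentiable at t" for t
    using assms unfolding test_function_def by blast+
  then show "continuous_on S \<phi>" "continuous_on S (deriv \<phi>)"
    by (auto intro!: continuous_at_imp_continuous_on field_differentiable_imp_continuous_at)
qed

lemma weak_derivative_diff:
  assumes f: "f \<in> L2 T" "f' \<in> L2 T" "weak_derivative T f f'"
    and g: "g \<in> L2 T" "g' \<in> L2 T" "weak_derivative T g g'"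
  shows "weak_derivative T (\<lambda>t. f t - g t) (\<lambda>t. f' t - g' t)"
  unfolding weak_derivative_def
proof (intro allI impI)
  fix \<phi> v assume \<phi>: "test_function T \<phi>"
  note c = test_function_continuous[OF \<phi>]
  have i: "integrable (Xi T) (\<lambda>t. h t v)" if "h \<in> L2 T" for h :: "real \<Rightarrow> 'a \<Rightarrow>\<^sub>L real"
    by (rule L2_pairing_integrable[OF that L2_const])
  have "(LINT t|Xi T. deriv \<phi> t * (f t - g t) v) = (LINT t|Xi T. deriv \<phi> t * f t v) - (LINT t|Xi T. deriv \<phi> t * g t v)"
    using integrable_Xi_continuous_mult[OF c(2) i[OF f(1)]] integrable_Xi_continuous_mult[OF c(2) i[OF g(1)]]
    by (simp add: blinfun.diff_left right_diff_distrib)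
  also have "\<dots> = - ((LINT t|Xi T. \<phi> t * f' t v) - (LINT t|Xi T. \<phi> t * g' t v))"
    using f(3) g(3) \<phi> by (simp add: weak_derivative_def)
  also have "(LINT t|Xi T. \<phi> t * f' t v) - (LINT t|Xi T. \<phi> t * g' t v) = (LINT t|Xi T. \<phi> t * (f' t - g' t) v)"
    using integrable_Xi_continuous_mult[OF c(1) i[OF f(2)]] integrable_Xi_continuous_mult[OF c(1) i[OF g(2)]]
    by (simp add: blinfun.diff_left right_diff_distrib)
  finally show "(LINT t|Xi T. deriv \<phi> t * (f t - g t) v) = - (LINT t|Xi T. \<phi> t * (f' t - g' t) v)" .
qed

lemma H_to_dual_L2:
  assumes "w \<in> X_space T \<iota>"
  shows "(\<lambda>t. H_to_dual \<iota> (\<iota> (w t))) \<in> L2 T"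
  using assms by (auto simp: X_space_def H1_dual_def)

lemma H_to_dual_diff: "H_to_dual \<iota> (\<iota> (v - w)) = H_to_dual \<iota> (\<iota> v) - H_to_dual \<iota> (\<iota> w)"
  by (rule blinfun_eqI) (simp add: H_to_dual_apply blinfun.diff_left blinfun.diff_right inner_diff_left)

lemma X_space_diff:
  assumes v: "v \<in> X_space T \<iota>" and w: "w \<in> X_space T \<iota>"
  shows "(\<lambda>t. v t - w t) \<in> X_space T \<iota>"
    and "weak_derivative T (\<lambda>t. H_to_dual \<iota> (\<iota> (v t - w t))) (\<lambda>t. time_derivative T \<iota> v t - time_derivative T \<iota> w t)"
proof -
  show weak: "weak_derivative T (\<lambda>t. H_to_dual \<iota> (\<iota> (v t - w t))) (\<lambda>t. time_derivative T \<iota> v t - time_derivative T \<iota> w t)"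
    unfolding H_to_dual_diff
    by (rule weak_derivative_diff[OF H_to_dual_L2[OF v] X_space_D(2,3)[OF v] H_to_dual_L2[OF w] X_space_D(2,3)[OF w]])
  have "(\<lambda>t. H_to_dual \<iota> (\<iota> (v t - w t))) \<in> L2 T"
    unfolding H_to_dual_diff by (rule L2_diff[OF H_to_dual_L2[OF v] H_to_dual_L2[OF w]])
  then show "(\<lambda>t. v t - w t) \<in> X_space T \<iota>"
    using weak L2_diff[OF X_space_D(1)[OF v] X_space_D(1)[OF w]] L2_diff[OF X_space_D(2)[OF v] X_space_D(2)[OF w]]
    by (auto simp: X_space_def Y_space_def H1_dual_def)
qed

lemma bump_test_function:
  assumes "0 < a" "b < T"
  shows "test_function T (bump n a b)"
  unfolding test_function_def
  using assms smooth_algebra_field_differentiable[OF bump_smooth]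
  by (intro conjI allI exI[of _ a] exI[of _ b]) (auto intro: bump_eq_0)

text \<open>For a fixed vector \<open>x\<close> the difference vanishes outside a null set depending
  on \<open>x\<close>. The countably many values of simple functions approximating \<open>v\<close>
  share one null set, and continuity then reaches \<open>v t\<close>.\<close>

lemma weak_derivative_unique:
  fixes g g' :: "real \<Rightarrow> 'v::real_normed_vector \<Rightarrow>\<^sub>L real"
  assumes T: "T > 0" and f: "f \<in> L2 T" and g: "g \<in> L2 T" "weak_derivative T f g"
    and g': "g' \<in> L2 T" "weak_derivative T f g'" and v: "v \<in> L2 T"
  shows "AE t in Xi T. g t (v t) = g' t (v t)"
proof -
  have const: "AE t in Xi T. (g t - g' t) x = 0" for x
  proof (rule AE_eq_0_if_bump_integrals_eq_0[OF T])
    show "integrable (Xi T) (\<lambda>t. (g t - g' t) x)"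
      by (rule L2_pairing_integrable[OF L2_diff[OF g(1) g'(1)] L2_const])
    fix n a b assume "0 < a" "a < b" "b < T"
    then show "(LINT t|Xi T. bump n a b t * (g t - g' t) x) = 0"
      using weak_derivative_diff[OF f g f g'] bump_test_function[of a b T n]
      by (simp add: weak_derivative_def)
  qed
  obtain s where s: "\<And>i. simple_function (Xi T) (s i)" "AE x in Xi T. (\<lambda>i. s i x) \<longlonglongrightarrow> v x"
    by (rule strongly_measurableE[OF L2_D(1)[OF v]]) (rule that)
  define D where "D = (\<Union>i. s i ` space (Xi T))"
  have "countable D" unfolding D_def by (intro countable_UN countableI_type countable_finite[OF simple_functionD(1)[OF s(1)]])
  have "AE t in Xi T. \<forall>x\<in>D. (g t - g' t) x = 0"
    using const by (subst AE_ball_countable[OF \<open>countable D\<close>]) blast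
  then show ?thesis
    using s(2) AE_space
  proof eventually_elim
    fix t assume t: "\<forall>x\<in>D. (g t - g' t) x = 0" "(\<lambda>i. s i t) \<longlonglongrightarrow> v t" "t \<in> space (Xi T)"
    have "(\<lambda>i. (g t - g' t) (s i t)) \<longlonglongrightarrow> (g t - g' t) (v t)" using t(2) by (intro tendsto_intros)
    moreover have "(g t - g' t) (s i t) = 0" for i using t by (auto simp: D_def)
    ultimately have "(g t - g' t) (v t) = 0" by (simp add: LIMSEQ_const_iff)
    then show "g t (v t) = g' t (v t)" by (simp add: blinfun.diff_left)
  qed
qed

text \<open>\<open>time_derivative\<close> is an arbitrary choice, so the derivative of a difference
  matches the difference of derivatives only through uniqueness of the paired integrand.\<close>

lemma op_dt_diff:
  assumes T: "T > 0" and u: "u \<in> X_space T \<iota>" and w: "w \<in> X_space T \<iota>" and v: "v \<in> L2 T"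
  shows "op_dt T \<iota> (\<lambda>t. u t - w t) v = op_dt T \<iota> u v - op_dt T \<iota> w v"
proof -
  let ?e = "\<lambda>t. u t - w t"
  let ?g = "\<lambda>t. time_derivative T \<iota> u t - time_derivative T \<iota> w t"
  note e = X_space_diff[OF u w]
  have g: "?g \<in> L2 T" by (rule L2_diff[OF X_space_D(2)[OF u] X_space_D(2)[OF w]])
  have "AE t in Xi T. time_derivative T \<iota> ?e t (v t) = ?g t (v t)"
    by (rule weak_derivative_unique[OF T H_to_dual_L2[OF e(1)] X_space_D(2,3)[OF e(1)] g e(2) v])
  then have "op_dt T \<iota> ?e v = (LINT t|Xi T. ?g t (v t))"
    unfolding op_dt_def
    using L2_pairing_integrable[OF g v] L2_pairing_integrable[OF X_space_D(2)[OF e(1)] v]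
    by (intro integral_cong_AE) (auto dest: borel_measurable_integrable)
  also have "\<dots> = op_dt T \<iota> u v - op_dt T \<iota> w v"
    unfolding op_dt_def
    using L2_pairing_integrable[OF X_space_D(2)[OF u] v] L2_pairing_integrable[OF X_space_D(2)[OF w] v]
    by (simp add: blinfun.diff_left)
  finally show ?thesis .
qed

lemma trace_at_diff:
  assumes T: "T > 0" and u: "u \<in> X_space T \<iota>" and w: "w \<in> X_space T \<iota>" and t: "t \<in> {0..T}"
  shows "trace_at T \<iota> t (\<lambda>t. u t - w t) = trace_at T \<iota> t u - trace_at T \<iota> t w"
proof (rule continuous_eq_if_AE_eq[OF T _ _ _ t])
  let ?e = "\<lambda>t. u t - w t"
  have e: "?e \<in> X_space T \<iota>" by (rule X_space_diff[OF u w])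
  show "continuous_on {0..T} (\<lambda>t. trace_at T \<iota> t ?e)" by (rule trace_at_continuous_energy[OF T e])
  show "continuous_on {0..T} (\<lambda>t. trace_at T \<iota> t u - trace_at T \<iota> t w)"
    by (intro continuous_intros trace_at_continuous_energy[OF T] u w)
  show "AE t in Xi T. trace_at T \<iota> t ?e = trace_at T \<iota> t u - trace_at T \<iota> t w"
    using trace_at_continuous_energy(2)[OF T e] trace_at_continuous_energy(2)[OF T u] trace_at_continuous_energy(2)[OF T w]
    by eventually_elim (simp add: blinfun.diff_right)
qed

subsection \<open>Dual norms\<close>

text \<open>The dual norm calculus is separated from the integrals. \<open>S_nontrivial\<close>
  makes the index set of the supremum in \<open>dual\<close> nonempty.\<close>

locale seminormed_form =
  fixes Y :: "('a \<Rightarrow> 'v::real_vector) set" and S :: "('a \<Rightarrow> 'v) \<Rightarrow> ('a \<Rightarrow> 'v) \<Rightarrow> real"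
  assumes add_closed: "u \<in> Y \<Longrightarrow> v \<in> Y \<Longrightarrow> (\<lambda>t. u t + v t) \<in> Y"
    and scale_closed: "u \<in> Y \<Longrightarrow> (\<lambda>t. a *\<^sub>R u t) \<in> Y"
    and S_sym: "S u v = S v u"
    and S_add: "u \<in> Y \<Longrightarrow> v \<in> Y \<Longrightarrow> z \<in> Y \<Longrightarrow> S (\<lambda>t. u t + v t) z = S u z + S v z"
    and S_scale: "u \<in> Y \<Longrightarrow> z \<in> Y \<Longrightarrow> S (\<lambda>t. a *\<^sub>R u t) z = a * S u z"
    and S_nonneg: "u \<in> Y \<Longrightarrow> S u u \<ge> 0"
    and S_nontrivial: "\<exists>u\<in>Y. S u u \<noteq> 0"
begin

definition nrm :: "('a \<Rightarrow> 'v) \<Rightarrow> real" where "nrm v = sqrt (S v v)"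

definition dual :: "(('a \<Rightarrow> 'v) \<Rightarrow> real) \<Rightarrow> real" where
  "dual g = (SUP v \<in> {v \<in> Y. nrm v \<noteq> 0}. g v / nrm v)"

definition linear_functional :: "(('a \<Rightarrow> 'v) \<Rightarrow> real) \<Rightarrow> bool" where
  "linear_functional g \<longleftrightarrow> (\<forall>u\<in>Y. \<forall>v\<in>Y. g (\<lambda>t. u t + v t) = g u + g v) \<and> (\<forall>a. \<forall>v\<in>Y. g (\<lambda>t. a *\<^sub>R v t) = a * g v)"

text \<open>\<open>K\<close> bounds the convex conjugate of \<open>\<parallel>v\<parallel>\<^sup>2/2\<close> at \<open>g\<close>, whose least bound is half the square of
  the dual norm.  Working with it replaces Riesz representatives and hence completeness.\<close>

definition conjugate_le :: "(('a \<Rightarrow> 'v) \<Rightarrow> real) \<Rightarrow> real \<Rightarrow> bool" where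
  "conjugate_le g K \<longleftrightarrow> linear_functional g \<and> (\<forall>v\<in>Y. g v \<le> K + S v v / 2)"

lemma nrm_power2: "v \<in> Y \<Longrightarrow> (nrm v)\<^sup>2 = S v v"
  by (simp add: nrm_def S_nonneg)

lemma nrm_nonneg: "v \<in> Y \<Longrightarrow> nrm v \<ge> 0"
  by (simp add: nrm_def S_nonneg)

lemma S_scale_scale: "v \<in> Y \<Longrightarrow> S (\<lambda>t. a *\<^sub>R v t) (\<lambda>t. a *\<^sub>R v t) = a\<^sup>2 * S v v"
  using S_scale[of v "\<lambda>t. a *\<^sub>R v t" a] S_sym[of v "\<lambda>t. a *\<^sub>R v t"] S_scale[of v v a] scale_closed[of v a]
  by (simp add: power2_eq_square)

lemma linear_functional_D:
  assumes "linear_functional g" "v \<in> Y"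
  shows "u \<in> Y \<Longrightarrow> g (\<lambda>t. u t + v t) = g u + g v" "g (\<lambda>t. a *\<^sub>R v t) = a * g v"
  using assms by (auto simp: linear_functional_def)

lemma conjugate_le_D:
  assumes "conjugate_le g K"
  shows "linear_functional g" "v \<in> Y \<Longrightarrow> g v \<le> K + S v v / 2"
  using assms by (auto simp: conjugate_le_def)

lemma conjugate_le_scale:
  assumes "conjugate_le g K" "v \<in> Y"
  shows "a * g v \<le> K + a\<^sup>2 * S v v / 2"
  using conjugate_le_D(2)[OF assms(1) scale_closed[OF assms(2)], of a] S_scale_scale[OF assms(2), of a]
    linear_functional_D(2)[OF conjugate_le_D(1)[OF assms(1)] assms(2), of a]
  by simp

lemma conjugate_le_nonneg:
  assumes "conjugate_le g K"
  shows "K \<ge> 0"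
proof -
  obtain u where u: "u \<in> Y" using S_nontrivial by blast
  show ?thesis using conjugate_le_scale[OF assms u, of 0] by simp
qed

text \<open>This optimises the scaling \<open>a\<close> in \<open>conjugate_le_scale\<close>. Where
  the form degenerates the bound is linear in \<open>a\<close> and forces \<open>g v = 0\<close>, so
  \<open>g\<close> ignores null functions.\<close>

lemma conjugate_le_power2:
  assumes g: "conjugate_le g K" and v: "v \<in> Y"
  shows "(g v)\<^sup>2 \<le> 2 * K * S v v"
proof (cases "S v v = 0")
  case True
  have "a * g v \<le> K" for a
    using conjugate_le_scale[OF assms, of a] True by simp
  \<comment> \<open>For nonzero \<open>g v\<close> this scaling would give
    \<open>K + 1 <= K\<close>.\<close>
  from this[of "(K + 1) / g v"] show ?thesis using True by (cases "g v = 0") auto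
next
  case False
  then have pos: "S v v > 0" using S_nonneg[OF v] by simp
  define a where "a = g v / S v v"
  have "a * g v \<le> K + a\<^sup>2 * S v v / 2"
    by (rule conjugate_le_scale[OF assms])
  then have "(a * g v) * S v v \<le> (K + a\<^sup>2 * S v v / 2) * S v v" using pos by (intro mult_right_mono) auto
  moreover have "(a * g v) * S v v = (g v)\<^sup>2" "(a\<^sup>2 * S v v / 2) * S v v = (g v)\<^sup>2 / 2"
    using pos by (auto simp: a_def power2_eq_square)
  ultimately show ?thesis by (simp add: algebra_simps)
qed

lemma conjugate_le_quotient:
  assumes g: "conjugate_le g K" and v: "v \<in> Y"
  shows "g v / nrm v \<le> sqrt (2 * K)"
proof -
  have "g v \<le> sqrt (2 * K * S v v)"
    using conjugate_le_power2[OF assms] by (rule real_le_rsqrt)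
  then have "g v \<le> sqrt (2 * K) * nrm v" by (simp add: nrm_def real_sqrt_mult)
  then show ?thesis
    using nrm_nonneg[OF v] conjugate_le_nonneg[OF g] by (cases "nrm v = 0") (auto simp: divide_le_eq)
qed

lemma dual_le:
  assumes g: "conjugate_le g K"
  shows "dual g \<le> sqrt (2 * K)"
  unfolding dual_def
  using S_nontrivial conjugate_le_quotient[OF g] by (intro cSUP_least) (auto simp: nrm_def)

lemma le_dual:
  assumes g: "conjugate_le g K" and v: "v \<in> Y"
  shows "g v \<le> dual g * nrm v"
proof (cases "nrm v = 0")
  case True
  then have "S v v = 0" using nrm_power2[OF v] by simp
  then have "g v = 0" using conjugate_le_power2[OF assms] by simp
  then show ?thesis using True by simp
next
  case False
  have "g v / nrm v \<le> dual g"
    unfolding dual_def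
  proof (rule cSUP_upper)
    show "bdd_above ((\<lambda>v. g v / nrm v) ` {v \<in> Y. nrm v \<noteq> 0})"
      using conjugate_le_quotient[OF g] by (intro bdd_aboveI2[of _ _ "sqrt (2 * K)"]) auto
  qed (use v False in auto)
  then show ?thesis using False nrm_nonneg[OF v] by (simp add: divide_le_eq)
qed

lemma dual_nonneg:
  assumes g: "conjugate_le g K"
  shows "dual g \<ge> 0"
proof -
  obtain u where u: "u \<in> Y" "nrm u \<noteq> 0" using S_nontrivial by (auto simp: nrm_def)
  let ?u = "\<lambda>t. (-1) *\<^sub>R u t"
  have "g ?u = - g u"
    using linear_functional_D(2)[OF conjugate_le_D(1)[OF g] u(1), of "-1"] by simp
  moreover have "nrm ?u = nrm u" using S_scale_scale[OF u(1), of "-1"] by (simp add: nrm_def)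
  ultimately have "0 \<le> 2 * (dual g * nrm u)"
    using le_dual[OF g u(1)] le_dual[OF g scale_closed[OF u(1), of "-1"]] by simp
  then show ?thesis using u(2) nrm_nonneg[OF u(1)] by (simp add: zero_le_mult_iff)
qed

lemma dual_power2_le:
  assumes g: "conjugate_le g K"
  shows "(dual g)\<^sup>2 \<le> 2 * K"
  using dual_le[OF g] dual_nonneg[OF g] conjugate_le_nonneg[OF g] by (metis mult_nonneg_nonneg power_mono real_sqrt_pow2 zero_le_numeral)

lemma conjugate_le_dual:
  assumes g: "conjugate_le g K"
  shows "conjugate_le g ((dual g)\<^sup>2 / 2)"
  unfolding conjugate_le_def
proof (intro conjI ballI)
  show "linear_functional g" using g by (simp add: conjugate_le_def)
  fix v assume v: "v \<in> Y"
  have "dual g * nrm v \<le> (dual g)\<^sup>2 / 2 + (nrm v)\<^sup>2 / 2"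
    using sum_squares_bound[of "dual g" "nrm v"] by simp
  then show "g v \<le> (dual g)\<^sup>2 / 2 + S v v / 2"
    using le_dual[OF g v] nrm_power2[OF v] by simp
qed

lemma linear_functional_add:
  "linear_functional g \<Longrightarrow> linear_functional k \<Longrightarrow> linear_functional (\<lambda>v. g v + k v)"
  by (simp add: linear_functional_def algebra_simps)

lemma linear_functional_S: "w \<in> Y \<Longrightarrow> linear_functional (S w)"
  using S_add S_scale S_sym by (simp add: linear_functional_def)

lemma S_diff:
  assumes v: "v \<in> Y" and w: "w \<in> Y"
  shows "S (\<lambda>t. v t + (-1) *\<^sub>R w t) (\<lambda>t. v t + (-1) *\<^sub>R w t) = S v v - 2 * S w v + S w w"
proof -
  let ?m = "\<lambda>t. (-1) *\<^sub>R w t" and ?d = "\<lambda>t. v t + (-1) *\<^sub>R w t"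
  have m: "?m \<in> Y" by (rule scale_closed[OF w])
  have d: "?d \<in> Y" by (rule add_closed[OF v m])
  show ?thesis
    using S_add[OF v m d] S_add[OF v m v] S_add[OF v m m] S_scale[OF w v, of "-1"] S_scale[OF w m, of "-1"]
      S_scale[OF w w, of "-1"] S_sym[of v ?d] S_sym[of ?m ?d] S_sym[of ?m v] S_sym[of w ?m] S_sym[of v w]
    by simp
qed

lemma nrm_diff_power2:
  assumes u: "u \<in> Y" and v: "v \<in> Y" and orth: "S u v = S v v"
  shows "(nrm (\<lambda>t. u t - v t))\<^sup>2 = (nrm u)\<^sup>2 - (nrm v)\<^sup>2"
  using S_diff[OF u v] orth S_sym[of v u] nrm_power2[OF add_closed[OF u scale_closed[OF v, of "-1"]]]
    nrm_power2[OF u] nrm_power2[OF v]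
  by simp

text \<open>Completing the square: the bound for \<open>g\<close> at \<open>v - w\<close> rearranges
  to the claim at \<open>v\<close>.\<close>

lemma conjugate_le_add_S:
  assumes g: "conjugate_le g K" and w: "w \<in> Y"
  shows "conjugate_le (\<lambda>v. g v + S w v) (K + g w + S w w / 2)"
  unfolding conjugate_le_def
proof (intro conjI ballI)
  show "linear_functional (\<lambda>v. g v + S w v)"
    using g w by (intro linear_functional_add linear_functional_S) (auto simp: conjugate_le_def)
  fix v assume v: "v \<in> Y"
  let ?m = "\<lambda>t. (-1) *\<^sub>R w t" and ?d = "\<lambda>t. v t + (-1) *\<^sub>R w t"
  have m: "?m \<in> Y" by (rule scale_closed[OF w])
  have d: "?d \<in> Y" by (rule add_closed[OF v m])
  have "g ?m = (-1) * g w" "g ?d = g v + g ?m"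
    using linear_functional_D[OF conjugate_le_D(1)[OF g]] v w m by blast+
  moreover note S_diff[OF v w]
  moreover have "g ?d \<le> K + S ?d ?d / 2" by (rule conjugate_le_D(2)[OF g d])
  ultimately show "g v + S w v \<le> K + g w + S w w / 2 + S v v / 2" by (simp add: field_simps)
qed

text \<open>The Hilbert space expansion of a squared norm, in which \<open>w\<close> represents
  \<open>S w\<close>. One inequality is the shift bound with the least constant for
  \<open>g\<close>; the other is the same bound for the shift by \<open>-w\<close>, which undoes the
  first.\<close>

lemma dual_add_S_power2:
  assumes g: "conjugate_le g K" and w: "w \<in> Y"
  shows "(dual (\<lambda>v. g v + S w v))\<^sup>2 = (dual g)\<^sup>2 + 2 * g w + S w w"
proof (rule antisym)
  let ?h = "\<lambda>v. g v + S w v" and ?m = "\<lambda>t. (-1) *\<^sub>R w t"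
  have m: "?m \<in> Y" by (rule scale_closed[OF w])
  note h = conjugate_le_add_S[OF conjugate_le_dual[OF g] w]
  show "(dual ?h)\<^sup>2 \<le> (dual g)\<^sup>2 + 2 * g w + S w w"
    using dual_power2_le[OF h] by simp
  have undo: "?h v + S ?m v = g v" if "v \<in> Y" for v
    using S_scale[OF w that, of "-1"] by simp
  have "dual (\<lambda>v. ?h v + S ?m v) = dual g"
    unfolding dual_def using undo by (intro SUP_cong) auto
  moreover have "(dual (\<lambda>v. ?h v + S ?m v))\<^sup>2 \<le> (dual ?h)\<^sup>2 + 2 * ?h ?m + S ?m ?m"
    using dual_power2_le[OF conjugate_le_add_S[OF conjugate_le_dual[OF h] m]] by simp
  moreover have "g ?m = (-1) * g w"
    by (rule linear_functional_D(2)[OF conjugate_le_D(1)[OF g] w])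
  moreover have "S ?m ?m = S w w" "S w ?m = - S w w"
    using S_scale_scale[OF w, of "-1"] S_scale[OF w w, of "-1"] S_sym[of w ?m] by auto
  ultimately show "(dual g)\<^sup>2 + 2 * g w + S w w \<le> (dual ?h)\<^sup>2" by simp
qed

lemma dual_S_power2:
  assumes w: "w \<in> Y"
  shows "(dual (S w))\<^sup>2 = S w w"
proof -
  have 0: "conjugate_le (\<lambda>v. 0) 0"
    by (auto simp: conjugate_le_def linear_functional_def S_nonneg)
  have "dual (\<lambda>v. 0) = 0"
    using dual_power2_le[OF 0] by simp
  then show ?thesis using dual_add_S_power2[OF 0 w] by simp
qed

lemma dual_add_le:
  assumes g: "conjugate_le g K" and k: "conjugate_le k L"
  shows "conjugate_le (\<lambda>v. g v + k v) ((dual g + dual k)\<^sup>2 / 2)"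
    and "dual (\<lambda>v. g v + k v) \<le> dual g + dual k"
proof -
  show c: "conjugate_le (\<lambda>v. g v + k v) ((dual g + dual k)\<^sup>2 / 2)"
    unfolding conjugate_le_def
  proof (intro conjI ballI)
    show "linear_functional (\<lambda>v. g v + k v)"
      using g k by (intro linear_functional_add) (auto simp: conjugate_le_def)
    fix v assume v: "v \<in> Y"
    have "g v + k v \<le> (dual g + dual k) * nrm v"
      using le_dual[OF g v] le_dual[OF k v] by (simp add: algebra_simps)
    also have "\<dots> \<le> (dual g + dual k)\<^sup>2 / 2 + S v v / 2"
      using mult_le_weighted_squares[of 1 "dual g + dual k" "nrm v"] unfolding nrm_power2[OF v] by linarith
    finally show "g v + k v \<le> (dual g + dual k)\<^sup>2 / 2 + S v v / 2" .
  qed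
  show "dual (\<lambda>v. g v + k v) \<le> dual g + dual k"
    using dual_le[OF c] dual_nonneg[OF g] dual_nonneg[OF k] by simp
qed

lemma dual_uminus_le:
  assumes g: "conjugate_le g K"
  shows "conjugate_le (\<lambda>v. - g v) ((dual g)\<^sup>2 / 2)" and "dual (\<lambda>v. - g v) \<le> dual g"
proof -
  show c: "conjugate_le (\<lambda>v. - g v) ((dual g)\<^sup>2 / 2)"
    unfolding conjugate_le_def
  proof (intro conjI ballI)
    show "linear_functional (\<lambda>v. - g v)"
      using linear_functional_D[OF conjugate_le_D(1)[OF g]] by (simp add: linear_functional_def)
    show "- g v \<le> (dual g)\<^sup>2 / 2 + S v v / 2" if "v \<in> Y" for v
      using conjugate_le_scale[OF conjugate_le_dual[OF g] that, of "-1"] by simp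
  qed
  show "dual (\<lambda>v. - g v) \<le> dual g" using dual_le[OF c] dual_nonneg[OF g] by simp
qed

end

subsection \<open>Residual and error\<close>

text \<open>Let e = c - 1, the positive root of e (e - a^2) = a^2 when a > 0. Young's inequality
  with weight e on the mixed term then gives p^2 and n^2 the same coefficient 1 + e. The term
  \<open>s\<close> is absorbed because the constant is at least 1.\<close>

lemma c_const_comparison:
  assumes "a \<ge> 0" "n \<ge> 0" "p \<ge> 0" "q \<ge> 0" "q \<le> p + a * n" "s \<ge> 0"
  shows "q\<^sup>2 + n\<^sup>2 + s \<le> c_const a * (p\<^sup>2 + n\<^sup>2 + s)"
proof -
  define r where "r = sqrt (a\<^sup>2 + 4)"
  have r2: "r\<^sup>2 = a\<^sup>2 + 4" by (simp add: r_def)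
  have "r > 0" by (simp add: r_def add_nonneg_pos)
  define e where "e = a / 2 * (a + r)"
  have c: "c_const a = 1 + e" by (simp add: c_const_def e_def r_def)
  have "e \<ge> 0" using \<open>a \<ge> 0\<close> \<open>r > 0\<close> by (simp add: e_def)
  have "e * (e - a\<^sup>2) = a\<^sup>2 / 4 * (r\<^sup>2 - a\<^sup>2)"
    unfolding e_def by (simp add: power2_eq_square algebra_simps)
  then have ea: "e * (e - a\<^sup>2) = a\<^sup>2" by (simp add: r2)
  have mixed: "2 * (p * (a * n)) \<le> e * p\<^sup>2 + (e - a\<^sup>2) * n\<^sup>2"
  proof (cases "a = 0")
    case True
    then show ?thesis by (simp add: e_def)
  next
    case False
    then have "e > 0" using \<open>a \<ge> 0\<close> \<open>r > 0\<close> by (simp add: e_def)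
    then have "a\<^sup>2 / e = e - a\<^sup>2" using ea by (simp add: field_simps)
    then have "(a * n)\<^sup>2 / e = (e - a\<^sup>2) * n\<^sup>2" by (simp add: power_mult_distrib flip: times_divide_eq_left)
    then show ?thesis using mult_le_weighted_squares[OF \<open>e > 0\<close>, of p "a * n"] by simp
  qed
  have "q\<^sup>2 \<le> (p + a * n)\<^sup>2" using assms by (intro power_mono)
  also have "\<dots> = p\<^sup>2 + 2 * (p * (a * n)) + a\<^sup>2 * n\<^sup>2" by (simp add: power2_eq_square algebra_simps)
  also have "\<dots> \<le> p\<^sup>2 + (e * p\<^sup>2 + (e - a\<^sup>2) * n\<^sup>2) + a\<^sup>2 * n\<^sup>2" using mixed by simp
  also have "\<dots> = (1 + e) * p\<^sup>2 + e * n\<^sup>2" by (simp add: algebra_simps)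
  finally have "q\<^sup>2 + n\<^sup>2 + s \<le> (1 + e) * p\<^sup>2 + (1 + e) * n\<^sup>2 + s" by (simp add: algebra_simps)
  moreover have "e * s \<ge> 0" using \<open>e \<ge> 0\<close> \<open>s \<ge> 0\<close> by simp
  ultimately show ?thesis unfolding c by (simp add: algebra_simps)
qed

locale parabolic_operator =
  fixes T :: real and A :: "real \<Rightarrow> 'v::{real_inner,complete_space} \<Rightarrow>\<^sub>L 'v \<Rightarrow>\<^sub>L real" and C c :: real
  assumes T_pos: "T > 0"
    and A_measurable: "\<And>w v. (\<lambda>t. A t w v) \<in> borel_measurable (Xi T)"
    and A_bounded: "AE t in Xi T. norm (A t) \<le> C" and C_nonneg: "C \<ge> 0"
    and A_coercive: "AE t in Xi T. \<forall>v. A t v v \<ge> c * (norm v)\<^sup>2" and c_pos: "c > 0"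
    and Y_nontrivial: "nontrivial T (Y_space T :: (real \<Rightarrow> 'v) set)"
begin

lemma A_pointwise: "AE t in Xi T. \<bar>A t (w t) (v t)\<bar> \<le> C * (norm (w t) * norm (v t))"
  using A_bounded
proof eventually_elim
  fix t assume "norm (A t) \<le> C"
  have "\<bar>A t (w t) (v t)\<bar> \<le> norm (A t (w t)) * norm (v t)" using norm_blinfun[of "A t (w t)" "v t"] by simp
  also have "\<dots> \<le> (norm (A t) * norm (w t)) * norm (v t)" by (intro mult_right_mono norm_blinfun) simp
  also have "\<dots> \<le> (C * norm (w t)) * norm (v t)" using \<open>norm (A t) \<le> C\<close> by (intro mult_right_mono) auto
  finally show "\<bar>A t (w t) (v t)\<bar> \<le> C * (norm (w t) * norm (v t))" by simp
qed

lemma integrable_A: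
  assumes w: "w \<in> L2 T" and v: "v \<in> L2 T"
  shows "integrable (Xi T) (\<lambda>t. A t (w t) (v t))"
proof (rule Bochner_Integration.integrable_bound)
  show "integrable (Xi T) (\<lambda>t. C * (norm (w t) * norm (v t)))"
    using L2_norm_mult_integrable[OF w v] by simp
  show "(\<lambda>t. A t (w t) (v t)) \<in> borel_measurable (Xi T)"
    using A_measurable L2_D(1)[OF w] L2_D(1)[OF v] by (rule borel_measurable_bilinear_form)
  show "AE t in Xi T. norm (A t (w t) (v t)) \<le> norm (C * (norm (w t) * norm (v t)))"
    using A_pointwise[of w v] by eventually_elim (simp add: C_nonneg)
qed

lemma op_A_le:
  assumes w: "w \<in> L2 T" and v: "v \<in> L2 T"
  shows "\<bar>op_A T A w v\<bar> \<le> C * (LINT t|Xi T. norm (w t) * norm (v t))"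
proof -
  have "\<bar>op_A T A w v\<bar> \<le> (LINT t|Xi T. \<bar>A t (w t) (v t)\<bar>)"
    unfolding op_A_def by (rule integral_abs_bound)
  also have "\<dots> \<le> (LINT t|Xi T. C * (norm (w t) * norm (v t)))"
    using integrable_A[OF w v] L2_norm_mult_integrable[OF w v] A_pointwise[of w v]
    by (intro integral_mono_AE) auto
  finally show ?thesis by simp
qed

lemma op_As_same: "op_As T A v v = op_A T A v v"
  by (simp add: op_As_def adjoint_op_def)

lemma op_As_coercive:
  assumes v: "v \<in> L2 T"
  shows "c * (LINT t|Xi T. (norm (v t))\<^sup>2) \<le> op_As T A v v"
proof -
  have "(LINT t|Xi T. c * (norm (v t))\<^sup>2) \<le> op_A T A v v"
    unfolding op_A_def using L2_D(2)[OF v] integrable_A[OF v v] A_coercive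
    by (intro integral_mono_AE) (auto elim: eventually_mono)
  then show ?thesis by (simp add: op_As_same)
qed

lemma op_A_add_scale:
  assumes u: "u \<in> L2 T" and v: "v \<in> L2 T" and z: "z \<in> L2 T"
  shows "op_A T A (\<lambda>t. u t + v t) z = op_A T A u z + op_A T A v z"
    "op_A T A z (\<lambda>t. u t + v t) = op_A T A z u + op_A T A z v"
    "op_A T A (\<lambda>t. a *\<^sub>R u t) z = a * op_A T A u z"
    "op_A T A z (\<lambda>t. a *\<^sub>R u t) = a * op_A T A z u"
  unfolding op_A_def using integrable_A u v z
  by (simp_all add: blinfun.add_left blinfun.add_right blinfun.scaleR_left blinfun.scaleR_right)

sublocale seminormed_form "Y_space T" "op_As T A"
proof
  fix u v z :: "real \<Rightarrow> 'v" and a :: real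
  show "op_As T A u v = op_As T A v u" by (simp add: op_As_def adjoint_op_def)
  assume u: "u \<in> Y_space T"
  show "(\<lambda>t. a *\<^sub>R u t) \<in> Y_space T" using u L2_scaleR by (simp add: Y_space_def)
  have "(LINT t|Xi T. (norm (u t))\<^sup>2) \<ge> 0" by (rule Bochner_Integration.integral_nonneg) simp
  then have "c * (LINT t|Xi T. (norm (u t))\<^sup>2) \<ge> 0" using c_pos by simp
  then show "op_As T A u u \<ge> 0"
    by (rule order_trans) (use op_As_coercive[of u] u in \<open>simp add: Y_space_def\<close>)
  {
    assume z: "z \<in> Y_space T"
    show "op_As T A (\<lambda>t. a *\<^sub>R u t) z = a * op_As T A u z"
      using op_A_add_scale(3,4)[of u u z a] u z by (simp add: Y_space_def op_As_def adjoint_op_def distrib_left)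
  }
  assume v: "v \<in> Y_space T"
  show "(\<lambda>t. u t + v t) \<in> Y_space T" using u v L2_add by (simp add: Y_space_def)
  assume z: "z \<in> Y_space T"
  show "op_As T A (\<lambda>t. u t + v t) z = op_As T A u z + op_As T A v z"
    using op_A_add_scale(1,2)[of u v z] u v z by (simp add: Y_space_def op_As_def adjoint_op_def flip: add_divide_distrib)
next
  obtain u :: "real \<Rightarrow> 'v" where u: "u \<in> L2 T" "\<not> (AE t in Xi T. u t = 0)"
    using Y_nontrivial by (auto simp: nontrivial_def Y_space_def)
  have "(LINT t|Xi T. (norm (u t))\<^sup>2) \<noteq> 0"
    using u integral_nonneg_eq_0_iff_AE[OF L2_D(2)[OF u(1)]] by auto
  moreover have "(LINT t|Xi T. (norm (u t))\<^sup>2) \<ge> 0" by (rule Bochner_Integration.integral_nonneg) simp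
  ultimately have "(LINT t|Xi T. (norm (u t))\<^sup>2) > 0" by linarith
  then have "c * (LINT t|Xi T. (norm (u t))\<^sup>2) > 0" using c_pos by simp
  then have "op_As T A u u \<noteq> 0" using op_As_coercive[OF u(1)] by linarith
  then show "\<exists>u\<in>Y_space T. op_As T A u u \<noteq> 0" using u(1) by (auto simp: Y_space_def)
qed

lemma norm_Y_eq: "norm_Y T A v = nrm v"
  by (simp add: norm_Y_def nrm_def)

lemma norm_Y_dual_eq: "norm_Y_dual T A g = dual g"
  by (simp add: norm_Y_dual_def dual_def norm_Y_eq)

text \<open>Coercivity converts a bound in the plain L2 norm, with coefficient exactly
  \<open>c\<close>, into one in the energy norm.\<close>

lemma conjugate_le_if_L2_bound:
  assumes "linear_functional g" and "\<And>v. v \<in> L2 T \<Longrightarrow> 2 * g v \<le> b + c * (LINT t|Xi T. (norm (v t))\<^sup>2)"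
  shows "conjugate_le g (b / 2)"
  unfolding conjugate_le_def
proof (intro conjI ballI)
  fix v :: "real \<Rightarrow> 'v" assume "v \<in> Y_space T"
  then have "v \<in> L2 T" by (simp add: Y_space_def)
  then show "g v \<le> b / 2 + op_As T A v v / 2"
    using assms(2)[of v] op_As_coercive[of v] by linarith
qed fact

lemma op_dt_conjugate_le:
  assumes w: "w \<in> X_space T \<iota>"
  shows "\<exists>K. conjugate_le (op_dt T \<iota> w) K"
proof -
  let ?g = "time_derivative T \<iota> w"
  note g = X_space_D(2)[OF w]
  have "conjugate_le (op_dt T \<iota> w) ((1 / c) * (LINT t|Xi T. (norm (?g t))\<^sup>2) / 2)"
  proof (rule conjugate_le_if_L2_bound)
    show "linear_functional (op_dt T \<iota> w)"
      unfolding linear_functional_def using L2_pairing_integrable[OF g]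
      by (simp add: op_dt_def Y_space_def blinfun.add_right blinfun.scaleR_right)
    fix v :: "real \<Rightarrow> 'v" assume v: "v \<in> L2 T"
    have "op_dt T \<iota> w v \<le> (LINT t|Xi T. norm (?g t) * norm (v t))"
      unfolding op_dt_def
    proof (rule integral_mono[OF L2_pairing_integrable[OF g v] L2_norm_mult_integrable[OF g v]])
      fix t show "?g t (v t) \<le> norm (?g t) * norm (v t)" using norm_blinfun[of "?g t" "v t"] by simp
    qed
    then show "2 * op_dt T \<iota> w v \<le> (1 / c) * (LINT t|Xi T. (norm (?g t))\<^sup>2) + c * (LINT t|Xi T. (norm (v t))\<^sup>2)"
      using L2_norm_mult_le[OF g v, of "1 / c"] c_pos by (simp add: mult.commute)
  qed
  then show ?thesis by blast
qed

text \<open>One \<open>R\<close> for all \<open>w\<close> is the point: it is what bounds the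
  supremum defining \<open>alpha\<close>.\<close>

lemma op_Aa_conjugate_le:
  "\<exists>R. \<forall>w\<in>Y_space T. conjugate_le (op_Aa T A w) (R * op_As T A w w / 2)"
proof -
  \<comment> \<open>The weight is large enough that \<open>C / k <= c\<close>; the added 1 keeps it
    positive when \<open>C = 0\<close>.\<close>
  define k where "k = (C + 1) / c"
  have "k > 0" using C_nonneg c_pos by (simp add: k_def)
  have Ck: "C / k \<le> c" using C_nonneg c_pos by (simp add: k_def field_simps)
  have "conjugate_le (op_Aa T A w) ((C * k / c) * op_As T A w w / 2)" if "w \<in> Y_space T" for w
  proof (rule conjugate_le_if_L2_bound)
    have w: "w \<in> L2 T" using that by (simp add: Y_space_def)
    show "linear_functional (op_Aa T A w)"
      unfolding linear_functional_def using op_A_add_scale[OF _ _ w]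
      by (simp add: op_Aa_def adjoint_op_def Y_space_def algebra_simps diff_divide_distrib add_divide_distrib)
    fix v :: "real \<Rightarrow> 'v" assume v: "v \<in> L2 T"
    let ?W = "LINT t|Xi T. (norm (w t))\<^sup>2" and ?V = "LINT t|Xi T. (norm (v t))\<^sup>2"
    have V0: "?V \<ge> 0" by (rule Bochner_Integration.integral_nonneg) simp
    have "2 * op_Aa T A w v \<le> C * (2 * (LINT t|Xi T. norm (w t) * norm (v t)))"
      using op_A_le[OF w v] op_A_le[OF v w] by (simp add: op_Aa_def adjoint_op_def mult.commute)
    also have "\<dots> \<le> C * (k * ?W + ?V / k)"
      using L2_norm_mult_le[OF w v \<open>k > 0\<close>] C_nonneg by (rule mult_left_mono)
    also have "\<dots> = (C * k / c) * (c * ?W) + (C / k) * ?V" using c_pos by (simp add: algebra_simps)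
    also have "\<dots> \<le> (C * k / c) * op_As T A w w + c * ?V"
      using op_As_coercive[OF w] Ck V0 C_nonneg \<open>k > 0\<close> c_pos
      by (intro add_mono mult_left_mono mult_right_mono) auto
    finally show "2 * op_Aa T A w v \<le> (C * k / c) * op_As T A w w + c * ?V" .
  qed
  then show ?thesis by blast
qed

text \<open>A real supremum is meaningful only over a nonempty set that is bounded above, so
  \<open>R\<close> must come first. Functions with \<open>nrm w = 0\<close> lie outside the
  supremum; for them the bound by \<open>sqrt R * nrm w\<close> applies directly.\<close>

lemma alpha_nonneg: "alpha T A \<ge> 0"
  and dual_op_Aa_le: "w \<in> Y_space T \<Longrightarrow> dual (op_Aa T A w) \<le> alpha T A * nrm w"
proof -
  obtain R where R: "\<And>w. w \<in> Y_space T \<Longrightarrow> conjugate_le (op_Aa T A w) (R * op_As T A w w / 2)"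
    using op_Aa_conjugate_le by blast
  have b: "dual (op_Aa T A w) \<le> sqrt R * nrm w" if "w \<in> Y_space T" for w
    using dual_le[OF R[OF that]] by (simp add: nrm_def real_sqrt_mult)
  have bdd: "bdd_above ((\<lambda>w. dual (op_Aa T A w) / nrm w) ` {w \<in> Y_space T. nrm w \<noteq> 0})"
  proof (rule bdd_aboveI2)
    fix w assume "w \<in> {w \<in> Y_space T. nrm w \<noteq> 0}"
    then show "dual (op_Aa T A w) / nrm w \<le> sqrt R"
      using b[of w] nrm_nonneg[of w] by (simp add: divide_le_eq)
  qed
  have alpha: "alpha T A = (SUP w \<in> {w \<in> Y_space T. nrm w \<noteq> 0}. dual (op_Aa T A w) / nrm w)"
    by (simp add: alpha_def norm_Y_eq norm_Y_dual_eq)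
  have up: "dual (op_Aa T A w) / nrm w \<le> alpha T A" if "w \<in> Y_space T" "nrm w \<noteq> 0" for w
    unfolding alpha by (rule cSUP_upper[OF _ bdd]) (use that in simp)
  obtain u where u: "u \<in> Y_space T" "nrm u \<noteq> 0" using S_nontrivial by (auto simp: nrm_def)
  then show "alpha T A \<ge> 0"
    using up[OF u] dual_nonneg[OF R[OF u(1)]] nrm_nonneg[OF u(1)] by (meson divide_nonneg_nonneg order_trans)
  show "dual (op_Aa T A w) \<le> alpha T A * nrm w" if w: "w \<in> Y_space T"
    using b[OF w] up[OF w] nrm_nonneg[OF w] by (cases "nrm w = 0") (auto simp: divide_le_eq)
qed

text \<open>Integration by parts turns \<open>2 (d\<^sub>t e)(e)\<close> into the difference of the squared traces; this is
  why \<open>\<parallel>e\<parallel>\<^sub>X\<close> contains the trace at \<open>T\<close> while the residual contains the one at \<open>0\<close>.\<close>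

lemma residual_equivalence:
  assumes e: "e \<in> X_space T \<iota>" and lam: "lam \<in> Y_space T"
    and Be: "\<And>v. v \<in> Y_space T \<Longrightarrow> op_As T A lam v = op_B T \<iota> A e v"
  defines "F \<equiv> (nrm lam)\<^sup>2 + (norm (trace_at T \<iota> 0 e))\<^sup>2"
  shows "F \<le> c_const (alpha T A) * (norm_X T \<iota> A e)\<^sup>2" "(norm_X T \<iota> A e)\<^sup>2 \<le> c_const (alpha T A) * F"
proof -
  have eY: "e \<in> Y_space T" using X_space_D(1)[OF e] by (simp add: Y_space_def)
  define d where "d = op_dt T \<iota> e"
  define m where "m = op_Aa T A e"
  define h where "h v = d v + m v" for v
  obtain K where d: "conjugate_le d K" using op_dt_conjugate_le[OF e] by (auto simp: d_def)
  obtain L where m: "conjugate_le m L" using op_Aa_conjugate_le eY by (auto simp: m_def)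
  note h = dual_add_le[OF d m, folded h_def]
  have split: "op_As T A lam v = h v + op_As T A e v" if "v \<in> Y_space T" for v
    using Be[OF that] by (simp add: h_def d_def m_def op_B_def op_As_def op_Aa_def field_simps)
  have "dual (op_As T A lam) = dual (\<lambda>v. h v + op_As T A e v)"
    unfolding dual_def using split by (intro SUP_cong) auto
  then have "(nrm lam)\<^sup>2 = (dual h)\<^sup>2 + 2 * h e + (nrm e)\<^sup>2"
    using dual_S_power2[OF lam] dual_add_S_power2[OF h(1) eY] nrm_power2[OF lam] nrm_power2[OF eY] by simp
  moreover have "m e = 0" by (simp add: m_def op_Aa_def adjoint_op_def)
  moreover have "2 * d e = (norm (trace_at T \<iota> T e))\<^sup>2 - (norm (trace_at T \<iota> 0 e))\<^sup>2"
    using trace_at_continuous_energy(3)[OF T_pos e] by (simp add: d_def)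
  ultimately have F: "F = (dual h)\<^sup>2 + (nrm e)\<^sup>2 + (norm (trace_at T \<iota> T e))\<^sup>2"
    by (simp add: F_def h_def)
  have X: "(norm_X T \<iota> A e)\<^sup>2 = (dual d)\<^sup>2 + (nrm e)\<^sup>2 + (norm (trace_at T \<iota> T e))\<^sup>2"
    by (simp add: norm_X_def norm_Y_eq norm_Y_dual_eq d_def)
  have mm: "dual m \<le> alpha T A * nrm e" unfolding m_def by (rule dual_op_Aa_le[OF eY])
  have hd: "dual h \<le> dual d + alpha T A * nrm e" using h(2) mm by simp
  \<comment> \<open>Since \<open>d = h - m\<close>, the triangle inequality also runs backwards, and
    \<open>c_const_comparison\<close> applies with \<open>dual d\<close> and \<open>dual h\<close>
    exchanged.\<close>
  have "dual (\<lambda>v. h v + - m v) \<le> dual h + dual (\<lambda>v. - m v)"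
    by (rule dual_add_le(2)[OF h(1) dual_uminus_le(1)[OF m]])
  then have dh: "dual d \<le> dual h + alpha T A * nrm e"
    using dual_uminus_le(2)[OF m] mm by (simp add: h_def)
  show "F \<le> c_const (alpha T A) * (norm_X T \<iota> A e)\<^sup>2"
    unfolding F X using hd
    by (intro c_const_comparison alpha_nonneg nrm_nonneg eY dual_nonneg[OF d] dual_nonneg[OF h(1)]) auto
  show "(norm_X T \<iota> A e)\<^sup>2 \<le> c_const (alpha T A) * F"
    unfolding F X using dh
    by (intro c_const_comparison alpha_nonneg nrm_nonneg eY dual_nonneg[OF d] dual_nonneg[OF h(1)]) auto
qed

end

theorem proposition5p2:
  fixes T :: real
    and \<iota> :: "'v::{real_inner,complete_space} \<Rightarrow>\<^sub>L 'h::{real_inner,complete_space}"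
    and A :: "real \<Rightarrow> 'v \<Rightarrow>\<^sub>L 'v \<Rightarrow>\<^sub>L real"
    and \<Delta> :: "'d set" and dinf \<delta> :: 'd
    and Xd Yd :: "'d \<Rightarrow> (real \<Rightarrow> 'v) set"
    and l :: "(real \<Rightarrow> 'v) \<Rightarrow> real" and u0 :: 'h
    and lam_d lam u_d u :: "real \<Rightarrow> 'v"
    and \<rho> :: real
  assumes "T > 0"
    and "gelfand_embedding \<iota>"
    and "admissible_operator T A"
    and "dinf \<in> \<Delta>" "Xd dinf = X_space T \<iota>" "Yd dinf = Y_space T"
    and "\<And>d. d \<in> \<Delta> \<Longrightarrow> closed_subspace (norm_X T \<iota> A) (X_space T \<iota>) (Xd d) \<and> nontrivial T (Xd d)"
    and "\<And>d. d \<in> \<Delta> \<Longrightarrow> closed_subspace (norm_Y T A) (Y_space T) (Yd d) \<and> nontrivial T (Yd d)"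
    and "\<And>d. d \<in> \<Delta> \<Longrightarrow> d \<noteq> dinf \<Longrightarrow> finite_dimensional T (Xd d) \<and> finite_dimensional T (Yd d)"
    and "\<And>d. d \<in> \<Delta> \<Longrightarrow> Xd d \<subseteq> Yd d"
    and "l \<in> Y_dual T"
    and "\<delta> \<in> \<Delta>"
    and "saddle_point_solution T \<iota> A (Xd \<delta>) (Yd \<delta>) l u0 lam_d u_d"
    and "lam \<in> Y_space T" "\<And>v. v \<in> Y_space T \<Longrightarrow> op_As T A lam v = l v - op_B T \<iota> A u_d v"
    and "u \<in> X_space T \<iota>" "\<And>v. v \<in> Y_space T \<Longrightarrow> op_B T \<iota> A u v = l v" "trace_at T \<iota> 0 u = u0"
    and "\<rho> \<ge> 0"
    and "norm_Y T A (\<lambda>t. lam t - lam_d t)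
           \<le> \<rho> * sqrt ((norm_Y T A lam_d)\<^sup>2
                  + (1 + 1 / (\<rho> + 1/2)\<^sup>2) * (norm (u0 - trace_at T \<iota> 0 u_d))\<^sup>2)"
  shows "1 / c_const (alpha T A) * (eta T \<iota> A u0 lam_d u_d)\<^sup>2 \<le> (norm_X T \<iota> A (\<lambda>t. u t - u_d t))\<^sup>2
    \<and> (norm_X T \<iota> A (\<lambda>t. u t - u_d t))\<^sup>2
       \<le> c_const (alpha T A) * (1 + \<rho>\<^sup>2 * (1 + 1 / (\<rho> + 1/2)\<^sup>2)) * (eta T \<iota> A u0 lam_d u_d)\<^sup>2"
proof -
  define Ld where "Ld = (norm_Y T A lam_d)\<^sup>2"
  define h where "h = (norm (u0 - trace_at T \<iota> 0 u_d))\<^sup>2"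
  define e where "e = (\<lambda>t. u t - u_d t)"
  define m where "m = 1 + 1 / (\<rho> + 1/2)\<^sup>2"
  obtain C0 where C0: "AE t in Xi T. norm (A t) \<le> C0"
    using \<open>admissible_operator T A\<close> unfolding admissible_operator_def by blast
  obtain c where c: "c > 0" "AE t in Xi T. \<forall>v. A t v v \<ge> c * (norm v)\<^sup>2"
    using \<open>admissible_operator T A\<close> unfolding admissible_operator_def by blast
  interpret parabolic_operator T A "max C0 0" c
  proof
    show "AE t in Xi T. norm (A t) \<le> max C0 0" using C0 by eventually_elim simp
    show "nontrivial T (Y_space T :: (real \<Rightarrow> 'v) set)" using assms(4,6) assms(8)[of dinf] by simp
    show "(\<lambda>t. A t w v) \<in> borel_measurable (Xi T)" for w v
      using \<open>admissible_operator T A\<close> by (simp add: admissible_operator_def)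
  qed (use \<open>T > 0\<close> c in auto)
  have u_d: "u_d \<in> X_space T \<iota>" and lam_d: "lam_d \<in> Yd \<delta>" "lam_d \<in> Y_space T"
    and saddle: "\<And>v. v \<in> Yd \<delta> \<Longrightarrow> op_As T A lam_d v + op_B T \<iota> A u_d v = l v"
    using assms(7,8)[OF \<open>\<delta> \<in> \<Delta>\<close>] assms(13) by (auto simp: saddle_point_solution_def closed_subspace_def)
  have e: "e \<in> X_space T \<iota>" unfolding e_def by (rule X_space_diff(1)[OF \<open>u \<in> X_space T \<iota>\<close> u_d])
  have Be: "op_As T A lam v = op_B T \<iota> A e v" if v: "v \<in> Y_space T" for v
  proof -
    have L: "v \<in> L2 T" "u \<in> L2 T" "u_d \<in> L2 T"
      using v X_space_D(1)[OF u_d] X_space_D(1)[OF \<open>u \<in> X_space T \<iota>\<close>] by (auto simp: Y_space_def)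
    have "op_A T A e v = op_A T A u v - op_A T A u_d v"
      unfolding op_A_def e_def using integrable_A[OF L(2,1)] integrable_A[OF L(3,1)]
      by (simp add: blinfun.diff_left blinfun.diff_right)
    then have "op_B T \<iota> A e v = op_B T \<iota> A u v - op_B T \<iota> A u_d v"
      using op_dt_diff[OF \<open>T > 0\<close> \<open>u \<in> X_space T \<iota>\<close> u_d L(1)] by (simp add: op_B_def e_def)
    then show ?thesis using assms(15,17)[OF v] by simp
  qed
  have "trace_at T \<iota> 0 e = u0 - trace_at T \<iota> 0 u_d"
    unfolding e_def using trace_at_diff[OF \<open>T > 0\<close> \<open>u \<in> X_space T \<iota>\<close> u_d, of 0] assms(18) \<open>T > 0\<close> by simp
  then have F: "(nrm lam)\<^sup>2 + h \<le> c_const (alpha T A) * (norm_X T \<iota> A e)\<^sup>2"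
    "(norm_X T \<iota> A e)\<^sup>2 \<le> c_const (alpha T A) * ((nrm lam)\<^sup>2 + h)"
    using residual_equivalence[OF e \<open>lam \<in> Y_space T\<close> Be] by (auto simp: h_def)
  \<comment> \<open>Galerkin orthogonality: both equations for lambda are tested with
    \<open>lam_d\<close>, which lies in the discrete space and in \<open>Y\<close>.\<close>
  have "op_As T A lam lam_d = op_As T A lam_d lam_d"
    using assms(15)[OF lam_d(2)] saddle[OF lam_d(1)] by simp
  then have pyth: "(norm_Y T A (\<lambda>t. lam t - lam_d t))\<^sup>2 = (nrm lam)\<^sup>2 - Ld"
    unfolding norm_Y_eq Ld_def by (rule nrm_diff_power2[OF \<open>lam \<in> Y_space T\<close> lam_d(2)])
  have eta: "(eta T \<iota> A u0 lam_d u_d)\<^sup>2 = Ld + h" by (simp add: eta_def Ld_def h_def)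
  have "Ld \<ge> 0" "h \<ge> 0" by (auto simp: Ld_def h_def)
  have "m \<ge> 1" by (simp add: m_def)
  have "c_const (alpha T A) > 0"
    using alpha_nonneg by (auto simp: c_const_def intro!: add_pos_nonneg mult_nonneg_nonneg add_nonneg_nonneg)
  have "(norm_Y T A (\<lambda>t. lam t - lam_d t))\<^sup>2 \<le> (\<rho> * sqrt (Ld + m * h))\<^sup>2"
    using assms(20) nrm_nonneg[of "\<lambda>t. lam t - lam_d t"] add_closed[OF \<open>lam \<in> Y_space T\<close> scale_closed[OF lam_d(2), of "-1"]]
    by (intro power_mono) (auto simp: Ld_def h_def m_def norm_Y_eq)
  also have "\<dots> = \<rho>\<^sup>2 * (Ld + m * h)"
    using \<open>Ld \<ge> 0\<close> \<open>h \<ge> 0\<close> \<open>m \<ge> 1\<close> by (simp add: power_mult_distrib)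
  \<comment> \<open>As \<open>m >= 1\<close>, the factor can be put on both terms, which turns the
    bracket into the squared estimator \<open>Ld + h\<close>.\<close>
  also have "\<dots> \<le> \<rho>\<^sup>2 * (m * (Ld + h))"
    using \<open>Ld \<ge> 0\<close> \<open>m \<ge> 1\<close> by (intro mult_left_mono) (auto simp: distrib_left mult_le_cancel_right1)
  finally have "(nrm lam)\<^sup>2 + h \<le> (1 + \<rho>\<^sup>2 * m) * (Ld + h)"
    using pyth by (simp add: algebra_simps)
  then have "c_const (alpha T A) * ((nrm lam)\<^sup>2 + h) \<le> c_const (alpha T A) * ((1 + \<rho>\<^sup>2 * m) * (Ld + h))"
    using \<open>c_const (alpha T A) > 0\<close> by (intro mult_left_mono) auto
  with F(2) have upper: "(norm_X T \<iota> A e)\<^sup>2 \<le> c_const (alpha T A) * (1 + \<rho>\<^sup>2 * m) * (Ld + h)"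
    by (simp add: mult.assoc)
  \<comment> \<open>By the Pythagorean identity, replacing \<open>lam_d\<close> by
    \<open>lam\<close> can only increase the residual.\<close>
  have "Ld + h \<le> (nrm lam)\<^sup>2 + h" using pyth zero_le_power2[of "norm_Y T A (\<lambda>t. lam t - lam_d t)"] by simp
  then have "Ld + h \<le> c_const (alpha T A) * (norm_X T \<iota> A e)\<^sup>2" using F(1) by simp
  then have lower: "1 / c_const (alpha T A) * (Ld + h) \<le> (norm_X T \<iota> A e)\<^sup>2"
    using \<open>c_const (alpha T A) > 0\<close> by (simp add: divide_le_eq mult.commute)
  show ?thesis using upper lower unfolding eta e_def m_def by blast
qed

end
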